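(* Suppose that $\mathbf{E}[\ln\rho_0]<0$; that there exists a unique $\kappa>0$ such that $\mathbf{E}[\rho_0^{\kappa}]=1$ and $\mathbf{E}[\rho_0^{\kappa}\ln^+\rho_0]<\infty$; and that there exists $\epsilon_0>0$ such that $\mathbf{E}[\rho_0^{-\epsilon_0}]<\infty$. Then for $\nu\in(0,1)$, $$\lim_{n\to\infty}\frac{\ln(-\ln P_\omega[X_n<-n^{\nu}])}{\ln n}=\nu\vee\frac{\kappa}{\kappa+1},\qquad\mathbf{P}\text{-a.s.},$$ $$\lim_{n\to\infty}\frac{\ln(-\ln\mathbb{P}[X_n<-n^{\nu}])}{\ln n}=\nu,$$ and $$\lim_{n\to\infty}\frac{\ln(-\ln\mathbb{P}[T_{-n^{\nu}}<n])}{\ln n}=\lim_{n\to\infty}\frac{\ln(-\ln P_\omega[T_{-n^{\nu}}<n])}{\ln n}=\nu,\qquad\mathbf{P}\text{-a.s.}$$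
   Context: Let $\omega=(\omega_i,\ i\in\mathbb{Z})$ be a family of i.i.d. random variables with values in $(0,1)$ (the environment); $\mathbf{P}$ is its law and $\mathbf{E}$ the corresponding expectation. Put $\rho_i=(1-\omega_i)/\omega_i$. Given $\omega$, the quenched law $P_\omega$ is the law of the nearest-neighbour Markov chain $(X_n)_{n\ge0}$ on $\mathbb{Z}$ with $X_0=0$ and $P_\omega[X_{n+1}=x+1\mid X_n=x]=\omega_x$, $P_\omega[X_{n+1}=x-1\mid X_n=x]=1-\omega_x$. The annealed law is $\mathbb{P}=\mathbf{P}\times P_\omega$ (semi-direct product), i.e. $\mathbb{P}[\cdot]=\int P_\omega[\cdot]\,d\mathbf{P}(\omega)$ for walk events. For $a\in\mathbb{Z}$, $T_a=\min\{n\ge0:X_n=a\}$, and for non-integer $a$, $T_a:=T_{\lfloor a\rfloor}$. Also $x\vee y=\max(x,y)$ and $\ln^+x=\max(\ln x,0)$. *)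

theory Defs
  imports "HOL-Probability.Probability"
begin

abbreviation env_space :: "(int \<Rightarrow> real) measure" where
  "env_space \<equiv> Pi\<^sub>M UNIV (\<lambda>_. borel)"

abbreviation path_space :: "(nat \<Rightarrow> int) measure" where
  "path_space \<equiv> Pi\<^sub>M UNIV (\<lambda>_. count_space UNIV)"

definition environment_law :: "'a measure \<Rightarrow> (int \<Rightarrow> 'a \<Rightarrow> real) \<Rightarrow> (int \<Rightarrow> real) measure" where
  "environment_law M W = distr M env_space (\<lambda>s i. W i s)"

definition rho :: "(int \<Rightarrow> real) \<Rightarrow> int \<Rightarrow> real" where
  "rho \<omega> i = (1 - \<omega> i) / \<omega> i"

definition ln_plus :: "real \<Rightarrow> real" where
  "ln_plus x = max (ln x) 0"


section \<open>The quenched law\<close>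

text \<open>
  The library truncates the parameter of \<^const>\<open>bernoulli_pmf\<close> to [0,1]; this plays no role for
  environments with values in (0,1).
\<close>

definition walk_step :: "(int \<Rightarrow> real) \<Rightarrow> int \<Rightarrow> int pmf" where
  "walk_step \<omega> x = map_pmf (\<lambda>right. if right then x + 1 else x - 1) (bernoulli_pmf (\<omega> x))"

text \<open>
  The kernel at time n gives the law of the position at time n as a function of the positions at
  the times before n.
\<close>

definition walk_kernel :: "(int \<Rightarrow> real) \<Rightarrow> nat \<Rightarrow> (nat \<Rightarrow> int) \<Rightarrow> int measure" where
  "walk_kernel \<omega> n X =
     (case n of 0 \<Rightarrow> measure_pmf (return_pmf 0) | Suc m \<Rightarrow> measure_pmf (walk_step \<omega> (X m)))"

interpretation walk: Ionescu_Tulcea "walk_kernel \<omega>" "\<lambda>_. count_space UNIV" for \<omega>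
proof (rule Ionescu_Tulcea.intro, goal_cases)
  case (1 i)
  show ?case
  proof (cases i)
    case 0
    then show ?thesis
      using measure_pmf_in_subprob_space by (auto simp: walk_kernel_def [abs_def])
  next
    case (Suc m)
    have "(\<lambda>X. X m) \<in> Pi\<^sub>M {0..<i} (\<lambda>_. count_space UNIV) \<rightarrow>\<^sub>M count_space UNIV"
      using Suc by (intro measurable_component_singleton) auto
    moreover have "(\<lambda>x. measure_pmf (walk_step \<omega> x)) \<in> count_space UNIV \<rightarrow>\<^sub>M subprob_algebra (count_space UNIV)"
      by (simp add: measure_pmf_in_subprob_space)
    ultimately show ?thesis
      unfolding walk_kernel_def Suc by (simp add: measurable_compose)
  qed
next
  case (2 i X)
  show ?case
    by (simp add: walk_kernel_def measure_pmf.prob_space_axioms split: nat.split)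
qed

text \<open>The Ionescu-Tulcea measure of these kernels on the space of all infinite paths.\<close>

definition quenched_law :: "(int \<Rightarrow> real) \<Rightarrow> (nat \<Rightarrow> int) measure" where
  "quenched_law \<omega> = walk.PF.lim \<omega>"

lemma sets_quenched_law [simp, measurable_cong]: "sets (quenched_law \<omega>) = sets path_space"
  by (simp add: quenched_law_def)

lemma space_quenched_law [simp]: "space (quenched_law \<omega>) = UNIV"
  using sets_eq_imp_space_eq[OF sets_quenched_law[of \<omega>]] by (simp add: space_PiM)

lemma pmf_walk_step:
  "pmf (walk_step \<omega> x) y =
     (if y = x + 1 then pmf (bernoulli_pmf (\<omega> x)) True
      else if y = x - 1 then pmf (bernoulli_pmf (\<omega> x)) False else 0)"
proof -
  let ?f = "\<lambda>right. if right then x + 1 else x - 1"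
  have inj: "inj ?f" by (auto simp: inj_def split: if_splits)
  have "pmf (walk_step \<omega> x) (x + 1) = pmf (bernoulli_pmf (\<omega> x)) True"
    "pmf (walk_step \<omega> x) (x - 1) = pmf (bernoulli_pmf (\<omega> x)) False"
    using pmf_map_inj'[OF inj, of "bernoulli_pmf (\<omega> x)" True]
      pmf_map_inj'[OF inj, of "bernoulli_pmf (\<omega> x)" False]
    by (simp_all add: walk_step_def)
  moreover have "pmf (walk_step \<omega> x) y = 0" if "y \<noteq> x + 1" "y \<noteq> x - 1"
    using that by (auto simp: pmf_eq_0_set_pmf walk_step_def)
  ultimately show ?thesis by auto
qed

lemma walk_step_probabilities:
  assumes "0 < \<omega> x" "\<omega> x < 1"
  shows "pmf (walk_step \<omega> x) (x + 1) = \<omega> x" "pmf (walk_step \<omega> x) (x - 1) = 1 - \<omega> x"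
  using assms by (auto simp: pmf_walk_step)

lemma sets_restrict_singleton:
  fixes y :: "nat \<Rightarrow> int"
  shows "{restrict y {0..<m}} \<in> sets (Pi\<^sub>M {0..<m} (\<lambda>_. count_space UNIV))"
proof -
  have "(\<Pi>\<^sub>E i\<in>{0..<m}. {restrict y {0..<m} i}) \<in> sets (Pi\<^sub>M {0..<m} (\<lambda>_. count_space UNIV))"
    by (intro sets_PiM_I_finite) auto
  then show ?thesis
    by (simp only: PiE_singleton[OF restrict_extensional])
qed

lemma emeasure_walk_C:
  "emeasure (walk.C \<omega> 0 m (\<lambda>_. undefined)) {restrict y {0..<m}} =
     (\<Prod>i<m. emeasure (walk_kernel \<omega> i y) {y i})"
proof (induction m)
  case 0
  show ?case by (simp add: space_PiM PiM_empty restrict_def)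
next
  case (Suc m)
  let ?P = "\<lambda>m. Pi\<^sub>M {0..<m} (\<lambda>_. count_space (UNIV :: int set))"
  let ?u = "\<lambda>_::nat. undefined :: int"
  have u: "?u \<in> space (?P 0)" by (simp add: space_PiM)
  note sing = sets_restrict_singleton
  have kern: "walk_kernel \<omega> m (restrict y {0..<m}) = walk_kernel \<omega> m y"
    by (simp add: walk_kernel_def split: nat.split)
  have sets_C: "sets (walk.C \<omega> 0 m ?u) = sets (?P m)"
    using walk.sets_C[OF u, of \<omega> m] by simp
  have space_C: "space (walk.C \<omega> 0 m ?u) = space (?P m)"
    using sets_C by (rule sets_eq_imp_space_eq)
  have "walk.eP \<omega> m \<in> walk.C \<omega> 0 m ?u \<rightarrow>\<^sub>M subprob_algebra (?P (Suc m))"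
    unfolding measurable_cong_sets[OF sets_C refl] by (rule walk.measurable_eP)
  moreover have "space (walk.C \<omega> 0 m ?u) \<noteq> {}"
    by (simp add: space_C space_PiM PiE_eq_empty_iff)
  moreover have "walk.C \<omega> 0 (Suc m) ?u = walk.C \<omega> 0 m ?u \<bind> walk.eP \<omega> m"
    by simp
  ultimately have "emeasure (walk.C \<omega> 0 (Suc m) ?u) {restrict y {0..<Suc m}} =
      (\<integral>\<^sup>+z. emeasure (walk.eP \<omega> m z) {restrict y {0..<Suc m}} \<partial>walk.C \<omega> 0 m ?u)"
    using emeasure_bind sing by metis
  also have "\<dots> = (\<integral>\<^sup>+z. emeasure (walk_kernel \<omega> m y) {y m} * indicator {restrict y {0..<m}} z \<partial>walk.C \<omega> 0 m ?u)"
  proof (rule nn_integral_cong)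
    fix z assume "z \<in> space (walk.C \<omega> 0 m ?u)"
    then have z: "z \<in> space (?P m)" using space_C by simp
    have "z(m := x) = restrict y {0..<Suc m} \<longleftrightarrow> z = restrict y {0..<m} \<and> x = y m" for x
    proof -
      have ext: "z i = undefined" if "i \<ge> m" for i
        using z that by (auto simp: space_PiM PiE_iff extensional_def)
      show ?thesis
      proof
        assume eq: "z(m := x) = restrict y {0..<Suc m}"
        have "z i = restrict y {0..<m} i" for i
          using fun_cong[OF eq, of i] ext[of i] by (cases "i < m") auto
        moreover have "x = y m"
          using fun_cong[OF eq, of m] by simp
        ultimately show "z = restrict y {0..<m} \<and> x = y m" by auto
      next
        assume "z = restrict y {0..<m} \<and> x = y m"
        then show "z(m := x) = restrict y {0..<Suc m}"
          by (auto simp: fun_eq_iff)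
      qed
    qed
    then have *: "(\<lambda>x. z(m := x)) -` {restrict y {0..<Suc m}} \<inter> space (count_space UNIV) =
        (if z = restrict y {0..<m} then {y m} else {})" by auto
    show "emeasure (walk.eP \<omega> m z) {restrict y {0..<Suc m}} =
        emeasure (walk_kernel \<omega> m y) {y m} * indicator {restrict y {0..<m}} z"
      unfolding walk.emeasure_eP[OF z sing] * by (simp add: kern)
  qed
  also have "\<dots> = emeasure (walk_kernel \<omega> m y) {y m} * emeasure (walk.C \<omega> 0 m ?u) {restrict y {0..<m}}"
    using sing[of y m] sets_C by (subst nn_integral_cmult_indicator) auto
  finally show ?case
    by (simp only: Suc prod.lessThan_Suc mult.commute)
qed

lemma emeasure_quenched_law_cylinder_kernel:
  "emeasure (quenched_law \<omega>) {X. \<forall>i<m. X i = y i} = (\<Prod>i<m. emeasure (walk_kernel \<omega> i y) {y i})"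
proof -
  let ?P = "Pi\<^sub>M {0..<m} (\<lambda>_. count_space (UNIV :: int set))"
  note sing = sets_restrict_singleton[of y m]
  have "{X. \<forall>i<m. X i = y i} = prod_emb UNIV (\<lambda>_. count_space UNIV) {0..<m} {restrict y {0..<m}}"
    by (auto simp: prod_emb_def restrict_def fun_eq_iff) metis
  then have "emeasure (quenched_law \<omega>) {X. \<forall>i<m. X i = y i} = emeasure (walk.CI \<omega> {0..<m}) {restrict y {0..<m}}"
    unfolding quenched_law_def using sing by (simp add: walk.lim)
  also have "\<dots> = emeasure (walk.C \<omega> 0 m (\<lambda>_. undefined)) {restrict y {0..<m}}"
  proof (subst walk.emeasure_CI[OF subset_refl sing])
    have "prod_emb {0..<m} (\<lambda>_. count_space (UNIV::int set)) {0..<m} {restrict y {0..<m}} = {restrict y {0..<m}}"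
      using sets.sets_into_space[OF sing] by (intro prod_emb_id) (auto simp: space_PiM)
    then show "emeasure (walk.C \<omega> 0 m (\<lambda>_. undefined))
        (prod_emb {0..<m} (\<lambda>_. count_space (UNIV::int set)) {0..<m} {restrict y {0..<m}}) =
        emeasure (walk.C \<omega> 0 m (\<lambda>_. undefined)) {restrict y {0..<m}}" by simp
  qed
  finally show ?thesis unfolding emeasure_walk_C .
qed

theorem emeasure_quenched_law_cylinder:
  "emeasure (quenched_law \<omega>) {X. \<forall>i\<le>n. X i = y i} =
     (if y 0 = 0 then ennreal (\<Prod>i<n. pmf (walk_step \<omega> (y i)) (y (Suc i))) else 0)"
proof -
  have "emeasure (quenched_law \<omega>) {X. \<forall>i\<le>n. X i = y i} =
      emeasure (quenched_law \<omega>) {X. \<forall>i<Suc n. X i = y i}"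
    by (simp add: less_Suc_eq_le)
  also have "\<dots> = emeasure (walk_kernel \<omega> 0 y) {y 0} * (\<Prod>i<n. emeasure (walk_kernel \<omega> (Suc i) y) {y (Suc i)})"
    unfolding emeasure_quenched_law_cylinder_kernel by (rule prod.lessThan_Suc_shift)
  also have "(\<Prod>i<n. emeasure (walk_kernel \<omega> (Suc i) y) {y (Suc i)}) =
      ennreal (\<Prod>i<n. pmf (walk_step \<omega> (y i)) (y (Suc i)))"
    by (simp add: walk_kernel_def emeasure_pmf_single prod_ennreal)
  finally show ?thesis by (auto simp: walk_kernel_def emeasure_pmf_single)
qed

lemma prob_space_quenched_law: "prob_space (quenched_law \<omega>)"
proof
  show "emeasure (quenched_law \<omega>) (space (quenched_law \<omega>)) = 1"
    using emeasure_quenched_law_cylinder_kernel[of \<omega> 0] by simp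
qed


section \<open>The annealed law\<close>

lemma sets_path_space_cylinders:
  "sets path_space = sigma_sets UNIV (insert {} (range (\<lambda>(n, y). {X. \<forall>i\<le>n. X i = y i})))"
    (is "_ = sigma_sets UNIV ?G")
proof
  have "{X::nat\<Rightarrow>int. \<forall>i\<le>n. X i = y i} \<in> sets path_space" for n y
  proof -
    have "{X::nat\<Rightarrow>int. \<forall>i\<le>n. X i = y i} = {X \<in> space path_space. \<forall>i\<in>{..n}. X i = y i}"
      by (auto simp: space_PiM)
    also have "\<dots> \<in> sets path_space" by measurable
    finally show ?thesis .
  qed
  then have G: "?G \<subseteq> sets path_space" by auto
  show "sigma_sets UNIV ?G \<subseteq> sets path_space"
    using sets.sigma_sets_subset[OF G] by (simp add: space_PiM)
  have "{X. X i \<in> A} \<in> sigma_sets UNIV ?G" for i and A :: "int set"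
  proof -
    let ?I = "{y \<in> (\<Pi>\<^sub>E j\<in>{..i}. UNIV). y i \<in> A}"
    have "countable ?I"
      by (rule countable_subset[OF _ countable_PiE[of "{..i}" "\<lambda>_. UNIV"]]) auto
    moreover have "{X. X i \<in> A} = (\<Union>y\<in>?I. {X. \<forall>j\<le>i. X j = y j})"
    proof (intro equalityI subsetI)
      fix X :: "nat \<Rightarrow> int" assume "X \<in> {X. X i \<in> A}"
      then show "X \<in> (\<Union>y\<in>?I. {X. \<forall>j\<le>i. X j = y j})"
        by (intro UN_I[of "restrict X {..i}"]) auto
    qed auto
    moreover have "{X. \<forall>j\<le>i. X j = y j} \<in> sigma_sets UNIV ?G" for y
      by (rule sigma_sets.Basic) (auto intro: image_eqI[of _ _ "(i, y)"])
    moreover have "sigma_algebra UNIV (sigma_sets UNIV ?G)"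
      by (rule sigma_algebra_sigma_sets) auto
    ultimately show ?thesis
      by (simp only:) (rule sigma_algebra.countable_UN', auto)
  qed
  then show "sets path_space \<subseteq> sigma_sets UNIV ?G"
    by (simp add: sets_PiM_single) (intro sigma_sets_mono, auto)
qed

lemma Int_stable_cylinders:
  "Int_stable (insert {} (range (\<lambda>(n, y). {X::nat\<Rightarrow>int. \<forall>i\<le>n. X i = y i})))" (is "Int_stable ?G")
proof -
  have *: "{X. \<forall>i\<le>n. X i = y i} \<inter> {X. \<forall>i\<le>m. X i = z i} \<in> ?G" if "n \<le> m" for n m and y z :: "nat \<Rightarrow> int"
  proof (cases "\<forall>i\<le>n. y i = z i")
    case True
    then have "{X. \<forall>i\<le>n. X i = y i} \<inter> {X. \<forall>i\<le>m. X i = z i} = {X. \<forall>i\<le>m. X i = z i}"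
      using that by auto
    then show ?thesis by (auto intro: image_eqI[of _ _ "(m, z)"])
  next
    case False
    then have "{X. \<forall>i\<le>n. X i = y i} \<inter> {X. \<forall>i\<le>m. X i = z i} = {}"
      using that by (auto dest: order_trans)
    then show ?thesis by simp
  qed
  show ?thesis
  proof (rule Int_stableI)
    fix A B assume AB: "A \<in> ?G" "B \<in> ?G"
    show "A \<inter> B \<in> ?G"
    proof (cases "A = {} \<or> B = {}")
      case False
      with AB obtain n y m z where "A = {X. \<forall>i\<le>n. X i = y i}" "B = {X. \<forall>i\<le>m. X i = z i}"
        by (elim insertE imageE) (simp_all add: split_beta)
      then show ?thesis
        using *[of n m y z] *[of m n z y] by (cases "n \<le> m") (simp_all only: Int_commute nat_le_linear)
    qed auto
  qed
qed

lemma measurable_quenched_law [measurable]: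
  "quenched_law \<in> env_space \<rightarrow>\<^sub>M subprob_algebra path_space"
proof (rule measurable_subprob_algebra_generated[OF sets_path_space_cylinders Int_stable_cylinders])
  have [measurable]: "(\<lambda>\<omega>. pmf (walk_step \<omega> x) y) \<in> borel_measurable env_space" for x y
  proof -
    have "pmf (bernoulli_pmf p) b = (if b then min 1 (max 0 p) else 1 - min 1 (max 0 p))" for p b
      by (simp add: bernoulli_pmf.rep_eq)
    then show ?thesis by (cases "y = x + 1"; cases "y = x - 1") (simp_all add: pmf_walk_step)
  qed
  show "(\<lambda>\<omega>. emeasure (quenched_law \<omega>) A) \<in> borel_measurable env_space"
    if "A \<in> insert {} (range (\<lambda>(n, y). {X. \<forall>i\<le>n. X i = y i}))" for A
    using that by (auto simp: emeasure_quenched_law_cylinder)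
  show "subprob_space (quenched_law \<omega>)" for \<omega>
    using prob_space_quenched_law by (rule prob_space_imp_subprob_space)
  show "(\<lambda>\<omega>. emeasure (quenched_law \<omega>) UNIV) \<in> borel_measurable env_space"
    using prob_space.emeasure_space_1[OF prob_space_quenched_law] by simp
qed auto

text \<open>The semi-direct product of the law P of the environment and the quenched laws.\<close>

definition annealed_law :: "(int \<Rightarrow> real) measure \<Rightarrow> ((int \<Rightarrow> real) \<times> (nat \<Rightarrow> int)) measure" where
  "annealed_law P =
     P \<bind> (\<lambda>\<omega>. distr (quenched_law \<omega>) (env_space \<Otimes>\<^sub>M path_space) (\<lambda>X. (\<omega>, X)))"

lemma emeasure_annealed_law:
  assumes P: "sets P = sets env_space" and A: "A \<in> sets path_space"
  shows "emeasure (annealed_law P) {(\<omega>, X). X \<in> A} = (\<integral>\<^sup>+\<omega>. emeasure (quenched_law \<omega>) A \<partial>P)"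
proof -
  have space: "space P = UNIV" using sets_eq_imp_space_eq[OF P] by (simp add: space_PiM)
  have "{(\<omega>, X). X \<in> A} = space env_space \<times> A" by (auto simp: space_PiM)
  then have meas: "{(\<omega>, X). X \<in> A} \<in> sets (env_space \<Otimes>\<^sub>M path_space)"
    using A by simp
  have "(\<lambda>\<omega>. distr (quenched_law \<omega>) (env_space \<Otimes>\<^sub>M path_space) (\<lambda>X. (\<omega>, X)))
      \<in> env_space \<rightarrow>\<^sub>M subprob_algebra (env_space \<Otimes>\<^sub>M path_space)"
    by (rule measurable_distr2[where M = path_space]) auto
  then have "(\<lambda>\<omega>. distr (quenched_law \<omega>) (env_space \<Otimes>\<^sub>M path_space) (\<lambda>X. (\<omega>, X)))
      \<in> P \<rightarrow>\<^sub>M subprob_algebra (env_space \<Otimes>\<^sub>M path_space)"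
    by (simp add: measurable_cong_sets[OF P refl])
  then have "emeasure (annealed_law P) {(\<omega>, X). X \<in> A} =
      (\<integral>\<^sup>+\<omega>. emeasure (distr (quenched_law \<omega>) (env_space \<Otimes>\<^sub>M path_space) (\<lambda>X. (\<omega>, X))) {(\<omega>, X). X \<in> A} \<partial>P)"
    unfolding annealed_law_def using meas space by (intro emeasure_bind) auto
  also have "\<dots> = (\<integral>\<^sup>+\<omega>. emeasure (quenched_law \<omega>) A \<partial>P)"
  proof (rule nn_integral_cong)
    fix \<omega>
    have "(\<lambda>X. (\<omega>, X)) \<in> quenched_law \<omega> \<rightarrow>\<^sub>M env_space \<Otimes>\<^sub>M path_space"
      by (rule measurable_Pair) (auto simp: space_PiM measurable_cong_sets[OF sets_quenched_law refl])
    then show "emeasure (distr (quenched_law \<omega>) (env_space \<Otimes>\<^sub>M path_space) (\<lambda>X. (\<omega>, X))) {(\<omega>, X). X \<in> A} =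
        emeasure (quenched_law \<omega>) A"
      using meas by (simp add: emeasure_distr vimage_def)
  qed
  finally show ?thesis .
qed


section \<open>Hitting times\<close>

text \<open>The infimum of the empty set is infinity. Non-integer levels are rounded down.\<close>

definition hitting_time :: "real \<Rightarrow> (nat \<Rightarrow> int) \<Rightarrow> enat" where
  "hitting_time a X = (INF n \<in> {n. X n = \<lfloor>a\<rfloor>}. enat n)"

lemma hitting_time_less_iff: "hitting_time a X < enat n \<longleftrightarrow> (\<exists>k<n. X k = \<lfloor>a\<rfloor>)"
  by (auto simp: hitting_time_def INF_less_iff)

lemma sets_hitting_time_less: "{X. hitting_time a X < enat n} \<in> sets path_space"
proof -
  have "{X. hitting_time a X < enat n} = {X \<in> space path_space. \<exists>k\<in>{..<n}. X k = \<lfloor>a\<rfloor>}"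
    by (auto simp: hitting_time_less_iff space_PiM)
  also have "\<dots> \<in> sets path_space" by measurable
  finally show ?thesis .
qed

end

theory Submission
  imports Defs "HOL-Real_Asymp.Real_Asymp"
begin

text \<open>
  Let E(x) be the exponential of the potential, so that E(x) / E(x-1) = \<open>\<rho>\<close>(x). All moments
  of \<open>\<rho>\<close> of order s in (0, \<open>\<kappa>\<close>) are less than 1. Hence, for every
  \<open>\<beta>\<close> > 1 / \<open>\<kappa>\<close>, almost surely E(y+k) / E(y) is at most K (1+|y|)^\<open>\<beta>\<close> exp(-2 \<open>\<gamma>\<close> k) for all
  y and k. The harmonic function h(x) = E(x) + E(x+1) + ... then bounds the probability to reach -m
  by h(0) / E(-m), which is exponentially small. A solution of the Poisson equation for
  exp(-\<open>\<gamma>\<close> x) is a Lyapunov function that contracts at rate L^(-\<open>\<beta>\<close>) within distance L of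
  the origin; with L = n^(1 / (1+\<open>\<beta>\<close>)) this shows that the walk is negative at time n with
  probability at most about exp(-L).

  For the lower bounds the walk goes straight to the left, at exponential cost in the distance, into
  a trap, where it survives n steps with probability about exp(-n exp(-depth)). The annealed
  probability can afford an environment that drifts to the left all along. In a typical environment
  there is a trap of depth about (1 / \<open>\<kappa>\<close>) ln N between -2N and -N, because products of
  independent copies of \<open>\<rho>\<close> have tails of exponent \<open>\<kappa>\<close>; one takes N = n^\<open>\<theta>\<close>,
  where \<open>\<theta>\<close> is the maximum of \<open>\<nu>\<close> and \<open>\<kappa>\<close> / (\<open>\<kappa>\<close>+1).
\<close>


section \<open>The walk in a fixed environment\<close>

text \<open>The threshold \<kappa>/(\<kappa>+1) is a balance. Walking to a trap at distance N costs
  a factor exp(-cN), and n steps in a trap of depth (1/\<kappa>) ln N cost about exp(-n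
  N^(-1/\<kappa>)); the exponents agree for N = n^(\<kappa>/(\<kappa>+1)). The upper bound meets it
  because 1/(1+\<beta>) tends to \<kappa>/(\<kappa>+1) as \<beta> decreases to 1/\<kappa>. Under the
  annealed law an environment drifting left over n^\<nu> sites costs as much as the walk there and
  forms a trap of depth linear in n^\<nu>, where staying is free; so only \<nu> is left.

  Integrating the quenched upper bound does not give the annealed one: the random constant K comes
  without moment bounds. Fractional moments replace it.

  Walk estimates are inequalities for powers of the monotone operator \<open>step_op\<close>: super-
  and subsolutions give bounds by induction on time, without stopping times, and the path measure
  enters only through one-time marginals. The double logarithm forgives constants and polynomial
  factors, so each rate is needed only up to a small change of the exponent.\<close>

definition step_op :: "(int \<Rightarrow> real) \<Rightarrow> (int \<Rightarrow> real) \<Rightarrow> int \<Rightarrow> real" where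
  "step_op \<omega> f x = \<omega> x * f (x + 1) + (1 - \<omega> x) * f (x - 1)"

abbreviation walk_prob :: "(int \<Rightarrow> real) \<Rightarrow> nat \<Rightarrow> int set \<Rightarrow> int \<Rightarrow> real" where
  "walk_prob \<omega> n A \<equiv> (step_op \<omega> ^^ n) (indicator A)"

locale environment =
  fixes \<omega> :: "int \<Rightarrow> real"
  assumes env_pos: "0 < \<omega> x" and env_less_1: "\<omega> x < 1"
begin

lemma step_op_mono: "(\<And>x. f x \<le> g x) \<Longrightarrow> step_op \<omega> f x \<le> step_op \<omega> g x"
  unfolding step_op_def using env_pos[of x] env_less_1[of x]
  by (intro add_mono mult_left_mono) auto

lemma funpow_step_mono: "(\<And>x. f x \<le> g x) \<Longrightarrow> (step_op \<omega> ^^ n) f x \<le> (step_op \<omega> ^^ n) g x"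
  by (induction n arbitrary: x) (auto intro: step_op_mono)

lemma step_op_const: "step_op \<omega> (\<lambda>_. c) x = c"
  by (simp add: step_op_def algebra_simps)

lemma walk_prob_bounds: "0 \<le> walk_prob \<omega> n A x" "walk_prob \<omega> n A x \<le> 1"
proof -
  have c: "(step_op \<omega> ^^ n) (\<lambda>_. c) = (\<lambda>_. c)" for c
    by (induction n) (auto simp: step_op_const)
  show "0 \<le> walk_prob \<omega> n A x"
    using funpow_step_mono[of "\<lambda>_. 0" "indicator A" n x] by (simp add: c)
  show "walk_prob \<omega> n A x \<le> 1"
    using funpow_step_mono[of "indicator A" "\<lambda>_. 1" n x] by (simp add: c indicator_def)
qed

lemma walk_prob_mono: "A \<subseteq> B \<Longrightarrow> walk_prob \<omega> n A x \<le> walk_prob \<omega> n B x"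
  by (intro funpow_step_mono) (auto simp: indicator_def)

lemma nn_integral_walk_step:
  "(\<integral>\<^sup>+y. ennreal (f y) \<partial>measure_pmf (walk_step \<omega> x)) = ennreal (step_op \<omega> f x)" if "\<And>y. 0 \<le> f y"
  using env_pos[of x] env_less_1[of x] that
  by (simp add: walk_step_def step_op_def nn_integral_map_pmf ennreal_mult'' ennreal_plus mult.commute)

text \<open>The Markov property for one-time marginals: the finite-dimensional measure gains its
  last coordinate from the kernel, so integrating that coordinate out replaces \<open>f\<close> by
  \<open>step_op \<omega> f\<close>.\<close>

lemma nn_integral_quenched_Suc:
  assumes f: "\<And>y. 0 \<le> f y"
  shows "(\<integral>\<^sup>+X. ennreal (f (X (Suc n))) \<partial>quenched_law \<omega>) = (\<integral>\<^sup>+X. ennreal (step_op \<omega> f (X n)) \<partial>quenched_law \<omega>)"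
proof -
  let ?P = "\<lambda>m::nat. Pi\<^sub>M {0..<m} (\<lambda>_. count_space (UNIV :: int set))"
  let ?C = "\<lambda>m. walk.C \<omega> 0 m (\<lambda>_. undefined)"
  have sets_C: "sets (?C m) = sets (?P m)" for m :: nat
    using walk.sets_C[of "\<lambda>_. undefined" 0 \<omega> m] by (simp add: space_PiM)
  have meas: "(\<lambda>X. X i) \<in> ?P m \<rightarrow>\<^sub>M count_space UNIV" if "i < m" for i m :: nat
    using that by (intro measurable_component_singleton) auto
  \<comment> \<open>The finite-dimensional laws of the limit measure are the iterated kernels, so
    statements about the infinite path reduce to \<open>?C\<close>.\<close>
  have C_lim: "?C m = distr (quenched_law \<omega>) (?P m) (\<lambda>X. restrict X {0..<m})" for m :: nat
  proof -
    have "distr (quenched_law \<omega>) (?P m) (\<lambda>X. restrict X {0..<m}) = walk.CI \<omega> {0..<m}"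
      unfolding quenched_law_def by (rule walk.distr_lim) auto
    also have "\<dots> = ?C m"
    proof (rule measure_eqI)
      show "sets (walk.CI \<omega> {0..<m}) = sets (?C m)"
        by (simp add: walk.CI_def sets_C)
      fix A assume "A \<in> sets (walk.CI \<omega> {0..<m})"
      then have A: "A \<in> sets (?P m)" by (simp add: walk.CI_def)
      have emb: "prod_emb {0..<m} (\<lambda>_. count_space (UNIV::int set)) {0..<m} A = A"
        using sets.sets_into_space[OF A] by (intro prod_emb_id) (auto simp: space_PiM)
      show "emeasure (walk.CI \<omega> {0..<m}) A = emeasure (?C m) A"
        using walk.emeasure_CI[OF subset_refl A, of \<omega>] emb by simp
    qed
    finally show ?thesis by simp
  qed
  have *: "(\<integral>\<^sup>+X. g (X i) \<partial>quenched_law \<omega>) = (\<integral>\<^sup>+X. g (X i) \<partial>?C m)" if "i < m" for g :: "int \<Rightarrow> ennreal" and i m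
    unfolding C_lim using that meas[OF that]
    by (subst nn_integral_distr) (auto intro!: measurable_restrict measurable_component_singleton
        simp: measurable_cong_sets[OF sets_quenched_law refl])
  let ?n = "Suc n"
  have eP: "walk.eP \<omega> ?n \<in> ?C ?n \<rightarrow>\<^sub>M subprob_algebra (?P (Suc ?n))"
    unfolding measurable_cong_sets[OF sets_C refl] by (rule walk.measurable_eP)
  have "(\<integral>\<^sup>+X. ennreal (f (X ?n)) \<partial>quenched_law \<omega>) = (\<integral>\<^sup>+X. ennreal (f (X ?n)) \<partial>?C (Suc ?n))"
    by (rule *) simp
  also have "\<dots> = (\<integral>\<^sup>+X. ennreal (f (X ?n)) \<partial>(?C ?n \<bind> walk.eP \<omega> ?n))"
    by simp
  also have "\<dots> = (\<integral>\<^sup>+z. (\<integral>\<^sup>+X. ennreal (f (X ?n)) \<partial>walk.eP \<omega> ?n z) \<partial>?C ?n)"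
    using meas[of ?n "Suc ?n"] by (intro nn_integral_bind[OF _ eP]) auto
  also have "\<dots> = (\<integral>\<^sup>+z. ennreal (step_op \<omega> f (z n)) \<partial>?C ?n)"
  proof (rule nn_integral_cong)
    fix z assume "z \<in> space (?C ?n)"
    then have z: "z \<in> space (?P ?n)" unfolding sets_eq_imp_space_eq[OF sets_C] .
    have "(\<integral>\<^sup>+X. ennreal (f (X ?n)) \<partial>walk.eP \<omega> ?n z) = (\<integral>\<^sup>+x. ennreal (f x) \<partial>walk_kernel \<omega> ?n z)"
      using meas[of ?n "Suc ?n"] by (subst walk.nn_integral_eP[OF z]) auto
    also have "\<dots> = ennreal (step_op \<omega> f (z n))"
      using f by (simp add: walk_kernel_def nn_integral_walk_step)
    finally show "(\<integral>\<^sup>+X. ennreal (f (X ?n)) \<partial>walk.eP \<omega> ?n z) = ennreal (step_op \<omega> f (z n))" .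
  qed
  also have "\<dots> = (\<integral>\<^sup>+X. ennreal (step_op \<omega> f (X n)) \<partial>quenched_law \<omega>)"
    by (rule *[symmetric]) simp
  finally show ?thesis .
qed

lemma AE_quenched_start: "AE X in quenched_law \<omega>. X 0 = 0"
proof -
  interpret prob_space "quenched_law \<omega>" by (rule prob_space_quenched_law)
  have "emeasure (quenched_law \<omega>) {X. X 0 = 0} = 1"
    using emeasure_quenched_law_cylinder[of \<omega> 0 "\<lambda>_. 0"] by simp
  then have "AE X in quenched_law \<omega>. X \<in> {X. X 0 = 0}"
    by (intro AE_prob_1) (simp add: measure_def)
  then show ?thesis by simp
qed

theorem measure_quenched_law_walk_prob:
  "measure (quenched_law \<omega>) {X. X n \<in> A} = walk_prob \<omega> n A 0"
proof -
  interpret prob_space "quenched_law \<omega>" by (rule prob_space_quenched_law)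
  \<comment> \<open>Each removed time step moves one application of the operator onto the test
    function; at time 0 the path sits at 0.\<close>
  have step: "(\<integral>\<^sup>+X. ennreal (f (X n)) \<partial>quenched_law \<omega>) = ennreal ((step_op \<omega> ^^ n) f 0)"
    if "\<And>y. 0 \<le> f y" for f
    using that
  proof (induction n arbitrary: f)
    case 0
    have "(\<integral>\<^sup>+X. ennreal (f (X 0)) \<partial>quenched_law \<omega>) = (\<integral>\<^sup>+X. ennreal (f 0) \<partial>quenched_law \<omega>)"
      using AE_quenched_start by (intro nn_integral_cong_AE) auto
    also have "\<dots> = ennreal (f 0)"
      using emeasure_space_1 by simp
    finally show ?case by simp
  next
    case (Suc n)
    have "0 \<le> step_op \<omega> f y" for y
      using step_op_mono[of "\<lambda>_. 0" f y] Suc.prems by (simp add: step_op_const)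
    then show ?case
      using Suc by (simp add: nn_integral_quenched_Suc funpow_swap1)
  qed
  have "emeasure (quenched_law \<omega>) {X. X n \<in> A} = (\<integral>\<^sup>+X. indicator {X. X n \<in> A} X \<partial>quenched_law \<omega>)"
  proof (rule nn_integral_indicator[symmetric])
    have "{X. X n \<in> A} = {X \<in> space path_space. X n \<in> A}" by (simp add: space_PiM)
    also have "\<dots> \<in> sets path_space" by measurable
    finally show "{X. X n \<in> A} \<in> sets (quenched_law \<omega>)" by simp
  qed
  also have "\<dots> = (\<integral>\<^sup>+X. ennreal (indicator A (X n)) \<partial>quenched_law \<omega>)"
    by (intro nn_integral_cong) (auto simp: indicator_def)
  also have "\<dots> = ennreal (walk_prob \<omega> n A 0)"
    by (rule step) simp
  finally show ?thesis
    using walk_prob_bounds(1) by (simp add: measure_def)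
qed

end

section \<open>The potential and survival inside a trap\<close>

definition weight :: "(int \<Rightarrow> real) \<Rightarrow> int \<Rightarrow> real" where
  "weight \<omega> x = (if 0 \<le> x then \<Prod>i\<in>{1..x}. rho \<omega> i else inverse (\<Prod>i\<in>{x+1..0}. rho \<omega> i))"

context environment
begin

lemma rho_pos: "0 < rho \<omega> x"
  using env_pos[of x] env_less_1[of x] by (simp add: rho_def)

lemma weight_pos: "0 < weight \<omega> x"
  by (auto simp: weight_def intro!: prod_pos rho_pos)

text \<open>Taking the inverse product on the negative half-line makes one recursion valid on all of
  Z, with value 1 at 0.\<close>

lemma weight_rec: "weight \<omega> x = rho \<omega> x * weight \<omega> (x - 1)"
proof (cases "x \<ge> 1")
  case True
  then have "{1..x} = insert x {1..x-1}" by auto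
  then show ?thesis using True by (simp add: weight_def)
next
  case False
  then have "{x..0} = insert x {x+1..0}" by auto
  then show ?thesis using False rho_pos[of x] by (auto simp: weight_def)
qed

text \<open>Detailed balance. It makes every function whose decrements are proportional to
  \<open>weight\<close> harmonic.\<close>

lemma weight_balance: "\<omega> x * weight \<omega> x = (1 - \<omega> x) * weight \<omega> (x - 1)"
  using env_pos[of x] by (subst weight_rec) (simp add: rho_def)

lemma weight_ratio: "weight \<omega> (y + int k) = weight \<omega> y * (\<Prod>i\<in>{y+1..y+int k}. rho \<omega> i)"
proof (induction k)
  case (Suc k)
  have "{y+1..y+int (Suc k)} = insert (y + int (Suc k)) {y+1..y+int k}" by auto
  then show ?case
    using Suc weight_rec[of "y + int (Suc k)"] by (simp add: algebra_simps)
qed simp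

lemma step_op_nonneg: "(\<And>x. 0 \<le> f x) \<Longrightarrow> 0 \<le> step_op \<omega> f x"
  using step_op_mono[of "\<lambda>_. 0" f x] by (simp add: step_op_const)

lemma step_op_scale: "step_op \<omega> (\<lambda>x. c * f x) x = c * step_op \<omega> f x"
  by (simp add: step_op_def algebra_simps)

text \<open>Of all trajectories only those whose first m steps go left are kept.\<close>

lemma walk_prob_straight_path:
  "(\<Prod>i<m. 1 - \<omega> (x - int i)) * walk_prob \<omega> k A (x - int m) \<le> walk_prob \<omega> (m + k) A x"
proof (induction m arbitrary: x)
  case (Suc m)
  have "(\<Prod>i<Suc m. 1 - \<omega> (x - int i)) * walk_prob \<omega> k A (x - int (Suc m))
      = (1 - \<omega> x) * ((\<Prod>i<m. 1 - \<omega> (x - 1 - int i)) * walk_prob \<omega> k A (x - 1 - int m))"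
    by (simp only: prod.lessThan_Suc_shift) (simp add: diff_diff_eq add.commute mult_ac)
  also have "\<dots> \<le> (1 - \<omega> x) * walk_prob \<omega> (m + k) A (x - 1)"
    using Suc[of "x - 1"] env_less_1[of x] by (intro mult_left_mono) auto
  also have "\<dots> \<le> step_op \<omega> (walk_prob \<omega> (m + k) A) x"
    using walk_prob_bounds(1)[of "m + k" A "x + 1"] env_pos[of x] by (simp add: step_op_def)
  finally show ?case by simp
qed simp

text \<open>
  The subsolution is the probability to reach x before d+1; only at x is it not harmonic, and an
  excursion from there to d+1 succeeds with probability at most the ratio of the weights.
\<close>

lemma walk_prob_trap:
  assumes xd: "x \<le> d" and le: "weight \<omega> x \<le> weight \<omega> d"
  shows "(1 - weight \<omega> x / weight \<omega> d) ^ k \<le> walk_prob \<omega> k {..d} x"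
proof -
  define H where "H y = (\<Sum>j\<in>{y..d}. weight \<omega> j)" for y
  define g where "g y = (if y \<le> x then 1 else H y / H x)" for y
  define q where "q = weight \<omega> x / weight \<omega> d"
  have H_step: "H y = weight \<omega> y + H (y + 1)" if "y \<le> d" for y
  proof -
    have "{y..d} = insert y {y+1..d}" using that by auto
    then show ?thesis by (simp add: H_def)
  qed
  have H_nonneg: "0 \<le> H y" for y
    unfolding H_def by (intro sum_nonneg less_imp_le weight_pos)
  have H0: "H y = 0" if "d < y" for y using that by (simp add: H_def)
  \<comment> \<open>Keeping only the term at d turns the exact exit probability
    \<open>weight \<omega> x / H x\<close> of an excursion into the bound q.\<close>
  have H_d: "weight \<omega> d \<le> H x"
    unfolding H_def using assms by (intro member_le_sum) (auto intro: less_imp_le weight_pos)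
  then have Hx: "0 < H x" using weight_pos[of d] by linarith
  have q: "0 \<le> q" "q \<le> 1"
    using weight_pos[of x] weight_pos[of d] le by (auto simp: q_def)
  have g: "0 \<le> g y" "g y \<le> indicator {..d} y" for y
  proof -
    show "0 \<le> g y" using H_nonneg by (simp add: g_def)
    have "H y \<le> H x" if "x < y"
      unfolding H_def using that by (intro sum_mono2) (auto intro: less_imp_le weight_pos)
    then show "g y \<le> indicator {..d} y"
      using assms Hx H0[of y] by (auto simp: g_def indicator_def)
  qed
  have sub: "(1 - q) * g y \<le> step_op \<omega> g y" for y
  proof -
    consider "y < x" | "y = x" | "x < y" "y \<le> d" | "d < y" by linarith
    then show ?thesis
    proof cases
      case 1
      then show ?thesis using q by (simp add: step_op_def g_def)
    next
      case 2
      have "g (x + 1) = 1 - weight \<omega> x / H x"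
        using H_step[OF xd] Hx by (simp add: g_def field_simps)
      moreover have "g (x - 1) = 1" by (simp add: g_def)
      ultimately have "step_op \<omega> g x = 1 - \<omega> x * (weight \<omega> x / H x)"
        unfolding step_op_def by (simp only:) (simp add: right_diff_distrib)
      moreover have "\<omega> x * (weight \<omega> x / H x) \<le> 1 * (weight \<omega> x / weight \<omega> d)"
        using env_pos[of x] env_less_1[of x] weight_pos[of x] weight_pos[of d] H_d Hx
        by (intro mult_mono divide_left_mono) auto
      ultimately show ?thesis using 2 by (simp add: g_def q_def)
    next
      case 3
      have g': "g z = H z / H x" if "x \<le> z" for z
        using that Hx by (cases "z = x") (auto simp: g_def)
      have "step_op \<omega> g y = (\<omega> y * H (y + 1) + (1 - \<omega> y) * H (y - 1)) / H x"
        using 3 by (simp add: step_op_def g' add_divide_distrib)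
      also have "\<dots> = (H y - \<omega> y * weight \<omega> y + (1 - \<omega> y) * weight \<omega> (y - 1)) / H x"
        using 3 H_step[of y] H_step[of "y - 1"] by (simp add: algebra_simps)
      also have "\<dots> = g y" using 3 by (simp add: weight_balance g')
      finally show ?thesis using q g[of y] by (simp add: mult_left_le_one_le)
    next
      case 4
      then have "g y = 0" using assms H0 by (simp add: g_def)
      then show ?thesis using step_op_nonneg[of g y] g by simp
    qed
  qed
  \<comment> \<open>The one-step inequality is iterated by monotonicity; that g lies below the
    indicator of {..d} starts the induction.\<close>
  have "(1 - q) ^ k * g y \<le> walk_prob \<omega> k {..d} y" for y
  proof (induction k arbitrary: y)
    case 0
    then show ?case using g by simp
  next
    case (Suc k)
    have "(1 - q) ^ Suc k * g y \<le> (1 - q) ^ k * step_op \<omega> g y"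
      using mult_left_mono[OF sub[of y], of "(1 - q) ^ k"] q by (simp add: mult_ac)
    also have "\<dots> = step_op \<omega> (\<lambda>y. (1 - q) ^ k * g y) y"
      by (simp add: step_op_scale)
    also have "\<dots> \<le> walk_prob \<omega> (Suc k) {..d} y"
      using Suc by (auto intro!: step_op_mono)
    finally show ?case .
  qed
  from this[of x] show ?thesis by (simp add: g_def q_def)
qed

end

section \<open>Supersolutions in an environment with decaying weights\<close>

locale regular_environment = environment +
  fixes K \<beta> \<gamma> :: real
  assumes beta_nonneg: "0 \<le> \<beta>" and gamma_pos: "0 < \<gamma>"
    and weight_decay: "weight \<omega> (y + int k) \<le> K * (1 + \<bar>real_of_int y\<bar>) powr \<beta> * exp (- (2 * \<gamma> * real k)) * weight \<omega> y"
begin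

lemma K_ge_1: "1 \<le> K"
  using weight_decay[of 0 0] by (simp add: weight_def)

definition escape :: "int \<Rightarrow> real" where
  "escape x = (\<Sum>k. weight \<omega> (x + int k))"

lemma summable_exp_gamma: "summable (\<lambda>k. exp (- (2 * \<gamma> * real k)))"
proof -
  have "summable (\<lambda>k. exp (- (2 * \<gamma>)) ^ k)"
    using gamma_pos by (intro summable_geometric) simp
  then show ?thesis by (simp add: exp_of_nat_mult[symmetric] mult.commute)
qed

lemma summable_weight: "summable (\<lambda>k. weight \<omega> (x + int k))"
proof (rule summable_comparison_test')
  show "summable (\<lambda>k. K * (1 + \<bar>real_of_int x\<bar>) powr \<beta> * exp (- (2 * \<gamma> * real k)) * weight \<omega> x)"
    by (intro summable_mult summable_mult2 summable_exp_gamma)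
  show "norm (weight \<omega> (x + int k)) \<le> K * (1 + \<bar>real_of_int x\<bar>) powr \<beta> * exp (- (2 * \<gamma> * real k)) * weight \<omega> x" for k
    using weight_decay[of x k] weight_pos[of "x + int k"] by simp
qed

lemma escape_rec: "escape x = weight \<omega> x + escape (x + 1)"
  using suminf_split_head[OF summable_weight[of x]] by (simp add: escape_def algebra_simps)

lemma escape_pos: "0 < escape x"
  unfolding escape_def by (intro suminf_pos summable_weight weight_pos)

lemma weight_le_escape: "weight \<omega> x \<le> escape x"
  using escape_rec[of x] escape_pos[of "x + 1"] by linarith

lemma escape_antimono: "x \<le> y \<Longrightarrow> escape y \<le> escape x"
proof (induction y rule: int_ge_induct)
  case (step y)
  then show ?case using escape_rec[of y] weight_pos[of y] by linarith
qed simp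

lemma escape_harmonic: "step_op \<omega> escape x = escape x"
  using weight_balance[of x] escape_rec[of x] escape_rec[of "x - 1"]
  by (simp add: step_op_def algebra_simps)

text \<open>The quotient is harmonic and, as \<open>escape\<close> decreases, at least 1 on {..a}.
  The monotone operator preserves the domination of the indicator, so the bound holds at every
  time.\<close>

lemma walk_prob_atMost_le: "walk_prob \<omega> k {..a} x \<le> escape x / escape a"
proof (induction k arbitrary: x)
  case 0
  show ?case
    using escape_antimono[of x a] escape_pos[of a] escape_pos[of x] by (auto simp: indicator_def)
next
  case (Suc k)
  have "walk_prob \<omega> (Suc k) {..a} x \<le> step_op \<omega> (\<lambda>x. (1 / escape a) * escape x) x"
    using Suc by (auto intro!: step_op_mono)
  also have "\<dots> = escape x / escape a"
    by (simp only: step_op_scale escape_harmonic) simp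
  finally show ?case .
qed

lemma escape_decay: "escape (int L) \<le> K * (\<Sum>k. exp (- (2 * \<gamma> * real k))) * exp (- (2 * \<gamma> * real L))"
proof -
  have "escape (int L) \<le> (\<Sum>k. K * exp (- (2 * \<gamma> * real L)) * exp (- (2 * \<gamma> * real k)))"
    unfolding escape_def
  proof (intro suminf_le summable_weight summable_mult summable_exp_gamma)
    show "weight \<omega> (int L + int k) \<le> K * exp (- (2 * \<gamma> * real L)) * exp (- (2 * \<gamma> * real k))" for k
      using weight_decay[of 0 "L + k"] by (simp add: weight_def exp_add[symmetric] algebra_simps)
  qed
  also have "\<dots> = K * exp (- (2 * \<gamma> * real L)) * (\<Sum>k. exp (- (2 * \<gamma> * real k)))"
    by (intro suminf_mult summable_exp_gamma)
  finally show ?thesis by (simp add: mult_ac)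
qed

lemma inverse_escape_decay:
  "1 / escape (- int L) \<le> K * (1 + real L) powr \<beta> * exp (- (2 * \<gamma> * real L))"
proof -
  \<comment> \<open>The 1 on the left is \<open>weight \<omega> 0\<close>, reached from -L after L
    steps of decay.\<close>
  have "1 \<le> K * (1 + real L) powr \<beta> * exp (- (2 * \<gamma> * real L)) * weight \<omega> (- int L)"
    using weight_decay[of "- int L" L] by (simp add: weight_def)
  also have "\<dots> \<le> K * (1 + real L) powr \<beta> * exp (- (2 * \<gamma> * real L)) * escape (- int L)"
    using K_ge_1 by (intro mult_left_mono weight_le_escape) auto
  finally show ?thesis using escape_pos[of "- int L"] by (simp add: field_simps)
qed

lemma walk_prob_far_left:
  "walk_prob \<omega> k {..- int L} 0 \<le> escape 0 * K * (1 + real L) powr \<beta> * exp (- (2 * \<gamma> * real L))"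
proof -
  have "walk_prob \<omega> k {..- int L} 0 \<le> escape 0 * (1 / escape (- int L))"
    using walk_prob_atMost_le[of k "- int L" 0] by simp
  also have "\<dots> \<le> escape 0 * (K * (1 + real L) powr \<beta> * exp (- (2 * \<gamma> * real L)))"
    using escape_pos[of 0] by (intro mult_left_mono inverse_escape_decay) auto
  finally show ?thesis by (simp add: mult_ac)
qed

text \<open>
  \<open>stationary\<close> is the reversible measure of the walk, and \<open>lyapunov\<close> is the Green potential
  of exp(-\<open>\<gamma>\<close> x): its increment at j is E(j) times the integral of exp(-\<open>\<gamma>\<close> y) over
  y \<open>\<le>\<close> j with respect to that measure.
\<close>

definition stationary :: "int \<Rightarrow> real" where
  "stationary y = 1 / weight \<omega> y + 1 / weight \<omega> (y - 1)"

definition slope :: "int \<Rightarrow> real" where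
  "slope j = (\<Sum>k. stationary (j - int k) * exp (- \<gamma> * real_of_int (j - int k)))"

definition lyapunov :: "int \<Rightarrow> real" where
  "lyapunov x = (\<Sum>i. weight \<omega> (x + int i) * slope (x + int i))"

text \<open>What remains of the estimates once position and distance are separated. The base is 2+k
  rather than 1+k because \<open>stationary y\<close> also involves the neighbour y-1.\<close>

definition poly_exp :: "nat \<Rightarrow> real" where
  "poly_exp k = (2 + real k) powr \<beta> * exp (- (\<gamma> * real k))"

lemma summable_poly_exp: "summable poly_exp"
proof (rule summable_comparison_test_bigo)
  have "summable (\<lambda>k. exp (- (\<gamma> / 2)) ^ k)"
    using gamma_pos by (intro summable_geometric) simp
  then show "summable (\<lambda>k. norm (exp (- (\<gamma> / 2) * real k)))"
    by (simp add: exp_of_nat_mult[symmetric] mult.commute)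
  show "poly_exp \<in> O(\<lambda>k. exp (- (\<gamma> / 2) * real k))"
    unfolding poly_exp_def using gamma_pos by real_asymp
qed

lemma suminf_poly_exp_pos: "0 < suminf poly_exp"
  by (intro suminf_pos summable_poly_exp) (simp add: poly_exp_def)

lemma stationary_pos: "0 < stationary y"
  unfolding stationary_def using weight_pos by (intro add_pos_pos) auto

text \<open>Half of the decay rate 2 \<gamma> is spent on the source, which grows like exp(\<gamma>
  k) when moving k sites to the left; the other half makes the sum over k converge. The two terms of
  \<open>stationary\<close> lie k and k+1 sites left of j, and both allow the same separation of j
  from k.\<close>

lemma stationary_weight_bound:
  "weight \<omega> j * (stationary (j - int k) * exp (- \<gamma> * real_of_int (j - int k)))
    \<le> 2 * K * (1 + \<bar>real_of_int j\<bar>) powr \<beta> * exp (- \<gamma> * real_of_int j) * poly_exp k"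
proof -
  let ?J = "1 + \<bar>real_of_int j\<bar>"
  let ?R = "K * (?J * (2 + real k)) powr \<beta> * exp (- (2 * \<gamma> * real k))"
  have J: "1 + \<bar>real_of_int j - t\<bar> \<le> ?J * (2 + real k)" if "0 \<le> t" "t \<le> real k + 1" for t
  proof -
    have "1 + \<bar>real_of_int j - t\<bar> \<le> 2 + real k + \<bar>real_of_int j\<bar> * 1" using that by linarith
    also have "\<dots> \<le> 2 + real k + \<bar>real_of_int j\<bar> * (2 + real k)" by (intro add_left_mono mult_left_mono) auto
    finally show ?thesis by (simp add: algebra_simps)
  qed
  have "weight \<omega> j \<le> K * (1 + \<bar>real_of_int (j - int k)\<bar>) powr \<beta> * exp (- (2 * \<gamma> * real k)) * weight \<omega> (j - int k)"
    using weight_decay[of "j - int k" k] by simp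
  also have "\<dots> \<le> ?R * weight \<omega> (j - int k)"
    using J[of "real k"] K_ge_1 beta_nonneg weight_pos[of "j - int k"]
    by (intro mult_right_mono mult_left_mono powr_mono2) (auto intro: less_imp_le)
  finally have 1: "weight \<omega> j / weight \<omega> (j - int k) \<le> ?R"
    using weight_pos[of "j - int k"] by (simp add: field_simps)
  have "weight \<omega> j \<le> K * (1 + \<bar>real_of_int (j - int k - 1)\<bar>) powr \<beta> * exp (- (2 * \<gamma> * real (Suc k))) * weight \<omega> (j - int k - 1)"
    using weight_decay[of "j - int k - 1" "Suc k"] by simp
  also have "\<dots> \<le> ?R * weight \<omega> (j - int k - 1)"
    using J[of "real k + 1"] K_ge_1 beta_nonneg gamma_pos weight_pos[of "j - int k - 1"]
    by (intro mult_right_mono mult_mono powr_mono2) (auto intro: less_imp_le simp: algebra_simps)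
  finally have 2: "weight \<omega> j / weight \<omega> (j - int k - 1) \<le> ?R"
    using weight_pos[of "j - int k - 1"] by (simp add: field_simps)
  have "weight \<omega> j * stationary (j - int k) \<le> 2 * ?R"
    using 1 2 by (simp add: stationary_def ring_distribs)
  then have "weight \<omega> j * stationary (j - int k) * exp (- \<gamma> * real_of_int (j - int k))
      \<le> 2 * ?R * exp (- \<gamma> * real_of_int (j - int k))"
    by (intro mult_right_mono) auto
  also have "\<dots> = 2 * K * ?J powr \<beta> * (2 + real k) powr \<beta> *
      (exp (- (2 * \<gamma> * real k)) * exp (- \<gamma> * real_of_int (j - int k)))"
    by (simp add: powr_mult mult_ac)
  also have "exp (- (2 * \<gamma> * real k)) * exp (- \<gamma> * real_of_int (j - int k))
      = exp (- \<gamma> * real_of_int j) * exp (- (\<gamma> * real k))"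
    by (simp add: exp_add[symmetric] algebra_simps)
  finally show ?thesis by (simp add: poly_exp_def mult_ac)
qed

lemma summable_slope: "summable (\<lambda>k. stationary (j - int k) * exp (- \<gamma> * real_of_int (j - int k)))"
proof -
  have "summable (\<lambda>k. weight \<omega> j * (stationary (j - int k) * exp (- \<gamma> * real_of_int (j - int k))))"
  proof (rule summable_comparison_test')
    show "summable (\<lambda>k. 2 * K * (1 + \<bar>real_of_int j\<bar>) powr \<beta> * exp (- \<gamma> * real_of_int j) * poly_exp k)"
      by (intro summable_mult summable_poly_exp)
    show "norm (weight \<omega> j * (stationary (j - int k) * exp (- \<gamma> * real_of_int (j - int k))))
      \<le> 2 * K * (1 + \<bar>real_of_int j\<bar>) powr \<beta> * exp (- \<gamma> * real_of_int j) * poly_exp k" for k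
      using stationary_weight_bound[of j k] weight_pos[of j] stationary_pos[of "j - int k"] by simp
  qed
  then show ?thesis using weight_pos[of j] by simp
qed

lemma slope_rec: "slope j = stationary j * exp (- \<gamma> * real_of_int j) + slope (j - 1)"
  using suminf_split_head[OF summable_slope[of j]] by (simp add: slope_def algebra_simps)

lemma slope_pos: "0 < slope j"
  unfolding slope_def using stationary_pos by (intro suminf_pos summable_slope) auto

lemma weight_slope_bound:
  "weight \<omega> j * slope j \<le> 2 * K * suminf poly_exp * (1 + \<bar>real_of_int j\<bar>) powr \<beta> * exp (- \<gamma> * real_of_int j)"
proof -
  have "weight \<omega> j * slope j = (\<Sum>k. weight \<omega> j * (stationary (j - int k) * exp (- \<gamma> * real_of_int (j - int k))))"
    unfolding slope_def by (intro suminf_mult[symmetric] summable_slope)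
  also have "\<dots> \<le> (\<Sum>k. 2 * K * (1 + \<bar>real_of_int j\<bar>) powr \<beta> * exp (- \<gamma> * real_of_int j) * poly_exp k)"
    by (intro suminf_le stationary_weight_bound summable_mult summable_slope summable_poly_exp)
  also have "\<dots> = 2 * K * (1 + \<bar>real_of_int j\<bar>) powr \<beta> * exp (- \<gamma> * real_of_int j) * suminf poly_exp"
    by (intro suminf_mult summable_poly_exp)
  finally show ?thesis by (simp add: mult_ac)
qed

lemma weight_slope_shift_bound:
  "weight \<omega> (x + int i) * slope (x + int i)
    \<le> 2 * K * suminf poly_exp * (1 + \<bar>real_of_int x\<bar>) powr \<beta> * exp (- \<gamma> * real_of_int x) * poly_exp i"
proof -
  let ?X = "1 + \<bar>real_of_int x\<bar>"
  have "1 + \<bar>real_of_int (x + int i)\<bar> \<le> 2 + real i + \<bar>real_of_int x\<bar> * 1" by simp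
  also have "\<dots> \<le> 2 + real i + \<bar>real_of_int x\<bar> * (2 + real i)" by (intro add_left_mono mult_left_mono) auto
  finally have X: "1 + \<bar>real_of_int (x + int i)\<bar> \<le> ?X * (2 + real i)" by (simp add: algebra_simps)
  have "weight \<omega> (x + int i) * slope (x + int i)
      \<le> 2 * K * suminf poly_exp * (1 + \<bar>real_of_int (x + int i)\<bar>) powr \<beta> * exp (- \<gamma> * real_of_int (x + int i))"
    by (rule weight_slope_bound)
  also have "\<dots> \<le> 2 * K * suminf poly_exp * (?X * (2 + real i)) powr \<beta> * exp (- \<gamma> * real_of_int (x + int i))"
    using X beta_nonneg K_ge_1 suminf_poly_exp_pos
    by (intro mult_right_mono mult_left_mono powr_mono2) auto
  also have "\<dots> = 2 * K * suminf poly_exp * (?X powr \<beta> * (2 + real i) powr \<beta>) * (exp (- \<gamma> * real_of_int x) * exp (- (\<gamma> * real i)))"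
  proof -
    have "exp (- \<gamma> * real_of_int (x + int i)) = exp (- \<gamma> * real_of_int x) * exp (- (\<gamma> * real i))"
      by (simp add: exp_add[symmetric] ring_distribs)
    moreover have "(?X * (2 + real i)) powr \<beta> = ?X powr \<beta> * (2 + real i) powr \<beta>"
      by (rule powr_mult)
    ultimately show ?thesis by (simp only:)
  qed
  finally show ?thesis by (simp add: poly_exp_def mult_ac)
qed

lemma summable_lyapunov: "summable (\<lambda>i. weight \<omega> (x + int i) * slope (x + int i))"
proof (rule summable_comparison_test')
  show "summable (\<lambda>i. 2 * K * suminf poly_exp * (1 + \<bar>real_of_int x\<bar>) powr \<beta> * exp (- \<gamma> * real_of_int x) * poly_exp i)"
    by (intro summable_mult summable_poly_exp)
  show "norm (weight \<omega> (x + int i) * slope (x + int i))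
    \<le> 2 * K * suminf poly_exp * (1 + \<bar>real_of_int x\<bar>) powr \<beta> * exp (- \<gamma> * real_of_int x) * poly_exp i" for i
    using weight_slope_shift_bound[of x i] weight_pos[of "x + int i"] slope_pos[of "x + int i"] by simp
qed

lemma lyapunov_rec: "lyapunov x = weight \<omega> x * slope x + lyapunov (x + 1)"
  using suminf_split_head[OF summable_lyapunov[of x]] by (simp add: lyapunov_def algebra_simps)

lemma lyapunov_pos: "0 < lyapunov x"
  unfolding lyapunov_def using weight_pos slope_pos by (intro suminf_pos summable_lyapunov) auto

lemma lyapunov_antimono: "x \<le> y \<Longrightarrow> lyapunov y \<le> lyapunov x"
proof (induction y rule: int_ge_induct)
  case (step y)
  have "0 < weight \<omega> y * slope y" using weight_pos slope_pos by simp
  with step show ?case using lyapunov_rec[of y] by linarith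
qed simp

text \<open>Each of the two summations costs a factor \<open>suminf poly_exp\<close>, but the power
  of 1+|x| remains \<beta>: the polynomial factor is carried from x+i to x at the expense of a power
  of 2+i. The contraction rate L^(-\<beta>) depends on this.\<close>

lemma lyapunov_bound:
  "lyapunov x \<le> 2 * K * (suminf poly_exp)\<^sup>2 * (1 + \<bar>real_of_int x\<bar>) powr \<beta> * exp (- \<gamma> * real_of_int x)"
proof -
  have "lyapunov x \<le> (\<Sum>i. 2 * K * suminf poly_exp * (1 + \<bar>real_of_int x\<bar>) powr \<beta> * exp (- \<gamma> * real_of_int x) * poly_exp i)"
    unfolding lyapunov_def
    by (intro suminf_le weight_slope_shift_bound summable_mult summable_lyapunov summable_poly_exp)
  also have "\<dots> = 2 * K * suminf poly_exp * (1 + \<bar>real_of_int x\<bar>) powr \<beta> * exp (- \<gamma> * real_of_int x) * suminf poly_exp"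
    by (intro suminf_mult summable_poly_exp)
  finally show ?thesis by (simp add: power2_eq_square mult_ac)
qed

lemma step_op_lyapunov: "step_op \<omega> lyapunov x = lyapunov x - exp (- \<gamma> * real_of_int x)"
proof -
  have "lyapunov x - step_op \<omega> lyapunov x =
      \<omega> x * (weight \<omega> x * slope x) - (1 - \<omega> x) * (weight \<omega> (x - 1) * slope (x - 1))"
    using lyapunov_rec[of x] lyapunov_rec[of "x - 1"] by (simp add: step_op_def algebra_simps)
  also have "\<dots> = \<omega> x * weight \<omega> x * (slope x - slope (x - 1))"
    using weight_balance[of x] by (simp add: right_diff_distrib mult.assoc[symmetric])
  also have "\<dots> = \<omega> x * weight \<omega> x * stationary x * exp (- \<gamma> * real_of_int x)"
    by (simp add: slope_rec[of x])
  \<comment> \<open>The reversible measure is normalised so that this product is 1, hence the source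
    appears with coefficient 1.\<close>
  also have "\<omega> x * weight \<omega> x * stationary x = \<omega> x + \<omega> x * weight \<omega> x / weight \<omega> (x - 1)"
    using weight_pos[of x] weight_pos[of "x - 1"] by (simp add: stationary_def field_simps)
  also have "\<dots> = 1"
    unfolding weight_balance using weight_pos[of "x - 1"] by simp
  finally show ?thesis by simp
qed

text \<open>
  In the window from -L to L the Lyapunov function contracts by a factor 1 - c / (1+L)^beta. A walk
  that is negative after having left the window has either reached -L or returned from L.
\<close>

lemma walk_prob_negative:
  obtains c D where "0 < c" "0 < D"
    "\<And>n L. walk_prob \<omega> n {..-1} 0 \<le>
       exp (- (c * real n / (1 + real L) powr \<beta>)) + D * (1 + real L) powr \<beta> * exp (- (2 * \<gamma> * real L))"
proof -
  define C where "C = 2 * K * (suminf poly_exp)\<^sup>2"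
  have C: "0 < C" using K_ge_1 suminf_poly_exp_pos by (simp add: C_def)
  define S where "S = (\<Sum>k. exp (- (2 * \<gamma> * real k)))"
  have S: "0 < S" unfolding S_def by (intro suminf_pos summable_exp_gamma) auto
  \<comment> \<open>The first summand pays for reaching -L, the second for returning from L to
    -1.\<close>
  define D where "D = escape 0 * K + K * S / escape (-1)"
  have D: "0 < D" using K_ge_1 S escape_pos by (auto simp: D_def intro!: add_pos_pos mult_pos_pos divide_pos_pos)
  have main: "walk_prob \<omega> n {..-1} 0 \<le>
       exp (- (1 / C * real n / (1 + real L) powr \<beta>)) + D * (1 + real L) powr \<beta> * exp (- (2 * \<gamma> * real L))" for n L
  proof -
    define \<eta> where "\<eta> = 1 / (C * (1 + real L) powr \<beta>)"
    have eta0: "0 < \<eta>" using C by (simp add: \<eta>_def)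
    have contr: "step_op \<omega> lyapunov x \<le> (1 - \<eta>) * lyapunov x" if "\<bar>x\<bar> \<le> int L" for x
    proof -
      have "lyapunov x \<le> C * (1 + \<bar>real_of_int x\<bar>) powr \<beta> * exp (- \<gamma> * real_of_int x)"
        unfolding C_def by (rule lyapunov_bound)
      also have "\<dots> \<le> C * (1 + real L) powr \<beta> * exp (- \<gamma> * real_of_int x)"
        using that C beta_nonneg by (intro mult_right_mono mult_left_mono powr_mono2) auto
      finally have "\<eta> * lyapunov x \<le> \<eta> * (C * (1 + real L) powr \<beta> * exp (- \<gamma> * real_of_int x))"
        using eta0 by simp
      also have "\<dots> = exp (- \<gamma> * real_of_int x)"
        using C by (simp add: \<eta>_def)
      finally show ?thesis by (simp add: step_op_lyapunov algebra_simps)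
    qed
    \<comment> \<open>Positivity of the averaged function forces 1 - \<eta> to be nonnegative, so
      that its powers can be used in bounds.\<close>
    have eta1: "\<eta> \<le> 1"
    proof -
      have "0 \<le> step_op \<omega> lyapunov 0"
        using lyapunov_pos by (intro step_op_nonneg less_imp_le)
      also have "\<dots> \<le> (1 - \<eta>) * lyapunov 0" by (rule contr) simp
      finally show ?thesis using lyapunov_pos[of 0] by (simp add: zero_le_mult_iff)
    qed
    let ?b = "escape (int L) / escape (-1)"
    have pos: "0 \<le> escape x / escape a" "0 \<le> (1 - \<eta>) ^ k * lyapunov x / lyapunov (-1)" for x a k
      using escape_pos[of x] escape_pos[of a] lyapunov_pos[of x] lyapunov_pos[of "-1"] eta1 by auto
    \<comment> \<open>The first term contracts inside the window, the second is at least 1 to the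
      left of it, and the constant \<open>?b\<close> covers the sites to the right.\<close>
    have claim: "walk_prob \<omega> k {..-1} x \<le> (1 - \<eta>) ^ k * lyapunov x / lyapunov (-1) + escape x / escape (- int L) + ?b" for k x
    proof (induction k arbitrary: x)
      case 0
      have "indicator {..-1} x \<le> lyapunov x / lyapunov (-1)"
        using lyapunov_antimono[of x "-1"] lyapunov_pos[of "-1"] lyapunov_pos[of x] by (auto simp: indicator_def)
      then show ?case using pos(1)[of x "- int L"] pos(1)[of "int L" "-1"] by simp
    next
      case (Suc k)
      consider "\<bar>x\<bar> \<le> int L" | "x < - int L" | "int L < x" by linarith
      then show ?case
      proof cases
        case 1
        let ?a = "(1 - \<eta>) ^ k / lyapunov (-1)"
        have "walk_prob \<omega> (Suc k) {..-1} x \<le> step_op \<omega> (\<lambda>x. ?a * lyapunov x + 1 / escape (- int L) * escape x + ?b) x"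
          using Suc by (auto intro!: step_op_mono)
        also have "\<dots> = ?a * step_op \<omega> lyapunov x + 1 / escape (- int L) * step_op \<omega> escape x + ?b"
          by (simp only: step_op_def) (simp only: algebra_simps)
        also have "\<dots> \<le> ?a * ((1 - \<eta>) * lyapunov x) + 1 / escape (- int L) * step_op \<omega> escape x + ?b"
          using contr[OF 1] eta1 lyapunov_pos[of "-1"] by (intro add_right_mono mult_left_mono) auto
        finally show ?thesis by (simp add: escape_harmonic mult_ac)
      next
        case 2
        then have "1 \<le> escape x / escape (- int L)"
          using escape_antimono[of x "- int L"] escape_pos[of "- int L"] by simp
        then show ?thesis
          using walk_prob_bounds(2)[of "Suc k" "{..-1}" x] pos(2)[of "Suc k" x] pos(1)[of "int L" "-1"] by linarith
      next
        case 3
        have "walk_prob \<omega> (Suc k) {..-1} x \<le> escape x / escape (-1)" by (rule walk_prob_atMost_le)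
        also have "\<dots> \<le> ?b"
          using escape_antimono[of "int L" x] escape_pos[of "-1"] 3 by (intro divide_right_mono) auto
        finally show ?thesis
          using pos(2)[of "Suc k" x] pos(1)[of x "- int L"] by linarith
      qed
    qed
    have "walk_prob \<omega> n {..-1} 0 \<le> (1 - \<eta>) ^ n * lyapunov 0 / lyapunov (-1) + escape 0 / escape (- int L) + ?b"
      by (rule claim)
    also have "(1 - \<eta>) ^ n * lyapunov 0 / lyapunov (-1) \<le> exp (- (1 / C * real n / (1 + real L) powr \<beta>))"
    proof -
      have "(1 - \<eta>) ^ n * lyapunov 0 / lyapunov (-1) \<le> (1 - \<eta>) ^ n"
        using lyapunov_antimono[of "-1" 0] lyapunov_pos[of "-1"] eta1 by (simp add: divide_le_eq mult_left_mono)
      also have "\<dots> \<le> exp (- \<eta>) ^ n"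
        using exp_ge_add_one_self[of "- \<eta>"] eta1 by (intro power_mono) auto
      also have "\<dots> = exp (- (1 / C * real n / (1 + real L) powr \<beta>))"
        by (simp add: exp_of_nat_mult[symmetric] \<eta>_def)
      finally show ?thesis .
    qed
    also have "escape 0 / escape (- int L) \<le> escape 0 * (K * (1 + real L) powr \<beta> * exp (- (2 * \<gamma> * real L)))"
      using mult_left_mono[OF inverse_escape_decay[of L], of "escape 0"] escape_pos[of 0] by simp
    also have "?b \<le> K * S * exp (- (2 * \<gamma> * real L)) / escape (-1)"
      using escape_decay[of L] escape_pos[of "-1"] by (intro divide_right_mono) (auto simp: S_def)
    \<comment> \<open>The factor (1+L)^\<beta>, which is at least 1, is inserted to merge both error
      terms under one constant.\<close>
    also have "\<dots> \<le> K * S * ((1 + real L) powr \<beta> * exp (- (2 * \<gamma> * real L))) / escape (-1)"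
      using K_ge_1 S escape_pos[of "-1"] beta_nonneg
      by (intro divide_right_mono mult_left_mono) (auto simp: ge_one_powr_ge_zero)
    finally show ?thesis by (simp add: D_def algebra_simps)
  qed
  show ?thesis
    by (rule that[of "1 / C" D]) (use C D main in auto)
qed

end

section \<open>Moments of the environment\<close>

definition site_ratio :: "real \<Rightarrow> real" where
  "site_ratio x = (1 - x) / x"

lemma rho_site_ratio: "rho \<omega> i = site_ratio (\<omega> i)"
  by (simp add: rho_def site_ratio_def)

lemma borel_measurable_site_ratio [measurable]: "site_ratio \<in> borel_measurable borel"
  unfolding site_ratio_def [abs_def] by measurable

lemma exp_gt_add_one: "1 + y < exp y" if "y \<noteq> 0" for y :: real
  using that ln_eq_minus_one[of "exp y"] exp_ge_add_one_self[of y] by (auto simp: less_le)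

text \<open>The strict tangent inequality at t*y, taken at the points y and 0 and averaged with
  weights t and 1-t.\<close>

lemma exp_strictly_convex:
  fixes t y :: real
  assumes "0 < t" "t < 1" "y \<noteq> 0"
  shows "exp (t * y) < (1 - t) + t * exp y"
proof -
  have "exp (t * y) * (1 + (1 - t) * y) < exp (t * y) * exp ((1 - t) * y)"
    using assms by (intro mult_strict_left_mono exp_gt_add_one) auto
  also have "\<dots> = exp y" by (simp add: exp_add[symmetric] algebra_simps)
  finally have 1: "t * (exp (t * y) * (1 + (1 - t) * y)) < t * exp y" using assms by simp
  have "exp (t * y) * (1 + - (t * y)) < exp (t * y) * exp (- (t * y))"
    using assms by (intro mult_strict_left_mono exp_gt_add_one) auto
  also have "\<dots> = 1" by (simp add: exp_add[symmetric])
  finally have 2: "(1 - t) * (exp (t * y) * (1 + - (t * y))) < 1 - t" using assms by simp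
  have "t * (exp (t * y) * (1 + (1 - t) * y)) + (1 - t) * (exp (t * y) * (1 + - (t * y))) = exp (t * y)"
    by (simp add: algebra_simps)
  then show ?thesis using 1 2 by linarith
qed

locale iid_environment = single_site: prob_space \<mu> for \<mu> :: "real measure" +
  fixes \<kappa> :: real
  assumes sets_site: "sets \<mu> = sets borel"
    and AE_site: "AE x in \<mu>. 0 < x \<and> x < 1"
    and ln_ratio_neg: "(\<integral>x. ln (site_ratio x) \<partial>\<mu>) < 0"
    and kappa_pos: "0 < \<kappa>"
    and ratio_kappa: "(\<integral>x. site_ratio x powr \<kappa> \<partial>\<mu>) = 1"
begin

declare sets_site [simp]

lemma borel_measurable_site: "f \<in> borel_measurable borel \<Longrightarrow> f \<in> borel_measurable \<mu>"
  by (simp add: measurable_cong_sets[OF sets_site refl])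

sublocale product: product_prob_space "\<lambda>_. \<mu>" "UNIV :: int set" ..

abbreviation law :: "(int \<Rightarrow> real) measure" where
  "law \<equiv> Pi\<^sub>M UNIV (\<lambda>_. \<mu>)"

lemma sets_law: "sets law = sets env_space"
  by (intro sets_PiM_cong) simp_all

lemma space_law [simp]: "space law = UNIV"
  using sets_eq_imp_space_eq[OF sets_site] by (simp add: space_PiM)

lemma measurable_coordinate [measurable]: "(\<lambda>\<omega>. \<omega> i) \<in> borel_measurable law"
  unfolding measurable_cong_sets[OF sets_law refl] by measurable

lemma measurable_rho [measurable]: "(\<lambda>\<omega>. rho \<omega> i) \<in> borel_measurable law"
  unfolding rho_def by measurable

lemma distr_coordinate: "distr law borel (\<lambda>\<omega>. \<omega> i) = \<mu>"
proof -
  have "distr law borel (\<lambda>\<omega>. \<omega> i) = distr law \<mu> (\<lambda>\<omega>. \<omega> i)"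
    by (intro distr_cong) simp_all
  then show ?thesis using product.PiM_component[of i] by simp
qed

lemma AE_environment: "AE \<omega> in law. environment \<omega>"
proof -
  have "AE \<omega> in law. 0 < \<omega> i \<and> \<omega> i < 1" for i
    by (rule product.AE_component) (use AE_site in auto)
  then have "AE \<omega> in law. \<forall>i. 0 < \<omega> i \<and> \<omega> i < 1"
    by (simp add: AE_all_countable)
  then show ?thesis by eventually_elim (simp add: environment_def)
qed

lemma indep_coordinates: "product.indep_vars (\<lambda>_. borel) (\<lambda>i \<omega>. \<omega> i) UNIV"
proof (subst product.indep_vars_iff_distr_eq_PiM)
  have "distr law env_space (\<lambda>x. \<lambda>i\<in>UNIV. x i) = distr law law (\<lambda>x. x)"
    by (intro distr_cong) (simp_all add: sets_law restrict_def)
  also have "\<dots> = law" by (rule distr_id)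
  finally show "distr law env_space (\<lambda>x. \<lambda>i\<in>UNIV. x i) = Pi\<^sub>M UNIV (\<lambda>i. distr law borel (\<lambda>\<omega>. \<omega> i))"
    by (simp add: distr_coordinate)
qed simp_all

lemma nn_integral_prod_coordinates:
  fixes f :: "real \<Rightarrow> ennreal"
  assumes [measurable]: "f \<in> borel_measurable borel" and "finite I"
  shows "(\<integral>\<^sup>+\<omega>. (\<Prod>i\<in>I. f (\<omega> i)) \<partial>law) = (\<integral>\<^sup>+x. f x \<partial>\<mu>) ^ card I"
proof -
  have "product.indep_vars (\<lambda>_. borel) (\<lambda>i \<omega>. f (\<omega> i)) I"
    using product.indep_vars_subset[OF indep_coordinates subset_UNIV]
    by (rule product.indep_vars_compose2) simp
  then have "(\<integral>\<^sup>+\<omega>. (\<Prod>i\<in>I. f (\<omega> i)) \<partial>law) = (\<Prod>i\<in>I. \<integral>\<^sup>+\<omega>. f (\<omega> i) \<partial>law)"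
    using \<open>finite I\<close> by (intro product.indep_vars_nn_integral) auto
  also have "\<dots> = (\<Prod>i\<in>I. \<integral>\<^sup>+x. f x \<partial>\<mu>)"
    by (intro prod.cong refl, subst distr_coordinate[symmetric]) (simp add: nn_integral_distr)
  finally show ?thesis by simp
qed

definition moment :: "real \<Rightarrow> real" where
  "moment s = (\<integral>x. site_ratio x powr s \<partial>\<mu>)"

lemma moment_nonneg: "0 \<le> moment s"
  unfolding moment_def by (intro integral_nonneg_AE) simp

text \<open>The Bochner integral of a non-integrable function is 0, so the value 1 already contains
  integrability.\<close>

lemma integrable_kappa: "integrable \<mu> (\<lambda>x. site_ratio x powr \<kappa>)"
  using ratio_kappa not_integrable_integral_eq[of \<mu> "\<lambda>x. site_ratio x powr \<kappa>"] by fastforce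

lemma AE_ratio_pos: "AE x in \<mu>. 0 < site_ratio x"
  using AE_site by eventually_elim (simp add: site_ratio_def)

text \<open>Convexity of the power in its exponent between 0 and \<kappa>, strict unless u =
  1.\<close>

lemma ratio_powr_convex:
  assumes "0 < s" "s < \<kappa>" "0 < u"
  shows "u powr s \<le> (1 - s / \<kappa>) + s / \<kappa> * u powr \<kappa>"
    and "u \<noteq> 1 \<Longrightarrow> u powr s < (1 - s / \<kappa>) + s / \<kappa> * u powr \<kappa>"
proof -
  show *: "u powr s < (1 - s / \<kappa>) + s / \<kappa> * u powr \<kappa>" if "u \<noteq> 1"
    using exp_strictly_convex[of "s / \<kappa>" "\<kappa> * ln u"] assms that kappa_pos
    by (simp add: powr_def)
  show "u powr s \<le> (1 - s / \<kappa>) + s / \<kappa> * u powr \<kappa>"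
    using * by (cases "u = 1") (auto intro: less_imp_le)
qed

lemma integrable_moment:
  assumes "0 < s" "s < \<kappa>"
  shows "integrable \<mu> (\<lambda>x. site_ratio x powr s)"
proof (rule Bochner_Integration.integrable_bound)
  show "integrable \<mu> (\<lambda>x. (1 - s / \<kappa>) + s / \<kappa> * site_ratio x powr \<kappa>)"
    using integrable_kappa by simp
  show "AE x in \<mu>. norm (site_ratio x powr s) \<le> norm ((1 - s / \<kappa>) + s / \<kappa> * site_ratio x powr \<kappa>)"
    using AE_ratio_pos
  proof eventually_elim
    case (elim x)
    show ?case using ratio_powr_convex(1)[OF assms elim] by simp
  qed
qed (rule borel_measurable_site, measurable)

text \<open>The moments of order 0 and \<kappa> are both 1, so by convexity those in between are at
  most 1. Equality would make \<rho> = 1 almost surely, against the negative mean of its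
  logarithm.\<close>

lemma moment_less_1:
  assumes "0 < s" "s < \<kappa>"
  shows "moment s < 1"
proof -
  define D where "D x = (1 - s / \<kappa>) + s / \<kappa> * site_ratio x powr \<kappa> - site_ratio x powr s" for x
  have intD: "integrable \<mu> D"
    unfolding D_def using integrable_kappa integrable_moment[OF assms] by simp
  have D: "(\<integral>x. D x \<partial>\<mu>) = 1 - moment s"
    unfolding D_def moment_def using integrable_kappa integrable_moment[OF assms] ratio_kappa
    by (simp add: single_site.prob_space)
  have nn: "AE x in \<mu>. 0 \<le> D x"
    using AE_ratio_pos by eventually_elim (use ratio_powr_convex(1)[OF assms] in \<open>auto simp: D_def\<close>)
  have m: "(\<lambda>x. ln (site_ratio x)) \<in> borel_measurable \<mu>"
    by (rule borel_measurable_site) measurable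
  have "(\<integral>x. D x \<partial>\<mu>) \<noteq> 0"
  proof
    assume "(\<integral>x. D x \<partial>\<mu>) = 0"
    then have "AE x in \<mu>. D x = 0"
      using integral_nonneg_eq_0_iff_AE[OF intD nn] by simp
    then have "AE x in \<mu>. ln (site_ratio x) = 0"
      using AE_ratio_pos
    proof eventually_elim
      case (elim x)
      then have "site_ratio x = 1"
        using ratio_powr_convex(2)[OF assms, of "site_ratio x"] by (force simp: D_def)
      then show ?case by simp
    qed
    then have "(\<integral>x. ln (site_ratio x) \<partial>\<mu>) = (\<integral>x. 0 \<partial>\<mu>)"
      by (intro integral_cong_AE m) auto
    then show False using ln_ratio_neg by simp
  qed
  moreover have "0 \<le> (\<integral>x. D x \<partial>\<mu>)"
    using nn by (rule integral_nonneg_AE)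
  ultimately show ?thesis using D by linarith
qed

lemma nn_integral_prod_rho_powr:
  assumes "0 < s" "s \<le> \<kappa>" "finite I"
  shows "(\<integral>\<^sup>+\<omega>. ennreal ((\<Prod>i\<in>I. rho \<omega> i) powr s) \<partial>law) = ennreal (moment s ^ card I)"
proof -
  have "(\<integral>\<^sup>+\<omega>. ennreal ((\<Prod>i\<in>I. rho \<omega> i) powr s) \<partial>law)
      = (\<integral>\<^sup>+\<omega>. (\<Prod>i\<in>I. ennreal (site_ratio (\<omega> i) powr s)) \<partial>law)"
  proof (rule nn_integral_cong_AE, use AE_environment in eventually_elim)
    fix \<omega> assume "environment \<omega>"
    then interpret environment \<omega> .
    show "ennreal ((\<Prod>i\<in>I. rho \<omega> i) powr s) = (\<Prod>i\<in>I. ennreal (site_ratio (\<omega> i) powr s))"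
      by (simp add: prod_powr_distrib[symmetric] prod_ennreal rho_site_ratio[symmetric] rho_pos less_imp_le)
  qed
  also have "\<dots> = (\<integral>\<^sup>+x. ennreal (site_ratio x powr s) \<partial>\<mu>) ^ card I"
    using \<open>finite I\<close> by (rule nn_integral_prod_coordinates[rotated]) simp
  also have "(\<integral>\<^sup>+x. ennreal (site_ratio x powr s) \<partial>\<mu>) = ennreal (moment s)"
    unfolding moment_def using assms integrable_kappa integrable_moment
    by (intro nn_integral_eq_integral) (auto simp: less_le)
  finally show ?thesis by (simp add: ennreal_power moment_nonneg)
qed

end

text \<open>The total sum has finite expectation, so it is almost surely finite and bounds every
  term. Unlike Borel-Cantelli this covers all indices at once; B \<ge> 1 ensures that roots of B are
  at least 1 too.\<close>

lemma AE_bounded_of_summable_nn_integral: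
  fixes f :: "nat \<Rightarrow> 'a \<Rightarrow> ennreal"
  assumes [measurable]: "\<And>i. f i \<in> borel_measurable M"
    and le: "\<And>i. (\<integral>\<^sup>+x. f i x \<partial>M) \<le> ennreal (c i)" and c: "\<And>i. 0 \<le> c i" "summable c"
  shows "AE x in M. \<exists>B\<ge>1. \<forall>i. f i x \<le> ennreal B"
proof -
  have "(\<integral>\<^sup>+x. (\<Sum>i. f i x) \<partial>M) = (\<Sum>i. \<integral>\<^sup>+x. f i x \<partial>M)"
    by (rule nn_integral_suminf) simp
  also have "\<dots> \<le> (\<Sum>i. ennreal (c i))"
    by (intro suminf_le le) auto
  also have "\<dots> = ennreal (suminf c)"
    using c by (rule suminf_ennreal2)
  finally have "(\<integral>\<^sup>+x. (\<Sum>i. f i x) \<partial>M) \<noteq> \<infinity>"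
    by (auto simp: top_unique)
  then have "AE x in M. (\<Sum>i. f i x) \<noteq> \<infinity>"
    by (intro nn_integral_PInf_AE) auto
  then show ?thesis
  proof eventually_elim
    fix x assume "(\<Sum>i. f i x) \<noteq> \<infinity>"
    then obtain b where b: "0 \<le> b" "(\<Sum>i. f i x) = ennreal b"
      by (cases "\<Sum>i. f i x") auto
    have "f i x \<le> ennreal (max 1 b)" for i
    proof -
      have "f i x = (\<Sum>j\<in>{i}. f j x)" by simp
      also have "\<dots> \<le> (\<Sum>i. f i x)" by (rule sum_le_suminf) auto
      also have "\<dots> \<le> ennreal (max 1 b)" using b by (simp add: ennreal_leI)
      finally show ?thesis .
    qed
    then show "\<exists>B\<ge>1. \<forall>i. f i x \<le> ennreal B" by (intro exI[of _ "max 1 b"]) auto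
  qed
qed

section \<open>Products of ratios along the environment\<close>

context iid_environment
begin

text \<open>
  The weighted sum over n and k of the s-th powers of the products has finite expectation, so it is
  almost surely finite and bounds each of its terms.
\<close>

lemma AE_products_bounded:
  fixes g :: "nat \<Rightarrow> int"
  assumes s: "0 < s" "s < \<kappa>" "1 < \<beta> * s" and \<gamma>: "exp (2 * \<gamma> * s) * moment s < 1"
  shows "AE \<omega> in law. \<exists>B\<ge>1. \<forall>n k. (\<Prod>i\<in>{g n + 1..g n + int k}. rho \<omega> i)
           \<le> B * (1 + real n) powr \<beta> * exp (- (2 * \<gamma> * real k))"
proof -
  define q where "q = exp (2 * \<gamma> * s) * moment s"
  have q: "0 \<le> q" "q < 1" using \<gamma> moment_nonneg by (auto simp: q_def)
  \<comment> \<open>\<open>w\<close> is the reciprocal of the s-th power of the claimed bound, up to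
    the constant. The sum over n converges because \<beta> s > 1, the sum over k because q <
    1.\<close>
  define w where "w n k = (1 + real n) powr (- (\<beta> * s)) * exp (2 * \<gamma> * s * real k)" for n k :: nat
  define f where "f n k \<omega> = ennreal (w n k * (\<Prod>i\<in>{g n + 1..g n + int k}. rho \<omega> i) powr s)" for n k \<omega>
  have [measurable]: "f n k \<in> borel_measurable law" for n k
    unfolding f_def by measurable
  have int_f: "(\<integral>\<^sup>+\<omega>. f n k \<omega> \<partial>law) = ennreal ((1 + real n) powr (- (\<beta> * s)) * q ^ k)" for n k
  proof -
    have "(\<integral>\<^sup>+\<omega>. f n k \<omega> \<partial>law)
        = (\<integral>\<^sup>+\<omega>. ennreal (w n k) * ennreal ((\<Prod>i\<in>{g n + 1..g n + int k}. rho \<omega> i) powr s) \<partial>law)"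
      by (intro nn_integral_cong) (simp add: f_def ennreal_mult w_def)
    also have "\<dots> = ennreal (w n k) * (\<integral>\<^sup>+\<omega>. ennreal ((\<Prod>i\<in>{g n + 1..g n + int k}. rho \<omega> i) powr s) \<partial>law)"
      by (rule nn_integral_cmult) measurable
    also have "(\<integral>\<^sup>+\<omega>. ennreal ((\<Prod>i\<in>{g n + 1..g n + int k}. rho \<omega> i) powr s) \<partial>law) = ennreal (moment s ^ k)"
      using s by (subst nn_integral_prod_rho_powr) auto
    also have "ennreal (w n k) * ennreal (moment s ^ k) = ennreal (w n k * moment s ^ k)"
      by (rule ennreal_mult[symmetric]) (auto simp: w_def moment_nonneg)
    also have "w n k * moment s ^ k = (1 + real n) powr (- (\<beta> * s)) * q ^ k"
      by (simp add: w_def q_def power_mult_distrib exp_of_nat_mult[symmetric] mult_ac)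
    finally show ?thesis .
  qed
  have "AE \<omega> in law. \<exists>B\<ge>1. \<forall>n. (\<Sum>k. f n k \<omega>) \<le> ennreal B"
  proof (rule AE_bounded_of_summable_nn_integral)
    fix n
    have "(\<integral>\<^sup>+\<omega>. (\<Sum>k. f n k \<omega>) \<partial>law) = (\<Sum>k. ennreal ((1 + real n) powr (- (\<beta> * s)) * q ^ k))"
      by (subst nn_integral_suminf) (auto simp: int_f)
    also have "\<dots> = ennreal (\<Sum>k. (1 + real n) powr (- (\<beta> * s)) * q ^ k)"
      using q by (intro suminf_ennreal2 summable_mult summable_geometric) auto
    also have "(\<Sum>k. (1 + real n) powr (- (\<beta> * s)) * q ^ k) = (1 + real n) powr (- (\<beta> * s)) * (1 / (1 - q))"
      using q by (subst suminf_mult) (auto simp: suminf_geometric summable_geometric)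
    finally show "(\<integral>\<^sup>+\<omega>. (\<Sum>k. f n k \<omega>) \<partial>law) \<le> ennreal ((1 + real n) powr (- (\<beta> * s)) * (1 / (1 - q)))"
      by simp
  next
    have "summable (\<lambda>n. real (Suc n) powr (- (\<beta> * s)))"
      using s by (subst summable_Suc_iff) (simp add: summable_real_powr_iff)
    then show "summable (\<lambda>n. (1 + real n) powr (- (\<beta> * s)) * (1 / (1 - q)))"
      by (intro summable_mult2) (simp add: add.commute)
  qed (use q in auto)
  with AE_environment show ?thesis
  proof eventually_elim
    fix \<omega> assume "environment \<omega>" and "\<exists>B\<ge>1. \<forall>n. (\<Sum>k. f n k \<omega>) \<le> ennreal B"
    then interpret environment \<omega> by simp
    from \<open>\<exists>B\<ge>1. _ B\<close> obtain B where B: "1 \<le> B" "\<And>n. (\<Sum>k. f n k \<omega>) \<le> ennreal B" by blast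
    have "(\<Prod>i\<in>{g n + 1..g n + int k}. rho \<omega> i) \<le> B powr (1 / s) * (1 + real n) powr \<beta> * exp (- (2 * \<gamma> * real k))" for n k
    proof -
      let ?D = "\<Prod>i\<in>{g n + 1..g n + int k}. rho \<omega> i"
      have D: "0 < ?D" by (intro prod_pos rho_pos)
      have "f n k \<omega> = (\<Sum>j\<in>{k}. f n j \<omega>)" by simp
      also have "\<dots> \<le> (\<Sum>k. f n k \<omega>)" by (rule sum_le_suminf) auto
      also have "\<dots> \<le> ennreal B" by (rule B(2))
      finally have "w n k * ?D powr s \<le> B" using B(1) by (simp add: f_def ennreal_le_iff)
      then have "?D powr s \<le> B * ((1 + real n) powr (\<beta> * s) * exp (- (2 * \<gamma> * s * real k)))"
        by (simp add: w_def powr_minus exp_minus field_simps)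
      then have "(?D powr s) powr (1 / s) \<le> (B * ((1 + real n) powr (\<beta> * s) * exp (- (2 * \<gamma> * s * real k)))) powr (1 / s)"
        using s by (intro powr_mono2) auto
      also have "\<dots> = B powr (1 / s) * (1 + real n) powr \<beta> * exp (- (2 * \<gamma> * s * real k)) powr (1 / s)"
        using s B(1) by (simp add: powr_mult powr_powr)
      also have "exp (- (2 * \<gamma> * s * real k)) powr (1 / s) = exp (- (2 * \<gamma> * real k))"
        using s by (simp add: powr_def)
      also have "(?D powr s) powr (1 / s) = ?D" using s D by (simp add: powr_powr)
      finally show ?thesis .
    qed
    moreover have "1 \<le> B powr (1 / s)" using B(1) s by (simp add: ge_one_powr_ge_zero)
    ultimately show "\<exists>B\<ge>1. \<forall>n k. (\<Prod>i\<in>{g n + 1..g n + int k}. rho \<omega> i)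
           \<le> B * (1 + real n) powr \<beta> * exp (- (2 * \<gamma> * real k))" by blast
  qed
qed

text \<open>The order of quantifiers matters: the rate \<gamma> is deterministic, only K is
  random.\<close>

lemma AE_regular_environment:
  assumes "1 / \<kappa> < \<beta>"
  obtains \<gamma> where "AE \<omega> in law. \<exists>K. regular_environment \<omega> K \<beta> \<gamma>"
proof -
  have "0 < 1 / \<kappa>" using kappa_pos by simp
  then have beta: "0 < \<beta>" using assms by linarith
  then have "0 < 1 / \<beta>" by simp
  \<comment> \<open>Any s strictly between 1/\<beta> and \<kappa> would do: the lower bound makes
    the sum over starting points converge, the upper one makes the moment less than 1.\<close>
  define s where "s = (1 / \<beta> + \<kappa>) / 2"
  have "1 / \<beta> < \<kappa>" using assms beta kappa_pos by (simp add: field_simps)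
  then have s: "1 / \<beta> < s" "s < \<kappa>" by (auto simp: s_def)
  then have s0: "0 < s" using \<open>0 < 1 / \<beta>\<close> by linarith
  have bs: "1 < \<beta> * s" using s(1) beta by (simp add: field_simps)
  note m = moment_nonneg[of s] moment_less_1[OF s0 s(2)]
  \<comment> \<open>Chosen so that exp(2 \<gamma> s) = 2 / (1 + \<open>moment s\<close>), whose
    product with the moment is still below 1.\<close>
  define \<gamma> where "\<gamma> = ln (2 / (1 + moment s)) / (2 * s)"
  have gamma: "0 < \<gamma>" using s0 m by (simp add: \<gamma>_def)
  have e: "exp (2 * \<gamma> * s) = 2 / (1 + moment s)" using s0 m by (simp add: \<gamma>_def)
  have "exp (2 * \<gamma> * s) * moment s = 2 * moment s / (1 + moment s)" unfolding e by simp
  also have "\<dots> < 1" using m by (simp add: divide_less_eq)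
  finally have q: "exp (2 * \<gamma> * s) * moment s < 1" .
  \<comment> \<open>The starting points run through the two half-lines separately, each enumerated
    by its distance to 0.\<close>
  show ?thesis
  proof (rule that, use AE_environment AE_products_bounded[OF s0 s(2) bs q, of int]
       AE_products_bounded[OF s0 s(2) bs q, of "\<lambda>n. - int n"] in eventually_elim)
    fix \<omega> assume "environment \<omega>"
      and 1: "\<exists>B\<ge>1. \<forall>n k. (\<Prod>i\<in>{int n + 1..int n + int k}. rho \<omega> i)
           \<le> B * (1 + real n) powr \<beta> * exp (- (2 * \<gamma> * real k))"
      and 2: "\<exists>B\<ge>1. \<forall>n k. (\<Prod>i\<in>{- int n + 1..- int n + int k}. rho \<omega> i)
           \<le> B * (1 + real n) powr \<beta> * exp (- (2 * \<gamma> * real k))"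
    then interpret environment \<omega> by simp
    from 1 obtain B1 where B1: "1 \<le> B1" "\<And>n k. (\<Prod>i\<in>{int n + 1..int n + int k}. rho \<omega> i)
           \<le> B1 * (1 + real n) powr \<beta> * exp (- (2 * \<gamma> * real k))" by blast
    from 2 obtain B2 where B2: "1 \<le> B2" "\<And>n k. (\<Prod>i\<in>{- int n + 1..- int n + int k}. rho \<omega> i)
           \<le> B2 * (1 + real n) powr \<beta> * exp (- (2 * \<gamma> * real k))" by blast
    let ?B = "max B1 B2"
    have "(\<Prod>i\<in>{y + 1..y + int k}. rho \<omega> i) \<le> ?B * (1 + \<bar>real_of_int y\<bar>) powr \<beta> * exp (- (2 * \<gamma> * real k))" for y k
    proof (cases "0 \<le> y")
      case True
      then obtain n where y: "y = int n" using zero_le_imp_eq_int by blast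
      have "(\<Prod>i\<in>{y + 1..y + int k}. rho \<omega> i) \<le> B1 * (1 + \<bar>real_of_int y\<bar>) powr \<beta> * exp (- (2 * \<gamma> * real k))"
        using B1(2)[of n k] y by simp
      also have "\<dots> \<le> ?B * (1 + \<bar>real_of_int y\<bar>) powr \<beta> * exp (- (2 * \<gamma> * real k))"
        by (intro mult_right_mono) auto
      finally show ?thesis .
    next
      case False
      then obtain n where "- y = int n" using zero_le_imp_eq_int[of "- y"] by auto
      then have y: "y = - int n" by simp
      have "(\<Prod>i\<in>{y + 1..y + int k}. rho \<omega> i) \<le> B2 * (1 + \<bar>real_of_int y\<bar>) powr \<beta> * exp (- (2 * \<gamma> * real k))"
        using B2(2)[of n k] y by simp
      also have "\<dots> \<le> ?B * (1 + \<bar>real_of_int y\<bar>) powr \<beta> * exp (- (2 * \<gamma> * real k))"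
        by (intro mult_right_mono) auto
      finally show ?thesis .
    qed
    then have "weight \<omega> (y + int k) \<le> ?B * (1 + \<bar>real_of_int y\<bar>) powr \<beta> * exp (- (2 * \<gamma> * real k)) * weight \<omega> y" for y k
      unfolding weight_ratio by (subst mult.commute) (intro mult_right_mono less_imp_le[OF weight_pos])
    then show "\<exists>K. regular_environment \<omega> K \<beta> \<gamma>"
      using beta gamma
      by (intro exI[of _ ?B] regular_environment.intro regular_environment_axioms.intro environment_axioms) simp_all
  qed
qed

text \<open>Since 1 - \<omega> = \<rho> / (1 + \<rho>), a negative moment of \<rho> gives one of 1 -
  \<omega>. The product of m such factors, raised to the power -\<epsilon>, then has expectation at
  most c^m, so its logarithm grows at most linearly.\<close>

lemma AE_straight_path:
  assumes eps: "0 < \<epsilon>" "integrable \<mu> (\<lambda>x. site_ratio x powr (- \<epsilon>))"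
  shows "AE \<omega> in law. \<exists>b>0. \<exists>C>0. \<forall>m. b * exp (- (C * real m)) \<le> (\<Prod>i<m. 1 - \<omega> (- int i))"
proof -
  have le: "(1 - x) powr (- \<epsilon>) \<le> 2 powr \<epsilon> * (1 + site_ratio x powr (- \<epsilon>))" if "0 < x" "x < 1" for x
  proof -
    let ?r = "site_ratio x"
    have r: "0 < ?r" using that by (simp add: site_ratio_def)
    have "(1 - x) = ?r / (1 + ?r)" using that by (simp add: site_ratio_def field_simps)
    then have "(1 - x) powr (- \<epsilon>) = ((1 + ?r) / ?r) powr \<epsilon>"
      using r by (simp add: powr_minus powr_divide)
    also have "\<dots> \<le> 2 powr \<epsilon> * (1 + ?r powr (- \<epsilon>))"
    proof (cases "?r \<ge> 1")
      case True
      have "((1 + ?r) / ?r) powr \<epsilon> \<le> 2 powr \<epsilon>"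
        using True eps by (intro powr_mono2) (auto simp: field_simps)
      also have "\<dots> \<le> 2 powr \<epsilon> * (1 + ?r powr (- \<epsilon>))"
        using mult_left_mono[of 1 "1 + ?r powr (- \<epsilon>)" "2 powr \<epsilon>"] by simp
      finally show ?thesis .
    next
      case False
      have "((1 + ?r) / ?r) powr \<epsilon> \<le> (2 * (1 / ?r)) powr \<epsilon>"
        using False eps r by (intro powr_mono2) (auto simp: field_simps)
      also have "\<dots> = 2 powr \<epsilon> * ?r powr (- \<epsilon>)"
        unfolding powr_mult powr_divide powr_minus_divide by simp
      also have "\<dots> \<le> 2 powr \<epsilon> * (1 + ?r powr (- \<epsilon>))"
        by (intro mult_left_mono) auto
      finally show ?thesis .
    qed
    finally show ?thesis .
  qed
  define c where "c = max 1 (\<integral>x. 2 powr \<epsilon> * (1 + site_ratio x powr (- \<epsilon>)) \<partial>\<mu>)"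
  have "(\<integral>\<^sup>+x. ennreal ((1 - x) powr (- \<epsilon>)) \<partial>\<mu>) \<le> (\<integral>\<^sup>+x. ennreal (2 powr \<epsilon> * (1 + site_ratio x powr (- \<epsilon>))) \<partial>\<mu>)"
    using AE_site by (intro nn_integral_mono_AE, eventually_elim) (use le in \<open>auto intro: ennreal_leI\<close>)
  also have "\<dots> = ennreal (\<integral>x. 2 powr \<epsilon> * (1 + site_ratio x powr (- \<epsilon>)) \<partial>\<mu>)"
    using eps(2) by (intro nn_integral_eq_integral) auto
  also have "\<dots> \<le> ennreal c" by (intro ennreal_leI) (simp add: c_def)
  finally have c: "(\<integral>\<^sup>+x. ennreal ((1 - x) powr (- \<epsilon>)) \<partial>\<mu>) \<le> ennreal c" .
  have c1: "1 \<le> c" by (simp add: c_def)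
  \<comment> \<open>The normalisation (2c)^(-m) leaves the summable expectations 2^(-m).\<close>
  define f where "f m \<omega> = ennreal ((1 / (2 * c)) ^ m) * (\<Prod>i\<in>(\<lambda>i. - int i) ` {..<m}. ennreal ((1 - \<omega> i) powr (- \<epsilon>)))" for m \<omega>
  have "AE \<omega> in law. \<exists>B\<ge>1. \<forall>m. f m \<omega> \<le> ennreal B"
  proof (rule AE_bounded_of_summable_nn_integral)
    show "f m \<in> borel_measurable law" for m
      unfolding f_def by measurable
    show "summable (\<lambda>m. (1 / 2 :: real) ^ m)" by (rule summable_geometric) simp
    fix m
    have "(\<integral>\<^sup>+\<omega>. f m \<omega> \<partial>law) = ennreal ((1 / (2 * c)) ^ m) *
        (\<integral>\<^sup>+\<omega>. (\<Prod>i\<in>(\<lambda>i. - int i) ` {..<m}. ennreal ((1 - \<omega> i) powr (- \<epsilon>))) \<partial>law)"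
      unfolding f_def by (rule nn_integral_cmult) measurable
    also have "(\<integral>\<^sup>+\<omega>. (\<Prod>i\<in>(\<lambda>i. - int i) ` {..<m}. ennreal ((1 - \<omega> i) powr (- \<epsilon>))) \<partial>law)
        = (\<integral>\<^sup>+x. ennreal ((1 - x) powr (- \<epsilon>)) \<partial>\<mu>) ^ m"
      by (subst nn_integral_prod_coordinates) (auto simp: card_image inj_on_def)
    also have "\<dots> \<le> ennreal c ^ m" by (intro power_mono c) simp
    also have "ennreal ((1 / (2 * c)) ^ m) * ennreal c ^ m = ennreal ((1 / 2) ^ m)"
      using c1 by (simp add: ennreal_power ennreal_mult[symmetric] power_mult_distrib[symmetric])
    finally show "(\<integral>\<^sup>+\<omega>. f m \<omega> \<partial>law) \<le> ennreal ((1 / 2) ^ m)" by (simp add: mult_left_mono)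
  qed auto
  with AE_environment show ?thesis
  proof eventually_elim
    fix \<omega> assume "environment \<omega>" and "\<exists>B\<ge>1. \<forall>m. f m \<omega> \<le> ennreal B"
    then interpret environment \<omega> by simp
    from \<open>\<exists>B\<ge>1. _ B\<close> obtain B where B: "1 \<le> B" "\<And>m. f m \<omega> \<le> ennreal B" by blast
    have "B powr (- 1 / \<epsilon>) * exp (- (ln (2 * c) / \<epsilon> * real m)) \<le> (\<Prod>i<m. 1 - \<omega> (- int i))" for m
    proof -
      let ?D = "\<Prod>i<m. 1 - \<omega> (- int i)"
      have D: "0 < ?D" using env_less_1 by (intro prod_pos) auto
      have "(\<Prod>i\<in>(\<lambda>i. - int i) ` {..<m}. ennreal ((1 - \<omega> i) powr (- \<epsilon>))) = (\<Prod>i<m. ennreal ((1 - \<omega> (- int i)) powr (- \<epsilon>)))"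
        by (subst prod.reindex) (auto simp: inj_on_def)
      also have "\<dots> = ennreal (?D powr (- \<epsilon>))"
        using env_less_1 by (simp add: prod_ennreal prod_powr_distrib less_imp_le)
      finally have "f m \<omega> = ennreal ((1 / (2 * c)) ^ m * ?D powr (- \<epsilon>))"
        using c1 by (simp add: f_def ennreal_mult)
      then have "(1 / (2 * c)) ^ m * ?D powr (- \<epsilon>) \<le> B" using B(2)[of m] B(1) by (simp add: ennreal_le_iff)
      then have "?D powr (- \<epsilon>) \<le> B * (2 * c) ^ m"
        using c1 by (simp add: power_divide field_simps)
      moreover have "0 < ?D powr (- \<epsilon>)" using D by (simp only: powr_gt_zero)
      ultimately have "(B * (2 * c) ^ m) powr (- 1 / \<epsilon>) \<le> (?D powr (- \<epsilon>)) powr (- 1 / \<epsilon>)"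
        using eps(1) by (intro powr_mono2') simp_all
      also have "\<dots> = ?D" using D eps by (simp add: powr_powr)
      also have "(B * (2 * c) ^ m) powr (- 1 / \<epsilon>) = B powr (- 1 / \<epsilon>) * ((2 * c) ^ m) powr (- 1 / \<epsilon>)"
        using B(1) c1 by (simp add: powr_mult)
      also have "((2 * c) ^ m) powr (- 1 / \<epsilon>) = exp (- (ln (2 * c) / \<epsilon> * real m))"
      proof -
        have "((2 * c) ^ m) powr (- 1 / \<epsilon>) = exp (- 1 / \<epsilon> * ln ((2 * c) ^ m))"
          unfolding powr_def using c1 by simp
        also have "ln ((2 * c) ^ m) = real m * ln (2 * c)"
          by (rule ln_realpow)
        finally show ?thesis by (simp add: mult.commute)
      qed
      finally show ?thesis .
    qed
    moreover have "0 < ln (2 * c) / \<epsilon>" using c1 eps by simp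
    moreover have "0 < B powr (- 1 / \<epsilon>)" using B(1) by simp
    ultimately show "\<exists>b>0. \<exists>C>0. \<forall>m. b * exp (- (C * real m)) \<le> (\<Prod>i<m. 1 - \<omega> (- int i))"
      by blast
  qed
qed

text \<open>
  The quenched probability is at most the minimum of 1 and a sum of products of ratios, hence at most
  the sum of their s-th powers for s \<open>\<le>\<close> 1; the full sum need not be integrable.
\<close>

lemma annealed_far_left:
  obtains C q where "0 < C" "0 < q" "q < 1"
    "\<And>n m. (\<integral>\<^sup>+\<omega>. ennreal (walk_prob \<omega> n {..- int m} 0) \<partial>law) \<le> ennreal (C * q ^ m)"
proof -
  \<comment> \<open>s \<le> 1 gives t \<le> t^s for t \<le> 1, and s < \<kappa> gives a moment below
    1.\<close>
  define s where "s = min 1 \<kappa> / 2"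
  have s: "0 < s" "s < \<kappa>" "s \<le> 1" using kappa_pos by (auto simp: s_def)
  \<comment> \<open>A number between the moment and 1 that is certainly positive, as its logarithm
    is taken later.\<close>
  define q where "q = (1 + moment s) / 2"
  have q: "0 < q" "q < 1" "moment s \<le> q"
    using moment_nonneg[of s] moment_less_1[OF s(1,2)] by (auto simp: q_def)
  obtain \<gamma> where \<gamma>: "AE \<omega> in law. \<exists>K. regular_environment \<omega> K (1 / \<kappa> + 1) \<gamma>"
    using AE_regular_environment[of "1 / \<kappa> + 1"] by auto
  define a where "a m k \<omega> = (\<Prod>i\<in>{- int m + 1..- int m + int (m + k)}. rho \<omega> i) powr s" for m k \<omega>
  have [measurable]: "a m k \<in> borel_measurable law" for m k
    unfolding a_def by measurable
  have "(\<integral>\<^sup>+\<omega>. ennreal (walk_prob \<omega> n {..- int m} 0) \<partial>law) \<le> ennreal (1 / (1 - q) * q ^ m)" for n m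
  proof -
    have "(\<integral>\<^sup>+\<omega>. ennreal (walk_prob \<omega> n {..- int m} 0) \<partial>law) \<le> (\<integral>\<^sup>+\<omega>. (\<Sum>k. ennreal (a m k \<omega>)) \<partial>law)"
    proof (rule nn_integral_mono_AE, use \<gamma> in eventually_elim)
      fix \<omega> assume "\<exists>K. regular_environment \<omega> K (1 / \<kappa> + 1) \<gamma>"
      then obtain K where "regular_environment \<omega> K (1 / \<kappa> + 1) \<gamma>" by blast
      then interpret regular_environment \<omega> K "1 / \<kappa> + 1" \<gamma> .
      \<comment> \<open>t k = E(k) / E(-m), so the sum of all t k is \<open>escape 0\<close> divided
        by the weight at -m.\<close>
      define t where "t k = (\<Prod>i\<in>{- int m + 1..- int m + int (m + k)}. rho \<omega> i)" for k
      have t: "0 < t k" for k unfolding t_def by (intro prod_pos rho_pos)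
      have weight_t: "weight \<omega> (0 + int k) = weight \<omega> (- int m) * t k" for k
        using weight_ratio[of "- int m" "m + k"] by (simp add: t_def)
      show "ennreal (walk_prob \<omega> n {..- int m} 0) \<le> (\<Sum>k. ennreal (a m k \<omega>))"
      proof (cases "\<forall>k. t k \<le> 1")
        case True
        have summ: "summable t"
          using summable_weight[of 0] weight_pos[of "- int m"] unfolding weight_t by simp
        have "walk_prob \<omega> n {..- int m} 0 \<le> escape 0 / escape (- int m)" by (rule walk_prob_atMost_le)
        also have "\<dots> \<le> escape 0 / weight \<omega> (- int m)"
          using escape_pos[of 0] weight_pos[of "- int m"] weight_le_escape[of "- int m"] escape_pos[of "- int m"]
          by (intro divide_left_mono) auto
        also have "escape 0 = weight \<omega> (- int m) * suminf t"
          unfolding escape_def weight_t by (intro suminf_mult summ)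
        finally have "walk_prob \<omega> n {..- int m} 0 \<le> suminf t" using weight_pos[of "- int m"] by simp
        then have "ennreal (walk_prob \<omega> n {..- int m} 0) \<le> ennreal (suminf t)" by (rule ennreal_leI)
        also have "\<dots> = (\<Sum>k. ennreal (t k))"
          using t summ by (intro suminf_ennreal2[symmetric]) (auto intro: less_imp_le)
        also have "\<dots> \<le> (\<Sum>k. ennreal (a m k \<omega>))"
        proof (intro suminf_le ennreal_leI)
          show "t k \<le> a m k \<omega>" for k
            using powr_mono'[of s 1 "t k"] t[of k] True s by (simp add: a_def t_def)
        qed auto
        finally show ?thesis .
      next
        case False
        then obtain k where "1 < t k" unfolding not_all not_le by blast
        then have "1 \<le> a m k \<omega>" using s by (simp add: a_def t_def ge_one_powr_ge_zero)
        then have "ennreal (walk_prob \<omega> n {..- int m} 0) \<le> ennreal (a m k \<omega>)"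
          using walk_prob_bounds(2)[of n "{..- int m}" 0] by (intro ennreal_leI) linarith
        also have "\<dots> = (\<Sum>j\<in>{k}. ennreal (a m j \<omega>))" by simp
        also have "\<dots> \<le> (\<Sum>k. ennreal (a m k \<omega>))" by (rule sum_le_suminf) auto
        finally show ?thesis .
      qed
    qed
    also have "\<dots> = (\<Sum>k. (\<integral>\<^sup>+\<omega>. ennreal (a m k \<omega>) \<partial>law))"
      by (rule nn_integral_suminf) measurable
    also have "\<dots> = (\<Sum>k. ennreal (moment s ^ (m + k)))"
      unfolding a_def using s by (subst nn_integral_prod_rho_powr) (auto simp: nat_int_add add.commute)
    also have "\<dots> \<le> (\<Sum>k. ennreal (q ^ m * q ^ k))"
      using q moment_nonneg by (intro suminf_le ennreal_leI) (auto simp: power_add[symmetric] intro!: power_mono)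
    also have "\<dots> = ennreal (\<Sum>k. q ^ m * q ^ k)"
      using q by (intro suminf_ennreal2 summable_mult summable_geometric) auto
    also have "(\<Sum>k. q ^ m * q ^ k) = 1 / (1 - q) * q ^ m"
      using q by (subst suminf_mult) (auto simp: suminf_geometric summable_geometric)
    finally show ?thesis .
  qed
  then show ?thesis using q by (intro that[of "1 / (1 - q)" q]) auto
qed

section \<open>Annealed lower bounds from environments drifting to the left\<close>

lemma ratio_exceeds_1:
  obtains \<delta> p where "0 < \<delta>" "0 < p" "p \<le> 1"
    "measure \<mu> {x. 0 < x \<and> x < 1 \<and> exp \<delta> \<le> site_ratio x} = p"
proof -
  let ?A = "\<lambda>n. {x. 0 < x \<and> x < 1 \<and> exp (1 / real (Suc n)) \<le> site_ratio x}"
  have A: "?A n \<in> sets \<mu>" for n by simp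
  have "\<exists>n. measure \<mu> (?A n) \<noteq> 0"
  proof (rule ccontr)
    assume "\<not> ?thesis"
    then have "AE x in \<mu>. x \<notin> ?A n" for n
      using A[of n] by (simp add: single_site.prob_eq_0)
    then have "AE x in \<mu>. \<forall>n. x \<notin> ?A n" unfolding AE_all_countable by blast
    with AE_site have le1: "AE x in \<mu>. site_ratio x \<le> 1"
    proof eventually_elim
      case (elim x)
      show ?case
      proof (rule ccontr)
        assume *: "\<not> site_ratio x \<le> 1"
        then have "0 < ln (site_ratio x)" by simp
        then obtain n where "1 / real (Suc n) < ln (site_ratio x)"
          using nat_approx_posE by blast
        then have "exp (1 / real (Suc n)) \<le> exp (ln (site_ratio x))" by (simp del: of_nat_Suc)
        then show False using elim * by (auto simp del: of_nat_Suc)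
      qed
    qed
    \<comment> \<open>If \<rho> never exceeded 1, this nonnegative function of mean 0 would vanish,
      so \<rho> = 1 almost surely, which the negative mean of the logarithm excludes.\<close>
    define D where "D x = 1 - site_ratio x powr \<kappa>" for x
    have intD: "integrable \<mu> D" unfolding D_def using integrable_kappa by simp
    have nn: "AE x in \<mu>. 0 \<le> D x"
      using le1 AE_ratio_pos
      by eventually_elim (use kappa_pos in \<open>auto simp: D_def powr_le1\<close>)
    have "(\<integral>x. D x \<partial>\<mu>) = 0"
      unfolding D_def using integrable_kappa ratio_kappa by (simp add: single_site.prob_space)
    then have "AE x in \<mu>. D x = 0"
      using integral_nonneg_eq_0_iff_AE[OF intD nn] by simp
    then have "AE x in \<mu>. ln (site_ratio x) = 0"
      using AE_ratio_pos
    proof eventually_elim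
      case (elim x)
      then have "site_ratio x powr \<kappa> = 1" by (simp add: D_def)
      then have "\<kappa> * ln (site_ratio x) = 0" using elim by (simp add: powr_def split: if_splits)
      then show ?case using kappa_pos by simp
    qed
    moreover have "(\<lambda>x. ln (site_ratio x)) \<in> borel_measurable \<mu>"
      by (rule borel_measurable_site) measurable
    ultimately have "(\<integral>x. ln (site_ratio x) \<partial>\<mu>) = (\<integral>x. 0 \<partial>\<mu>)"
      by (intro integral_cong_AE) auto
    then show False using ln_ratio_neg by simp
  qed
  then obtain n where "measure \<mu> (?A n) \<noteq> 0" by blast
  then show ?thesis
    by (intro that[of "1 / real (Suc n)" "measure \<mu> (?A n)"]) (auto simp: zero_less_measure_iff simp del: of_nat_Suc)
qed

text \<open>On an event of probability p^(2m+1) all sites from -2m to 0 push left. The walk runs to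
  -2m, and from there the rim at -m is m uphill sites away, so the trap has depth at least \<delta>
  m. The second bound, meant for hitting times, takes the same event but only the descent to
  -m.\<close>

lemma annealed_trap:
  obtains \<delta> a where "0 < \<delta>" "0 < a"
    "\<And>m k. ennreal (exp (- (a * (1 + real m))) * (1 - exp (- (\<delta> * real m))) ^ k)
        \<le> (\<integral>\<^sup>+\<omega>. ennreal (walk_prob \<omega> (2 * m + k) {..- int m} 0) \<partial>law)"
    "\<And>m. ennreal (exp (- (a * (1 + real m)))) \<le> (\<integral>\<^sup>+\<omega>. ennreal (walk_prob \<omega> m {- int m} 0) \<partial>law)"
proof -
  obtain \<delta> p where \<delta>: "0 < \<delta>" and p: "0 < p" "p \<le> 1"
    and mp: "measure \<mu> {x. 0 < x \<and> x < 1 \<and> exp \<delta> \<le> site_ratio x} = p"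
    by (rule ratio_exceeds_1)
  let ?A = "{x. 0 < x \<and> x < 1 \<and> exp \<delta> \<le> site_ratio x}"
  \<comment> \<open>With this a, exp(-a (1+m)) = (p/2)^(2m+2) lies below the probability p^(2m+1) of
    the environment times the path cost 2^(-2m).\<close>
  define a where "a = 2 * ln (2 / p)"
  have a: "0 < a" using p by (simp add: a_def)
  define G where "G m = {\<omega>\<in>space law. \<forall>i\<in>{- int (2 * m)..0}. \<omega> i \<in> ?A}" for m :: nat
  have G_sets: "G m \<in> sets law" for m
    unfolding G_def by measurable
  have G: "emeasure law (G m) = ennreal (p ^ (2 * m + 1))" for m
  proof -
    have "emeasure law (G m) = (\<Prod>i\<in>{- int (2 * m)..0}. emeasure \<mu> ?A)"
      unfolding G_def by (rule product.emeasure_PiM_Collect) auto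
    also have "\<dots> = ennreal p ^ (2 * m + 1)"
      using mp by (simp add: single_site.emeasure_eq_measure nat_add_distrib nat_mult_distrib)
    also have "\<dots> = ennreal (p ^ (2 * m + 1))"
      using p by (intro ennreal_power) simp
    finally show ?thesis .
  qed
  have half: "(1 / 2) ^ (2 * m) \<le> (\<Prod>i<2 * m. 1 - \<omega> (- int i))"
       "(1 / 2) ^ m \<le> (\<Prod>i<m. 1 - \<omega> (- int i))" if "\<omega> \<in> G m" for \<omega> m
  proof -
    have *: "1 / 2 \<le> 1 - \<omega> (- int i)" if "i < 2 * m" for i
    proof -
      have "\<omega> (- int i) \<in> ?A" using \<open>\<omega> \<in> G m\<close> that by (auto simp: G_def)
      then have "0 < \<omega> (- int i)" "exp \<delta> \<le> site_ratio (\<omega> (- int i))" by auto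
      moreover have "1 < exp \<delta>" using \<delta> by simp
      ultimately have "0 < \<omega> (- int i)" "1 \<le> site_ratio (\<omega> (- int i))" by linarith+
      then show ?thesis by (simp add: site_ratio_def field_simps)
    qed
    have "(\<Prod>i<2 * m. 1 / 2) \<le> (\<Prod>i<2 * m. 1 - \<omega> (- int i))"
      using * by (intro prod_mono) auto
    then show "(1 / 2) ^ (2 * m) \<le> (\<Prod>i<2 * m. 1 - \<omega> (- int i))" by simp
    have "(\<Prod>i<m. 1 / 2) \<le> (\<Prod>i<m. 1 - \<omega> (- int i))"
      using * by (intro prod_mono) auto
    then show "(1 / 2) ^ m \<le> (\<Prod>i<m. 1 - \<omega> (- int i))" by simp
  qed
  have exp_a: "exp (- (a * (1 + real m))) \<le> (1 / 2) ^ (2 * m) * p ^ (2 * m + 1)" for m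
  proof -
    have "exp (- (a * (1 + real m))) = (p / 2) ^ (2 * m + 2)"
    proof -
      have "- (a * (1 + real m)) = real (2 * m + 2) * ln (p / 2)"
        using p by (simp add: a_def ln_div algebra_simps)
      then show ?thesis using p by (simp only: exp_of_nat_mult) simp
    qed
    also have "\<dots> = (1 / 2) ^ (2 * m) * p ^ (2 * m + 1) * (p / 4)"
      by (simp add: power_divide power_add power2_eq_square mult_ac)
    also have "\<dots> \<le> (1 / 2) ^ (2 * m) * p ^ (2 * m + 1) * 1"
      using p by (intro mult_left_mono) auto
    finally show ?thesis by simp
  qed
  have lower: "ennreal (exp (- (a * (1 + real m))) * t) \<le> (\<integral>\<^sup>+\<omega>. ennreal (f \<omega>) \<partial>law)"
    if f: "\<And>\<omega>. environment \<omega> \<Longrightarrow> \<omega> \<in> G m \<Longrightarrow> (1 / 2) ^ (2 * m) * t \<le> f \<omega>" and "0 \<le> t" for f :: "(int \<Rightarrow> real) \<Rightarrow> real" and t m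
  proof -
    have "ennreal (exp (- (a * (1 + real m))) * t) \<le> ennreal ((1 / 2) ^ (2 * m) * t * p ^ (2 * m + 1))"
      using mult_right_mono[OF exp_a[of m] \<open>0 \<le> t\<close>] by (intro ennreal_leI) (simp add: mult_ac)
    also have "\<dots> = ennreal ((1 / 2) ^ (2 * m) * t) * emeasure law (G m)"
      unfolding G using p \<open>0 \<le> t\<close> by (intro ennreal_mult) auto
    also have "\<dots> = (\<integral>\<^sup>+\<omega>. ennreal ((1 / 2) ^ (2 * m) * t) * indicator (G m) \<omega> \<partial>law)"
      by (rule nn_integral_cmult_indicator[symmetric]) (rule G_sets)
    also have "\<dots> \<le> (\<integral>\<^sup>+\<omega>. ennreal (f \<omega>) \<partial>law)"
      by (rule nn_integral_mono_AE, use AE_environment in eventually_elim)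
         (use f in \<open>auto intro: ennreal_leI split: split_indicator\<close>)
    finally show ?thesis .
  qed
  show ?thesis
  proof (rule that[OF \<delta> a])
    fix m k :: nat
    show "ennreal (exp (- (a * (1 + real m))) * (1 - exp (- (\<delta> * real m))) ^ k)
        \<le> (\<integral>\<^sup>+\<omega>. ennreal (walk_prob \<omega> (2 * m + k) {..- int m} 0) \<partial>law)"
    proof (rule lower)
      fix \<omega> assume "environment \<omega>" and GM: "\<omega> \<in> G m"
      then interpret environment \<omega> by simp
      let ?x = "- int (2 * m)" and ?d = "- int m"
      have "exp (\<delta> * real m) = (\<Prod>i\<in>{?x + 1..?x + int m}. exp \<delta>)"
        by (simp add: exp_of_nat_mult[symmetric] mult.commute)
      also have "\<dots> \<le> (\<Prod>i\<in>{?x + 1..?x + int m}. rho \<omega> i)"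
      proof (intro prod_mono conjI)
        fix i assume "i \<in> {?x + 1..?x + int m}"
        then have "\<omega> i \<in> ?A" using GM by (auto simp: G_def)
        then show "exp \<delta> \<le> rho \<omega> i" by (simp add: rho_site_ratio)
      qed simp
      finally have "exp (\<delta> * real m) * weight \<omega> ?x \<le> weight \<omega> ?d"
        using weight_ratio[of ?x m] weight_pos[of ?x] by (simp add: mult.commute)
      then have w: "weight \<omega> ?x / weight \<omega> ?d \<le> exp (- (\<delta> * real m))"
        using weight_pos[of ?d] by (simp add: exp_minus field_simps)
      also have "\<dots> \<le> 1" using \<delta> by simp
      finally have le: "weight \<omega> ?x \<le> weight \<omega> ?d" using weight_pos[of ?d] by (simp add: divide_le_eq)
      have nonneg: "0 \<le> (\<Prod>i<2 * m. 1 - \<omega> (0 - int i))"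
        using env_less_1 by (intro prod_nonneg) (auto intro: less_imp_le)
      have "(1 / 2) ^ (2 * m) * (1 - exp (- (\<delta> * real m))) ^ k
          \<le> (\<Prod>i<2 * m. 1 - \<omega> (0 - int i)) * (1 - weight \<omega> ?x / weight \<omega> ?d) ^ k"
        using half(1)[OF GM] w \<delta> nonneg by (intro mult_mono power_mono) simp_all
      also have "\<dots> \<le> (\<Prod>i<2 * m. 1 - \<omega> (0 - int i)) * walk_prob \<omega> k {..?d} (0 - int (2 * m))"
        using walk_prob_trap[OF _ le, of k] nonneg by (intro mult_left_mono) simp_all
      also have "\<dots> \<le> walk_prob \<omega> (2 * m + k) {..?d} 0" by (rule walk_prob_straight_path)
      finally show "(1 / 2) ^ (2 * m) * (1 - exp (- (\<delta> * real m))) ^ k \<le> walk_prob \<omega> (2 * m + k) {..?d} 0" .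
    qed (use \<delta> in simp)
  next
    fix m :: nat
    have "ennreal (exp (- (a * (1 + real m))) * 1) \<le> (\<integral>\<^sup>+\<omega>. ennreal (walk_prob \<omega> m {- int m} 0) \<partial>law)"
    proof (rule lower)
      fix \<omega> assume "environment \<omega>" and GM: "\<omega> \<in> G m"
      then interpret environment \<omega> by simp
      \<comment> \<open>This path has m steps only; the smaller factor 2^(-2m) is accepted in order
        to share \<open>lower\<close> with the trap bound.\<close>
      have "(1 / 2) ^ (2 * m) * 1 \<le> (1 / 2 :: real) ^ m" by (simp add: power_decreasing)
      also note half(2)[OF GM]
      also have "(\<Prod>i<m. 1 - \<omega> (- int i)) \<le> walk_prob \<omega> m {- int m} 0"
        using walk_prob_straight_path[of 0 m 0 "{- int m}"] by simp
      finally show "(1 / 2) ^ (2 * m) * 1 \<le> walk_prob \<omega> m {- int m} 0" .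
    qed simp
    then show "ennreal (exp (- (a * (1 + real m)))) \<le> (\<integral>\<^sup>+\<omega>. ennreal (walk_prob \<omega> m {- int m} 0) \<partial>law)" by simp
  qed
qed

end

section \<open>Deep traps\<close>

context iid_environment
begin

lemma indep_block_products:
  fixes K :: "'b \<Rightarrow> int set"
  assumes "disjoint_family_on K L"
  shows "product.indep_vars (\<lambda>_. borel) (\<lambda>b \<omega>. \<Prod>i\<in>K b. rho \<omega> i) L"
proof -
  have "product.indep_vars (\<lambda>b. Pi\<^sub>M (K b) (\<lambda>_. borel)) (\<lambda>b \<omega>. restrict (\<lambda>i. \<omega> i) (K b)) L"
    using assms by (intro product.indep_vars_restrict[OF indep_coordinates]) auto
  then have "product.indep_vars (\<lambda>_. borel) (\<lambda>b \<omega>. \<Prod>i\<in>K b. site_ratio (restrict (\<lambda>i. \<omega> i) (K b) i)) L"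
    by (rule product.indep_vars_compose2) measurable
  also have "(\<lambda>b \<omega>. \<Prod>i\<in>K b. site_ratio (restrict (\<lambda>i. \<omega> i) (K b) i)) = (\<lambda>b \<omega>. \<Prod>i\<in>K b. rho \<omega> i)"
    by (intro ext prod.cong) (auto simp: rho_site_ratio)
  finally show ?thesis .
qed

definition tail :: "nat \<Rightarrow> real \<Rightarrow> real" where
  "tail k t = measure law {\<omega>. t \<le> (\<Prod>i\<in>{1..int k}. rho \<omega> i)}"

lemma sets_block_event [measurable]: "{\<omega>. t \<le> (\<Prod>i\<in>I. rho \<omega> i)} \<in> sets law"
proof -
  have "{\<omega> \<in> space law. t \<le> (\<Prod>i\<in>I. rho \<omega> i)} \<in> sets law" by measurable
  then show ?thesis by simp
qed

text \<open>Translation invariance of the product measure: the law of a block depends only on its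
  length.\<close>

lemma measure_block_event:
  "measure law {\<omega>. t \<le> (\<Prod>i\<in>{c+1..c+int k}. rho \<omega> i)} = tail k t"
proof -
  let ?T = "\<lambda>\<omega>. \<lambda>n\<in>UNIV. \<omega> (n + c) :: real"
  have d: "distr law law ?T = law"
    by (rule distr_PiM_reindex) (auto simp: single_site.prob_space_axioms inj_on_def)
  have T: "?T \<in> measurable law law"
    by (rule measurable_restrict) (simp add: measurable_component_singleton)
  have "tail k t = measure (distr law law ?T) {\<omega>. t \<le> (\<Prod>i\<in>{1..int k}. rho \<omega> i)}"
    unfolding d by (simp add: tail_def)
  also have "\<dots> = measure law (?T -` {\<omega>. t \<le> (\<Prod>i\<in>{1..int k}. rho \<omega> i)} \<inter> space law)"
    by (rule measure_distr[OF T]) measurable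
  also have "?T -` {\<omega>. t \<le> (\<Prod>i\<in>{1..int k}. rho \<omega> i)} \<inter> space law = {\<omega>. t \<le> (\<Prod>i\<in>{c+1..c+int k}. rho \<omega> i)}"
  proof -
    have "(\<Prod>i\<in>{1..int k}. rho (?T \<omega>) i) = (\<Prod>i\<in>{c+1..c+int k}. rho \<omega> i)" for \<omega>
      by (rule prod.reindex_bij_witness[of _ "\<lambda>i. i - c" "\<lambda>i. i + c"]) (auto simp: rho_def)
    then show ?thesis by simp
  qed
  finally show ?thesis by simp
qed

text \<open>
  The moment of order kappa of a product of k ratios is 1 for every k, although the lower moments
  tend to 0; hence its upper tail cannot decay faster than with exponent kappa.
\<close>

lemma heavy_tail:
  assumes "0 < \<delta>"
  obtains k a where "0 < a" "exp (- ((\<kappa> + \<delta>) * a)) \<le> tail k (exp a)"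
proof (rule ccontr)
  note found = that
  assume "\<not> thesis"
  then have light: "tail k (exp a) \<le> exp (- ((\<kappa> + \<delta>) * a))" if "0 < a" for k a
    using found[OF that, of k] by linarith
  define s where "s = \<kappa> / 2"
  have s: "0 < s" "s < \<kappa>" using kappa_pos by (auto simp: s_def)
  \<comment> \<open>Under the light tail, \<open>?g T\<close> bounds the part of the \<kappa>-moment
    above exp T, summed over the shells from exp(T+j) to exp(T+j+1). It does not depend on k, so T
    is fixed first; k then makes the part below exp T small through the moment of order s <
    \<kappa>.\<close>
  let ?g = "\<lambda>T. exp \<kappa> * exp (- (\<delta> * real T)) * (1 / (1 - exp (- \<delta>)))"
  have "?g \<longlonglongrightarrow> 0" using assms by real_asymp
  then have "eventually (\<lambda>T. ?g T < 1 / 2) sequentially" by (rule order_tendstoD) simp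
  \<comment> \<open>T \<ge> 1 keeps the levels T + j positive, as \<open>light\<close>
    demands.\<close>
  then have "eventually (\<lambda>T. ?g T < 1 / 2 \<and> 1 \<le> T) sequentially"
    using eventually_ge_at_top[of 1] by eventually_elim simp
  then obtain T where T: "?g T < 1 / 2" "1 \<le> T"
    by (auto simp: eventually_sequentially)
  have "(\<lambda>k. exp ((\<kappa> - s) * real T) * moment s ^ k) \<longlonglongrightarrow> 0"
    using moment_nonneg[of s] moment_less_1[OF s]
    by (intro tendsto_mult_right_zero LIMSEQ_power_zero) simp
  then have "eventually (\<lambda>k. exp ((\<kappa> - s) * real T) * moment s ^ k < 1 / 2) sequentially"
    by (rule order_tendstoD) simp
  then obtain k where k: "exp ((\<kappa> - s) * real T) * moment s ^ k < 1 / 2"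
    by (auto simp: eventually_sequentially)
  define Y where "Y \<omega> = (\<Prod>i\<in>{1..int k}. rho \<omega> i)" for \<omega>
  have Y_meas [measurable]: "Y \<in> borel_measurable law" unfolding Y_def by measurable
  define A where "A j = {\<omega>. exp (real (T + j)) \<le> Y \<omega>}" for j
  have A_sets [measurable]: "A j \<in> sets law" for j
    unfolding A_def Y_def by measurable
  have Y_moment: "(\<integral>\<^sup>+\<omega>. ennreal (Y \<omega> powr r) \<partial>law) = ennreal (moment r ^ k)" if "0 < r" "r \<le> \<kappa>" for r
    unfolding Y_def using that by (subst nn_integral_prod_rho_powr) auto
  have "ennreal 1 = (\<integral>\<^sup>+\<omega>. ennreal (Y \<omega> powr \<kappa>) \<partial>law)"
    using Y_moment[of \<kappa>] kappa_pos ratio_kappa by (simp add: moment_def)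
  also have "\<dots> \<le> (\<integral>\<^sup>+\<omega>. ennreal (exp ((\<kappa> - s) * real T)) * ennreal (Y \<omega> powr s)
      + (\<Sum>j. ennreal (exp (\<kappa> * real (T + j + 1))) * indicator (A j) \<omega>) \<partial>law)"
  proof (rule nn_integral_mono_AE, use AE_environment in eventually_elim)
    fix \<omega> assume "environment \<omega>"
    then interpret environment \<omega> .
    have Y: "0 < Y \<omega>" unfolding Y_def by (intro prod_pos rho_pos)
    show "ennreal (Y \<omega> powr \<kappa>) \<le> ennreal (exp ((\<kappa> - s) * real T)) * ennreal (Y \<omega> powr s)
      + (\<Sum>j. ennreal (exp (\<kappa> * real (T + j + 1))) * indicator (A j) \<omega>)"
    proof (cases "Y \<omega> \<le> exp (real T)")
      case True
      have "Y \<omega> powr \<kappa> = Y \<omega> powr (\<kappa> - s) * Y \<omega> powr s"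
        by (simp add: powr_add[symmetric])
      also have "\<dots> \<le> exp (real T) powr (\<kappa> - s) * Y \<omega> powr s"
        using True Y s by (intro mult_right_mono powr_mono2) auto
      also have "exp (real T) powr (\<kappa> - s) = exp ((\<kappa> - s) * real T)" by (simp add: powr_def)
      finally have "ennreal (Y \<omega> powr \<kappa>) \<le> ennreal (exp ((\<kappa> - s) * real T)) * ennreal (Y \<omega> powr s)"
        by (simp add: ennreal_mult[symmetric] ennreal_leI)
      then show ?thesis by (rule order_trans) simp
    next
      case False
      then have "real T < ln (Y \<omega>)" using Y ln_less_cancel_iff[of "exp (real T)" "Y \<omega>"] by simp
      then have fl: "int T \<le> \<lfloor>ln (Y \<omega>)\<rfloor>" by (simp add: le_floor_iff)
      define j where "j = nat (\<lfloor>ln (Y \<omega>)\<rfloor> - int T)"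
      have j: "real (T + j) = real_of_int \<lfloor>ln (Y \<omega>)\<rfloor>" using fl by (simp add: j_def)
      have "real (T + j) \<le> ln (Y \<omega>)" "ln (Y \<omega>) \<le> real (T + j + 1)"
        using j by linarith+
      then have "exp (real (T + j)) \<le> exp (ln (Y \<omega>))" "exp (ln (Y \<omega>)) \<le> exp (real (T + j + 1))"
        by (simp_all only: exp_le_cancel_iff)
      then have Aj: "\<omega> \<in> A j" and le: "Y \<omega> \<le> exp (real (T + j + 1))"
        using Y by (simp_all add: A_def)
      have "Y \<omega> powr \<kappa> \<le> exp (real (T + j + 1)) powr \<kappa>"
        using le Y kappa_pos by (intro powr_mono2) auto
      also have "\<dots> = exp (\<kappa> * real (T + j + 1))" by (simp add: powr_def)
      finally have "ennreal (Y \<omega> powr \<kappa>) \<le> ennreal (exp (\<kappa> * real (T + j + 1)))" by (rule ennreal_leI)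
      also have "\<dots> = (\<Sum>j\<in>{j}. ennreal (exp (\<kappa> * real (T + j + 1))) * indicator (A j) \<omega>)"
        using Aj by simp
      also have "\<dots> \<le> (\<Sum>j. ennreal (exp (\<kappa> * real (T + j + 1))) * indicator (A j) \<omega>)"
        by (rule sum_le_suminf) auto
      finally show ?thesis by (rule order_trans) simp
    qed
  qed
  also have "\<dots> = ennreal (exp ((\<kappa> - s) * real T)) * (\<integral>\<^sup>+\<omega>. ennreal (Y \<omega> powr s) \<partial>law)
      + (\<Sum>j. ennreal (exp (\<kappa> * real (T + j + 1))) * emeasure law (A j))"
  proof -
    have "(\<integral>\<^sup>+\<omega>. (\<Sum>j. ennreal (exp (\<kappa> * real (T + j + 1))) * indicator (A j) \<omega>) \<partial>law)
        = (\<Sum>j. \<integral>\<^sup>+\<omega>. ennreal (exp (\<kappa> * real (T + j + 1))) * indicator (A j) \<omega> \<partial>law)"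
      by (rule nn_integral_suminf) measurable
    also have "\<dots> = (\<Sum>j. ennreal (exp (\<kappa> * real (T + j + 1))) * emeasure law (A j))"
      by (intro suminf_cong nn_integral_cmult_indicator A_sets)
    finally show ?thesis
      by (subst nn_integral_add) (auto simp: nn_integral_cmult)
  qed
  also have "\<dots> \<le> ennreal (exp ((\<kappa> - s) * real T) * moment s ^ k) + (\<Sum>j. ennreal (exp \<kappa> * exp (- (\<delta> * real T)) * exp (- \<delta>) ^ j))"
  proof (intro add_mono suminf_le)
    show "ennreal (exp ((\<kappa> - s) * real T)) * (\<integral>\<^sup>+\<omega>. ennreal (Y \<omega> powr s) \<partial>law) \<le> ennreal (exp ((\<kappa> - s) * real T) * moment s ^ k)"
      using Y_moment[of s] s moment_nonneg[of s] by (simp add: ennreal_mult)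
    fix j
    have "ennreal (exp (\<kappa> * real (T + j + 1))) * emeasure law (A j) = ennreal (exp (\<kappa> * real (T + j + 1)) * tail k (exp (real (T + j))))"
      by (simp add: A_def Y_def tail_def product.emeasure_eq_measure ennreal_mult)
    also have "\<dots> \<le> ennreal (exp (\<kappa> * real (T + j + 1)) * exp (- ((\<kappa> + \<delta>) * real (T + j))))"
      using T(2) by (intro ennreal_leI mult_left_mono light) auto
    also have "exp (\<kappa> * real (T + j + 1)) * exp (- ((\<kappa> + \<delta>) * real (T + j))) = exp \<kappa> * exp (- (\<delta> * real T)) * exp (- \<delta>) ^ j"
      by (simp add: exp_add[symmetric] exp_of_nat_mult[symmetric] algebra_simps)
    finally show "ennreal (exp (\<kappa> * real (T + j + 1))) * emeasure law (A j) \<le> ennreal (exp \<kappa> * exp (- (\<delta> * real T)) * exp (- \<delta>) ^ j)" .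
  qed auto
  also have "(\<Sum>j. ennreal (exp \<kappa> * exp (- (\<delta> * real T)) * exp (- \<delta>) ^ j)) = ennreal (\<Sum>j. exp \<kappa> * exp (- (\<delta> * real T)) * exp (- \<delta>) ^ j)"
    using assms by (intro suminf_ennreal2 summable_mult summable_geometric) auto
  also have "(\<Sum>j. exp \<kappa> * exp (- (\<delta> * real T)) * exp (- \<delta>) ^ j) = ?g T"
    using assms by (subst suminf_mult) (auto simp: suminf_geometric summable_geometric)
  also have "ennreal (exp ((\<kappa> - s) * real T) * moment s ^ k) + ennreal (?g T) = ennreal (exp ((\<kappa> - s) * real T) * moment s ^ k + ?g T)"
    using assms moment_nonneg by (intro ennreal_plus[symmetric]) auto
  finally have "1 \<le> exp ((\<kappa> - s) * real T) * moment s ^ k + ?g T"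
    using assms moment_nonneg[of s] by (subst (asm) ennreal_le_iff) (auto intro!: add_nonneg_nonneg)
  then show False using T(1) k by linarith
qed

text \<open>If each of j adjacent independent blocks gains exp a, the whole stretch gains exp(a j).
  This extends one favourable pair (k, a) to all scales, with length proportional to height.\<close>

lemma tail_power: "tail k (exp a) ^ j \<le> tail (k * j) (exp (a * real j))"
proof (cases "j = 0")
  case True
  then show ?thesis using product.P.prob_space by (simp add: tail_def)
next
  case False
  define K where "K b = {int (k * b) + 1..int (k * b) + int k}" for b :: nat
  have disj: "disjoint_family_on K {..<j}"
  proof (unfold disjoint_family_on_def, intro ballI impI)
    have *: "K b \<inter> K c = {}" if "b < c" for b c
    proof -
      have "k * b + k \<le> k * c" using that mult_le_mono2[of "Suc b" c k] by simp
      then show ?thesis by (auto simp: K_def simp flip: of_nat_add of_nat_mult)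
    qed
    fix b c :: nat assume "b \<noteq> c"
    then show "K b \<inter> K c = {}" using *[of b c] *[of c b] by (cases "b < c") auto
  qed
  let ?E = "\<lambda>b. (\<lambda>\<omega>. \<Prod>i\<in>K b. rho \<omega> i) -` {exp a..} \<inter> space law"
  have E: "?E b = {\<omega>. exp a \<le> (\<Prod>i\<in>K b. rho \<omega> i)}" for b by auto
  have E_sets: "?E b \<in> sets law" for b unfolding E by measurable
  have E_prob: "measure law (?E b) = tail k (exp a)" for b
    by (subst E, unfold K_def) (rule measure_block_event)
  have "tail k (exp a) ^ j = (\<Prod>b<j. measure law (?E b))"
    by (simp only: E_prob prod_constant card_lessThan)
  also have "\<dots> = measure law (\<Inter>b<j. ?E b)"
    using False by (intro product.indep_varsD_finite[OF indep_block_products[OF disj], symmetric]) auto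
  also have "\<dots> \<le> measure law {\<omega>. exp (a * real j) \<le> (\<Prod>i\<in>{1..int (k * j)}. rho \<omega> i)}"
  proof (rule product.finite_measure_mono_AE)
    show "AE \<omega> in law. \<omega> \<in> (\<Inter>b<j. ?E b) \<longrightarrow> \<omega> \<in> {\<omega>. exp (a * real j) \<le> (\<Prod>i\<in>{1..int (k * j)}. rho \<omega> i)}"
      using AE_environment
    proof (eventually_elim, intro impI)
      fix \<omega> assume "environment \<omega>" and *: "\<omega> \<in> (\<Inter>b<j. ?E b)"
      then interpret environment \<omega> by simp
      have "exp (a * real i) \<le> weight \<omega> (int (k * i))" if "i \<le> j" for i
        using that
      proof (induction i)
        case 0
        show ?case by (simp add: weight_def)
      next
        case (Suc i)
        have "exp a \<le> (\<Prod>i\<in>K i. rho \<omega> i)" using * Suc.prems by auto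
        then have "exp (a * real i) * exp a \<le> weight \<omega> (int (k * i)) * (\<Prod>i\<in>K i. rho \<omega> i)"
          using Suc weight_pos[of "int (k * i)"] by (intro mult_mono) auto
        also have "\<dots> = weight \<omega> (int (k * Suc i))"
          using weight_ratio[of "int (k * i)" k] by (simp add: K_def algebra_simps)
        finally show ?case by (simp add: exp_add[symmetric] algebra_simps)
      qed
      from this[of j] show "\<omega> \<in> {\<omega>. exp (a * real j) \<le> (\<Prod>i\<in>{1..int (k * j)}. rho \<omega> i)}"
        by (simp add: weight_def)
    qed
  qed measurable
  finally show ?thesis by (simp add: tail_def)
qed

text \<open>The stretch from -2N to -N contains about N / ln N independent blocks of logarithmic
  length, each deep enough with probability at least N^(-\<tau>) for some \<tau> < 1. That all fail
  has probability at most about exp(-c N^(1-\<tau>) / ln N), which is summable, so Borel-Cantelli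
  applies.\<close>

lemma AE_trap:
  assumes "0 < \<theta>" "\<theta> < 1 / \<kappa>"
  shows "AE \<omega> in law. \<forall>\<^sub>F N in sequentially. \<exists>x d. - (2 * int N) \<le> x \<and> x \<le> d \<and> d \<le> - int N \<and>
     real N powr \<theta> * weight \<omega> x \<le> weight \<omega> d"
proof -
  \<comment> \<open>Room is needed twice: between \<theta> and \<open>\<theta>2\<close> for rounding
    the number of pieces down, and between \<open>\<theta>2\<close> and 1/\<kappa> for the loss
    \<delta> in the tail exponent.\<close>
  define \<theta>2 where "\<theta>2 = (\<theta> + 1 / \<kappa>) / 2"
  have th: "\<theta> < \<theta>2" "\<theta>2 < 1 / \<kappa>" "0 < \<theta>2" using assms by (auto simp: \<theta>2_def)
  define \<delta> where "\<delta> = (1 / \<theta>2 - \<kappa>) / 2"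
  have "\<kappa> < 1 / \<theta>2" using th kappa_pos by (simp add: field_simps)
  moreover have "0 < (X - \<kappa>) / 2" "\<kappa> + (X - \<kappa>) / 2 < X" if "\<kappa> < X" for X
    using that by (simp_all add: field_simps)
  ultimately have \<delta>: "0 < \<delta>" "\<kappa> + \<delta> < 1 / \<theta>2" unfolding \<delta>_def by blast+
  define \<tau> where "\<tau> = (\<kappa> + \<delta>) * \<theta>2"
  have tau: "0 < \<tau>" "\<tau> < 1" using \<delta> th kappa_pos by (auto simp: \<tau>_def pos_less_divide_eq)
  obtain k a where a: "0 < a" and heavy: "exp (- ((\<kappa> + \<delta>) * a)) \<le> tail k (exp a)"
    using heavy_tail[OF \<delta>(1)] by blast
  \<comment> \<open>For k = 0 the product is empty and equals 1 < exp a, so the tail would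
    vanish.\<close>
  have k: "0 < k"
  proof (rule ccontr)
    assume "\<not> 0 < k"
    then have "tail k (exp a) = measure law {}" using a by (simp add: tail_def not_le)
    then show False using heavy by (simp add: not_le[symmetric])
  qed
  \<comment> \<open>The number of pieces of height a that fit under the target height
    \<open>\<theta>2 * ln (real N)\<close>; a block consists of that many pieces of length
    k.\<close>
  define j where "j N = nat \<lfloor>\<theta>2 * ln (real N) / a\<rfloor>" for N :: nat
  define len where "len N = k * j N" for N
  have j_upper: "a * real (j N) \<le> \<theta>2 * ln (real N)" if "1 \<le> N" for N
  proof -
    have "0 \<le> \<theta>2 * ln (real N) / a" using that th a by simp
    then have "real (j N) \<le> \<theta>2 * ln (real N) / a" by (simp add: j_def)
    then show ?thesis using a by (simp add: field_simps)
  qed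
  have j_lower: "\<theta>2 * ln (real N) - a \<le> a * real (j N)" for N
  proof -
    have "\<theta>2 * ln (real N) / a - 1 \<le> real (j N)" unfolding j_def by linarith
    then show ?thesis using a by (simp add: field_simps)
  qed
  define K where "K N b = {(- 2 * int N + int b * int (len N)) + 1..(- 2 * int N + int b * int (len N)) + int (len N)}" for N b
  have disj: "disjoint_family_on (K N) L" for N L
  proof (unfold disjoint_family_on_def, intro ballI impI)
    have *: "K N b \<inter> K N c = {}" if "b < c" for b c
    proof -
      have "int b * int (len N) + int (len N) \<le> int c * int (len N)"
        using that mult_right_mono[of "int b + 1" "int c" "int (len N)"] by (simp add: algebra_simps)
      then show ?thesis by (auto simp: K_def)
    qed
    fix b c :: nat assume "b \<noteq> c"
    then show "K N b \<inter> K N c = {}" using *[of b c] *[of c b] by (cases "b < c") auto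
  qed
  define success where "success N b = {\<omega>. exp (a * real (j N)) \<le> (\<Prod>i\<in>K N b. rho \<omega> i)}" for N b
  define failure where "failure N = (\<Inter>b<N div len N. - success N b)" for N
  have success_sets: "success N b \<in> sets law" for N b
    unfolding success_def by measurable
  have compl_sets: "- success N b \<in> sets law" for N b
    using sets.compl_sets[OF success_sets[of N b]] by (simp add: Compl_eq_Diff_UNIV)
  have failure_sets: "failure N \<in> sets law" for N
  proof (cases "N div len N = 0")
    \<comment> \<open>This includes \<open>len N = 0\<close>, where the quotient is 0 by convention:
      the intersection over no block is the whole space.\<close>
    case True
    then have "failure N = space law" by (simp add: failure_def)
    then show ?thesis by (simp only: sets.top)
  next
    case False
    then show ?thesis unfolding failure_def by (intro sets.finite_INT compl_sets) auto
  qed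
  have success_prob: "real N powr (- \<tau>) \<le> measure law (success N b)" if "1 \<le> N" for N b
  proof -
    have "real N powr (- \<tau>) = exp (- ((\<kappa> + \<delta>) * (\<theta>2 * ln (real N))))"
      using that by (simp add: powr_def \<tau>_def)
    also have "\<dots> \<le> exp (- ((\<kappa> + \<delta>) * (a * real (j N))))"
      using j_upper[OF that] kappa_pos \<delta> by (simp add: mult_left_mono)
    also have "\<dots> = exp (- ((\<kappa> + \<delta>) * a)) ^ j N"
      by (simp add: exp_of_nat_mult[symmetric] mult_ac)
    also have "\<dots> \<le> tail k (exp a) ^ j N" by (intro power_mono heavy) simp
    also have "\<dots> \<le> tail (len N) (exp (a * real (j N)))" unfolding len_def by (rule tail_power)
    also have "\<dots> = measure law (success N b)" unfolding success_def K_def measure_block_event ..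
    finally show ?thesis .
  qed
  have failure_prob: "measure law (failure N) \<le> exp (- (real N powr (- \<tau>) * (real N / (k * \<theta>2 / a * ln (real N)) - 1)))"
    if N: "1 \<le> N" and pos: "1 \<le> \<theta>2 * ln (real N) / a" for N
  proof -
    let ?B = "N div len N"
    have "1 \<le> j N" using pos by (simp add: j_def le_nat_floor)
    then have len: "0 < len N" using k by (simp add: len_def)
    have lnN: "0 < ln (real N)"
      using pos th a zero_less_mult_pos[of \<theta>2 "ln (real N)"] by (simp add: field_simps)
    have scale_pos: "0 < real k * \<theta>2 / a * ln (real N)" using lnN th a k by simp
    show ?thesis
    proof (cases "?B = 0")
      \<comment> \<open>Independence is applied to a nonempty family only; without any block the
        right side is at least 1.\<close>
      case True
      have "N < len N" using True len by (simp add: div_eq_0_iff)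
      then have "real N \<le> real (len N)" by simp
      also have "\<dots> \<le> k * \<theta>2 / a * ln (real N)"
        using j_upper[OF N] a k by (simp add: len_def field_simps)
      finally have "real N / (k * \<theta>2 / a * ln (real N)) \<le> 1"
        by (subst divide_le_eq_1_pos[OF scale_pos])
      then have "real N / (k * \<theta>2 / a * ln (real N)) - 1 \<le> 0" by simp
      then have "0 \<le> - (real N powr (- \<tau>) * (real N / (k * \<theta>2 / a * ln (real N)) - 1))"
        by (simp add: mult_nonneg_nonpos)
      then have "1 \<le> exp (- (real N powr (- \<tau>) * (real N / (k * \<theta>2 / a * ln (real N)) - 1)))"
        by simp
      with product.prob_le_1 show ?thesis by (rule order_trans)
    next
      case False
      have "failure N = (\<Inter>b<?B. (\<lambda>\<omega>. \<Prod>i\<in>K N b. rho \<omega> i) -` {..<exp (a * real (j N))} \<inter> space law)"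
        unfolding failure_def by (intro INF_cong) (auto simp: success_def)
      then have "measure law (failure N) = (\<Prod>b<?B. measure law ((\<lambda>\<omega>. \<Prod>i\<in>K N b. rho \<omega> i) -` {..<exp (a * real (j N))} \<inter> space law))"
        using False by (simp only:) (intro product.indep_varsD_finite[OF indep_block_products[OF disj]], auto)
      also have "\<dots> = (\<Prod>b<?B. 1 - measure law (success N b))"
      proof (intro prod.cong refl)
        fix b
        have "(\<lambda>\<omega>. \<Prod>i\<in>K N b. rho \<omega> i) -` {..<exp (a * real (j N))} \<inter> space law = space law - success N b"
          by (auto simp: success_def)
        then show "measure law ((\<lambda>\<omega>. \<Prod>i\<in>K N b. rho \<omega> i) -` {..<exp (a * real (j N))} \<inter> space law) = 1 - measure law (success N b)"
          using product.prob_compl[OF success_sets] by (simp only:)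
      qed
      also have "\<dots> \<le> (\<Prod>b<?B. exp (- (real N powr (- \<tau>))))"
      proof (intro prod_mono conjI)
        fix b
        show "0 \<le> 1 - measure law (success N b)" using product.prob_le_1 by simp
        have "1 - measure law (success N b) \<le> 1 + - (real N powr (- \<tau>))" using success_prob[OF N] by simp
        also have "\<dots> \<le> exp (- (real N powr (- \<tau>)))" by (rule exp_ge_add_one_self)
        finally show "1 - measure law (success N b) \<le> exp (- (real N powr (- \<tau>)))" .
      qed
      also have "\<dots> = exp (- (real N powr (- \<tau>) * real ?B))"
        by (simp add: exp_of_nat_mult[symmetric] mult.commute)
      also have "\<dots> \<le> exp (- (real N powr (- \<tau>) * (real N / (k * \<theta>2 / a * ln (real N)) - 1)))"
      proof -
        \<comment> \<open>Rounding down the number of blocks costs at most 1.\<close>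
        have "real N < real (len N) * (real ?B + 1)"
        proof -
          have "N < len N * (?B + 1)" using len by (metis Suc_eq_plus1 dividend_less_times_div mult_Suc_right add.commute)
          then have "real N < real (len N * (?B + 1))" by (simp only: of_nat_less_iff)
          then show ?thesis by (simp add: algebra_simps)
        qed
        also have "\<dots> \<le> (k * \<theta>2 / a * ln (real N)) * (real ?B + 1)"
          using j_upper[OF N] a k by (intro mult_right_mono) (auto simp: len_def field_simps)
        finally have "real N / (k * \<theta>2 / a * ln (real N)) < real ?B + 1"
          by (subst pos_divide_less_eq[OF scale_pos]) (simp only: mult.commute)
        then have "real N / (k * \<theta>2 / a * ln (real N)) - 1 \<le> real ?B" by simp
        then show ?thesis by (simp add: mult_left_mono)
      qed
      finally show ?thesis .
    qed
  qed
  have ev_pos: "\<forall>\<^sub>F N in sequentially. 1 \<le> \<theta>2 * ln (real N) / a"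
    using th a by real_asymp
  have "summable (\<lambda>N. measure law (failure N))"
  proof (rule summable_comparison_test_ev)
    let ?u = "\<lambda>N. exp (- (real N powr (- \<tau>) * (real N / (k * \<theta>2 / a * ln (real N)) - 1)))"
    show "summable ?u"
    proof (rule summable_comparison_test_bigo)
      have "summable (\<lambda>N. real N powr (-2))" by (subst summable_real_powr_iff) simp
      then show "summable (\<lambda>N. norm (real N powr (-2)))" by simp
      have "0 < real k" using k by simp
      then show "?u \<in> O(\<lambda>N. real N powr (-2))"
        using tau th a by real_asymp
    qed
    show "\<forall>\<^sub>F N in sequentially. norm (measure law (failure N)) \<le> ?u N"
      using ev_pos eventually_ge_at_top[of 1] by eventually_elim (use failure_prob in auto)
  qed
  then have "AE \<omega> in law. \<forall>\<^sub>F N in sequentially. \<omega> \<in> space law - failure N"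
    using failure_sets by (intro borel_cantelli_AE1) (auto simp: product.emeasure_eq_measure)
  with AE_environment show ?thesis
  proof eventually_elim
    fix \<omega> assume "environment \<omega>" and ev: "\<forall>\<^sub>F N in sequentially. \<omega> \<in> space law - failure N"
    then interpret environment \<omega> by simp
    \<comment> \<open>The surplus in the exponent, from \<theta> to \<open>\<theta>2\<close>,
      absorbs the factor exp a lost by rounding down.\<close>
    have ev2: "\<forall>\<^sub>F N in sequentially. real N powr \<theta> \<le> exp (\<theta>2 * ln (real N) - a)"
      using th assms by real_asymp
    show "\<forall>\<^sub>F N in sequentially. \<exists>x d. - (2 * int N) \<le> x \<and> x \<le> d \<and> d \<le> - int N \<and>
       real N powr \<theta> * weight \<omega> x \<le> weight \<omega> d"
      using ev ev2
    proof eventually_elim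
      case (elim N)
      then obtain b where b: "b < N div len N" and succ: "\<omega> \<in> success N b"
        by (auto simp: failure_def)
      define x where "x = - 2 * int N + int b * int (len N)"
      define d where "d = x + int (len N)"
      have "(b + 1) * len N \<le> N div len N * len N" using b by (intro mult_right_mono) auto
      also have "\<dots> \<le> N" by simp
      finally have "int ((b + 1) * len N) \<le> int N" by (simp only: of_nat_le_iff)
      then have "d \<le> - int N" by (simp add: d_def x_def algebra_simps)
      moreover have "- (2 * int N) \<le> x" "x \<le> d" by (auto simp: x_def d_def)
      moreover have "real N powr \<theta> * weight \<omega> x \<le> weight \<omega> d"
      proof -
        have "real N powr \<theta> \<le> exp (\<theta>2 * ln (real N) - a)" by (rule elim(2))
        also have "\<dots> \<le> exp (a * real (j N))" using j_lower by simp
        also have "\<dots> \<le> (\<Prod>i\<in>K N b. rho \<omega> i)" using succ by (simp add: success_def)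
        finally have "real N powr \<theta> * weight \<omega> x \<le> weight \<omega> x * (\<Prod>i\<in>K N b. rho \<omega> i)"
          using weight_pos[of x] by (simp add: mult.commute)
        also have "\<dots> = weight \<omega> d"
          unfolding d_def weight_ratio K_def x_def ..
        finally show ?thesis .
      qed
      ultimately show ?case by blast
    qed
  qed
qed

end

section \<open>Exponents\<close>

text \<open>Bounds are obtained for exponents away from \<theta>, so two sequences tending to
  \<theta> stand in for it; being countable, they are compatible with almost sure
  statements.\<close>

lemma tendsto_ln_ln_exponent:
  fixes p :: "nat \<Rightarrow> real" and a b :: "nat \<Rightarrow> real"
  assumes a: "a \<longlonglongrightarrow> \<theta>" and b: "b \<longlonglongrightarrow> \<theta>"
    and upper: "\<And>i. \<forall>\<^sub>F n in sequentially. p n \<le> exp (- (real n powr a i))"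
    and lower: "\<And>i. \<forall>\<^sub>F n in sequentially. exp (- (real n powr b i)) \<le> p n"
  shows "(\<lambda>n. ln (- ln (p n)) / ln (real n)) \<longlonglongrightarrow> \<theta>"
proof (rule order_tendstoI)
  fix y assume "y < \<theta>"
  then have "\<forall>\<^sub>F i in sequentially. y < a i" using a by (intro order_tendstoD)
  then obtain i where i: "y < a i" by (auto simp: eventually_sequentially)
  show "\<forall>\<^sub>F n in sequentially. y < ln (- ln (p n)) / ln (real n)"
    \<comment> \<open>The lower bound is there to give p n > 0, so that the inner logarithm is
      genuine.\<close>
    using upper[of i] lower[of 0] eventually_ge_at_top[of 2]
  proof eventually_elim
    case (elim n)
    have "0 < p n" using elim(2) exp_gt_zero less_le_trans by blast
    then have "ln (p n) \<le> - (real n powr a i)" using elim(1) ln_le_cancel_iff[of "p n" "exp (- (real n powr a i))"] by simp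
    then have "real n powr a i \<le> - ln (p n)" by simp
    moreover have "0 < real n powr a i" using elim(3) by simp
    ultimately have "ln (real n powr a i) \<le> ln (- ln (p n))" by (intro iffD2[OF ln_le_cancel_iff]) linarith+
    then have "a i * ln (real n) \<le> ln (- ln (p n))" using elim(3) by (simp add: ln_powr)
    moreover have "0 < ln (real n)" using elim(3) by simp
    ultimately have "a i \<le> ln (- ln (p n)) / ln (real n)" by (simp add: pos_le_divide_eq)
    with i show ?case by linarith
  qed
next
  fix y assume "\<theta> < y"
  then have "\<forall>\<^sub>F i in sequentially. b i < y" using b by (intro order_tendstoD)
  then obtain i where i: "b i < y" by (auto simp: eventually_sequentially)
  show "\<forall>\<^sub>F n in sequentially. ln (- ln (p n)) / ln (real n) < y"
    \<comment> \<open>The upper bound is there to give p n < 1, so that the outer logarithm has a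
      positive argument.\<close>
    using upper[of 0] lower[of i] eventually_ge_at_top[of 2]
  proof eventually_elim
    case (elim n)
    have pos: "0 < p n" using elim(2) exp_gt_zero less_le_trans by blast
    then have "- (real n powr b i) \<le> ln (p n)" using elim(2) by (simp add: ln_ge_iff)
    then have 1: "- ln (p n) \<le> real n powr b i" by simp
    have "p n < 1" using elim(1,3) by (rule_tac le_less_trans) auto
    then have "0 < - ln (p n)" using pos by simp
    then have "ln (- ln (p n)) \<le> ln (real n powr b i)" using 1 by (intro iffD2[OF ln_le_cancel_iff]) linarith+
    then have "ln (- ln (p n)) \<le> b i * ln (real n)" using elim(3) by (simp add: ln_powr)
    moreover have "0 < ln (real n)" using elim(3) by simp
    ultimately have "ln (- ln (p n)) / ln (real n) \<le> b i" by (simp add: pos_divide_le_eq)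
    with i show ?case by linarith
  qed
qed

text \<open>A factor rather than a difference, so that the exponents stay positive for every
  \<theta> > 0.\<close>

lemma exponent_below: "(\<lambda>i. \<theta> * (real i + 1) / (real i + 2)) \<longlonglongrightarrow> \<theta>"
  by real_asymp

lemma exponent_above: "(\<lambda>i. \<theta> + 1 / (real i + 1)) \<longlonglongrightarrow> \<theta>"
  by real_asymp

lemma exponent_below_bounds:
  assumes "0 < \<theta>"
  shows "0 < \<theta> * (real i + 1) / (real i + 2)" "\<theta> * (real i + 1) / (real i + 2) < \<theta>"
  using assms by (simp_all add: pos_divide_less_eq)

lemma exp_le_one_minus:
  fixes q :: real
  assumes "0 \<le> q" "q \<le> 1 / 2"
  shows "exp (- (2 * q)) \<le> 1 - q"
proof -
  have "1 \<le> (1 - q) * (1 + 2 * q)" using assms by (simp add: algebra_simps) (use mult_left_mono[of q "1/2" q] in simp)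
  also have "\<dots> \<le> (1 - q) * exp (2 * q)"
    using assms exp_ge_add_one_self[of "2 * q"] by (intro mult_left_mono) auto
  finally show ?thesis by (simp add: exp_minus field_simps)
qed

text \<open>The ceiling, because rounding -n^\<nu> down gives minus the ceiling of n^\<nu>.\<close>

definition level :: "real \<Rightarrow> nat \<Rightarrow> nat" where
  "level \<nu> n = nat \<lceil>real n powr \<nu>\<rceil>"

lemma level_bounds: "real n powr \<nu> \<le> real (level \<nu> n)" "real (level \<nu> n) \<le> real n powr \<nu> + 1"
proof -
  have *: "0 \<le> real n powr \<nu>" by simp
  have r: "real (level \<nu> n) = real_of_int \<lceil>real n powr \<nu>\<rceil>"
    unfolding level_def by (rule of_nat_nat) (use * in linarith)
  show "real n powr \<nu> \<le> real (level \<nu> n)" "real (level \<nu> n) \<le> real n powr \<nu> + 1"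
    unfolding r by linarith+
qed

lemma below_level: "real_of_int x < - (real n powr \<nu>) \<Longrightarrow> x \<le> - int (level \<nu> n)"
  using level_bounds(2)[of \<nu> n] by linarith

lemma floor_level: "\<lfloor>- (real n powr \<nu>)\<rfloor> = - int (level \<nu> n)"
proof -
  have "0 \<le> \<lceil>real n powr \<nu>\<rceil>" using ceiling_mono[of 0 "real n powr \<nu>"] by simp
  then show ?thesis by (simp add: level_def floor_minus)
qed

lemma hitting_time_level: "hitting_time (- (real n powr \<nu>)) X < enat k \<longleftrightarrow> (\<exists>i<k. X i = - int (level \<nu> n))"
  by (simp add: hitting_time_less_iff floor_level)

abbreviation (input) far_left_event :: "real \<Rightarrow> nat \<Rightarrow> (nat \<Rightarrow> int) set" where
  "far_left_event \<nu> n \<equiv> {X. real_of_int (X n) < - (real n powr \<nu>)}"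

abbreviation (input) hitting_event :: "real \<Rightarrow> nat \<Rightarrow> (nat \<Rightarrow> int) set" where
  "hitting_event \<nu> n \<equiv> {X. hitting_time (- (real n powr \<nu>)) X < enat n}"

lemma sets_position_event: "{X. X n \<in> A} \<in> sets path_space"
proof -
  have "{X. X n \<in> A} = {X \<in> space path_space. X n \<in> A}" by (simp add: space_PiM)
  also have "\<dots> \<in> sets path_space" by measurable
  finally show ?thesis .
qed

lemma sets_far_left_event: "far_left_event \<nu> n \<in> sets path_space"
  using sets_position_event[of n "{x. real_of_int x < - (real n powr \<nu>)}"] by simp

section \<open>Events of the path in terms of one-time marginals\<close>

context environment
begin

lemma quenched_mono:
  "A \<subseteq> B \<Longrightarrow> B \<in> sets path_space \<Longrightarrow> measure (quenched_law \<omega>) A \<le> measure (quenched_law \<omega>) B"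
  using finite_measure.finite_measure_mono[of "quenched_law \<omega>" A B]
    prob_space.finite_measure[OF prob_space_quenched_law] by auto

lemma far_left_upper:
  "measure (quenched_law \<omega>) (far_left_event \<nu> n) \<le> walk_prob \<omega> n {..- int (level \<nu> n)} 0"
proof -
  have "measure (quenched_law \<omega>) (far_left_event \<nu> n) \<le> measure (quenched_law \<omega>) {X. X n \<in> {..- int (level \<nu> n)}}"
    by (rule quenched_mono[OF _ sets_position_event]) (auto dest: below_level)
  then show ?thesis by (simp only: measure_quenched_law_walk_prob)
qed

lemma far_left_lower:
  assumes "real_of_int d < - (real n powr \<nu>)"
  shows "walk_prob \<omega> n {..d} 0 \<le> measure (quenched_law \<omega>) (far_left_event \<nu> n)"
proof -
  have "measure (quenched_law \<omega>) {X. X n \<in> {..d}} \<le> measure (quenched_law \<omega>) (far_left_event \<nu> n)"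
    by (rule quenched_mono[OF _ sets_far_left_event]) (use assms in force)
  then show ?thesis by (simp only: measure_quenched_law_walk_prob)
qed

text \<open>Being at the level implies being at or below it; the union over the times costs only a
  factor n.\<close>

lemma hitting_upper:
  "measure (quenched_law \<omega>) (hitting_event \<nu> n) \<le> (\<Sum>k<n. walk_prob \<omega> k {..- int (level \<nu> n)} 0)"
proof -
  interpret prob_space "quenched_law \<omega>" by (rule prob_space_quenched_law)
  have "measure (quenched_law \<omega>) (hitting_event \<nu> n)
      \<le> measure (quenched_law \<omega>) (\<Union>k<n. {X. X k \<in> {..- int (level \<nu> n)}})"
    by (rule quenched_mono) (auto simp: hitting_time_level intro!: sets.finite_UN sets_position_event[unfolded atMost_iff] simp del: atMost_iff)
  also have "\<dots> \<le> (\<Sum>k<n. measure (quenched_law \<omega>) {X. X k \<in> {..- int (level \<nu> n)}})"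
    by (rule finite_measure_subadditive_finite) (auto simp del: atMost_iff simp: sets_position_event)
  finally show ?thesis by (simp only: measure_quenched_law_walk_prob)
qed

text \<open>The event is already realised by standing at the level at the earliest possible
  time.\<close>

lemma hitting_lower:
  assumes "level \<nu> n < n"
  shows "walk_prob \<omega> (level \<nu> n) {- int (level \<nu> n)} 0 \<le> measure (quenched_law \<omega>) (hitting_event \<nu> n)"
proof -
  have "measure (quenched_law \<omega>) {X. X (level \<nu> n) \<in> {- int (level \<nu> n)}} \<le> measure (quenched_law \<omega>) (hitting_event \<nu> n)"
    by (rule quenched_mono[OF _ sets_hitting_time_less]) (use assms in \<open>auto simp: hitting_time_level\<close>)
  then show ?thesis by (simp only: measure_quenched_law_walk_prob)
qed

end

section \<open>Quenched upper bounds\<close>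

context regular_environment
begin

lemma walk_prob_level_upper:
  "walk_prob \<omega> k {..- int (level \<nu> n)} 0
    \<le> escape 0 * K * (2 + real n powr \<nu>) powr \<beta> * exp (- (2 * \<gamma> * (real n powr \<nu>)))"
proof -
  have "walk_prob \<omega> k {..- int (level \<nu> n)} 0
      \<le> escape 0 * K * (1 + real (level \<nu> n)) powr \<beta> * exp (- (2 * \<gamma> * real (level \<nu> n)))"
    by (rule walk_prob_far_left)
  also have "\<dots> \<le> escape 0 * K * (2 + real n powr \<nu>) powr \<beta> * exp (- (2 * \<gamma> * (real n powr \<nu>)))"
    using level_bounds[where n = n and \<nu> = \<nu>] escape_pos[of 0] K_ge_1 gamma_pos beta_nonneg
    by (intro mult_mono powr_mono2) auto
  finally show ?thesis .
qed

lemma quenched_upper_nu: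
  assumes \<nu>: "0 < \<nu>" and a: "0 < a" "a < \<nu>"
  shows "\<forall>\<^sub>F n in sequentially. measure (quenched_law \<omega>) (far_left_event \<nu> n) \<le> exp (- (real n powr a))"
    and "\<forall>\<^sub>F n in sequentially. measure (quenched_law \<omega>) (hitting_event \<nu> n) \<le> exp (- (real n powr a))"
proof -
  define c where "c = escape 0 * K"
  have c: "0 < c" using escape_pos[of 0] K_ge_1 by (simp add: c_def)
  let ?u = "\<lambda>n. c * (2 + real n powr \<nu>) powr \<beta> * exp (- (2 * \<gamma> * (real n powr \<nu>)))"
  have ev: "\<forall>\<^sub>F n in sequentially. real n * ?u n \<le> exp (- (real n powr a))"
    using c \<nu> a gamma_pos by real_asymp
  have bound: "walk_prob \<omega> k {..- int (level \<nu> n)} 0 \<le> ?u n" for k n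
    using walk_prob_level_upper[of k \<nu> n] by (simp add: c_def)
  show "\<forall>\<^sub>F n in sequentially. measure (quenched_law \<omega>) (far_left_event \<nu> n) \<le> exp (- (real n powr a))"
    using ev eventually_ge_at_top[of 1]
  proof eventually_elim
    case (elim n)
    have "measure (quenched_law \<omega>) (far_left_event \<nu> n) \<le> 1 * ?u n"
      using order_trans[OF far_left_upper bound] by simp
    also have "\<dots> \<le> real n * ?u n" using elim(2) c by (intro mult_right_mono) auto
    finally show ?case using elim(1) by linarith
  qed
  show "\<forall>\<^sub>F n in sequentially. measure (quenched_law \<omega>) (hitting_event \<nu> n) \<le> exp (- (real n powr a))"
    using ev
  proof eventually_elim
    case (elim n)
    have "measure (quenched_law \<omega>) (hitting_event \<nu> n) \<le> (\<Sum>k<n. walk_prob \<omega> k {..- int (level \<nu> n)} 0)"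
      by (rule hitting_upper)
    also have "\<dots> \<le> (\<Sum>k<n. ?u n)" by (intro sum_mono bound)
    finally show ?case using elim by simp
  qed
qed

text \<open>The event is enlarged to negativity at time n, so \<nu> does not enter the rate.\<close>

lemma quenched_upper_trap:
  assumes \<nu>: "0 < \<nu>" and a: "0 < a" "a < 1 / (1 + \<beta>)"
  shows "\<forall>\<^sub>F n in sequentially. measure (quenched_law \<omega>) (far_left_event \<nu> n) \<le> exp (- (real n powr a))"
proof -
  obtain c D where cD: "0 < c" "0 < D"
    "\<And>n L. walk_prob \<omega> n {..-1} 0 \<le>
       exp (- (c * real n / (1 + real L) powr \<beta>)) + D * (1 + real L) powr \<beta> * exp (- (2 * \<gamma> * real L))"
    using walk_prob_negative by blast
  \<comment> \<open>With L = n^\<alpha> the contraction exponent n / L^\<beta> and the escape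
    exponent L have the same order, since 1 - \<alpha> \<beta> = \<alpha>.\<close>
  define \<alpha> where "\<alpha> = 1 / (1 + \<beta>)"
  have \<alpha>: "0 < \<alpha>" "a < \<alpha>" using beta_nonneg a by (auto simp: \<alpha>_def)
  have e: "1 - \<alpha> * \<beta> = \<alpha>" using beta_nonneg by (simp add: \<alpha>_def field_simps)
  define e where "e = \<alpha> * \<beta>"
  define c' where "c' = c / 2 powr \<beta>"
  define D' where "D' = D * 2 powr \<beta>"
  have c': "0 < c'" "0 < D'" using cD by (auto simp: c'_def D'_def)
  have ev: "\<forall>\<^sub>F n in sequentially. exp (- (c' * real n powr \<alpha>)) \<le> exp (- (real n powr a)) / 2"
    using c' \<alpha> a(1) by real_asymp
  have ev': "\<forall>\<^sub>F n in sequentially. D' * real n * exp (- (2 * \<gamma> * (real n powr \<alpha> - 1))) \<le> exp (- (real n powr a)) / 2"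
    using c' \<alpha> a(1) gamma_pos by real_asymp
  show ?thesis
    using ev ev' eventually_ge_at_top[of 1]
  proof eventually_elim
    case (elim n)
    define L where "L = nat \<lfloor>real n powr \<alpha>\<rfloor>"
    have n1: "1 \<le> real n powr \<alpha>" using elim(3) \<alpha> by (simp add: ge_one_powr_ge_zero)
    have L: "real L \<le> real n powr \<alpha>" "real n powr \<alpha> - 1 \<le> real L"
    proof -
      have r: "real L = real_of_int \<lfloor>real n powr \<alpha>\<rfloor>"
        unfolding L_def by (rule of_nat_nat) (use n1 in linarith)
      show "real L \<le> real n powr \<alpha>" "real n powr \<alpha> - 1 \<le> real L" unfolding r by linarith+
    qed
    have P: "(1 + real L) powr \<beta> \<le> 2 powr \<beta> * real n powr e"
    proof -
      have "(1 + real L) powr \<beta> \<le> (2 * real n powr \<alpha>) powr \<beta>"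
        using L(1) n1 beta_nonneg by (intro powr_mono2) auto
      also have "\<dots> = 2 powr \<beta> * real n powr e" unfolding powr_mult by (simp add: powr_powr e_def)
      finally show ?thesis .
    qed
    have "c' * real n powr \<alpha> = c * real n / (2 powr \<beta> * real n powr e)"
    proof -
      have "real n powr \<alpha> = real n powr (1 - e)" using e by (simp add: e_def)
      also have "\<dots> = real n / real n powr e" using elim(3) by (simp add: powr_diff)
      finally show ?thesis by (simp add: c'_def)
    qed
    also have "\<dots> \<le> c * real n / (1 + real L) powr \<beta>"
      using P cD(1) elim(3) by (intro divide_left_mono mult_pos_pos) auto
    finally have 1: "exp (- (c * real n / (1 + real L) powr \<beta>)) \<le> exp (- (c' * real n powr \<alpha>))" by simp
    \<comment> \<open>A crude power of n suffices, as this factor is beaten by the exponential next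
      to it.\<close>
    have "real n powr e \<le> real n powr 1"
      using e \<alpha> elim(3) by (intro powr_mono) (auto simp: e_def)
    with P have P': "(1 + real L) powr \<beta> \<le> 2 powr \<beta> * real n"
      using elim(3) by (auto elim!: order_trans)
    have 2: "D * (1 + real L) powr \<beta> * exp (- (2 * \<gamma> * real L))
        \<le> D * (2 powr \<beta> * real n) * exp (- (2 * \<gamma> * (real n powr \<alpha> - 1)))"
      using P' L(2) cD(2) gamma_pos by (intro mult_mono mult_left_mono) auto
    have "measure (quenched_law \<omega>) (far_left_event \<nu> n) \<le> walk_prob \<omega> n {..- int (level \<nu> n)} 0"
      by (rule far_left_upper)
    also have "\<dots> \<le> walk_prob \<omega> n {..-1} 0"
    proof (rule walk_prob_mono)
      have "1 \<le> real n powr \<nu>" using elim(3) \<nu> by (simp add: ge_one_powr_ge_zero)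
      then have "1 \<le> level \<nu> n" using level_bounds(1)[of n \<nu>] by linarith
      then show "{..- int (level \<nu> n)} \<subseteq> {..-1}" by auto
    qed
    also have "\<dots> \<le> exp (- (c * real n / (1 + real L) powr \<beta>)) + D * (1 + real L) powr \<beta> * exp (- (2 * \<gamma> * real L))"
      by (rule cD(3))
    finally show ?case using 1 2 elim(1,2) unfolding D'_def mult.assoc by linarith
  qed
qed

end

section \<open>Quenched lower bounds\<close>

context environment
begin

lemma quenched_lower_hitting:
  assumes path: "\<And>m. b * exp (- (C * real m)) \<le> (\<Prod>i<m. 1 - \<omega> (- int i))"
    and b: "0 < b" "0 < C" and \<nu>: "0 < \<nu>" "\<nu> < 1" and e: "\<nu> < e"
  shows "\<forall>\<^sub>F n in sequentially. exp (- (real n powr e)) \<le> measure (quenched_law \<omega>) (hitting_event \<nu> n)"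
proof -
  have ev: "\<forall>\<^sub>F n in sequentially. exp (- (real n powr e)) \<le> b * exp (- (C * (real n powr \<nu> + 1)))"
    using b \<nu> e by real_asymp
  have ev2: "\<forall>\<^sub>F n in sequentially. real n powr \<nu> + 1 < real n"
    using \<nu> by real_asymp
  show ?thesis using ev ev2
  proof eventually_elim
    case (elim n)
    let ?m = "level \<nu> n"
    have m: "?m < n" using elim(2) level_bounds(2)[of \<nu> n] by linarith
    have "exp (- (real n powr e)) \<le> b * exp (- (C * (real n powr \<nu> + 1)))" by (rule elim(1))
    also have "\<dots> \<le> b * exp (- (C * real ?m))"
      using level_bounds(2)[of \<nu> n] b by (intro mult_left_mono) auto
    also have "\<dots> \<le> (\<Prod>i<?m. 1 - \<omega> (- int i))" by (rule path)
    also have "\<dots> \<le> walk_prob \<omega> ?m {- int ?m} 0"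
      using walk_prob_straight_path[of 0 ?m 0 "{- int ?m}"] by simp
    also have "\<dots> \<le> measure (quenched_law \<omega>) (hitting_event \<nu> n)" by (rule hitting_lower[OF m])
    finally show ?case .
  qed
qed

text \<open>The descent to a trap at distance N = n^\<theta> costs order n^\<theta> in the exponent.
  A trap of depth t ln N lets the walk out at rate at most n^(-\<theta> t), so n steps cost n^(1 -
  \<theta> t). The exponent f dominates both, and e > f absorbs the constants.\<close>

lemma quenched_lower_trap:
  assumes path: "\<And>m. b * exp (- (C * real m)) \<le> (\<Prod>i<m. 1 - \<omega> (- int i))"
    and b: "0 < b" "0 < C"
    and trap: "\<forall>\<^sub>F N in sequentially. \<exists>x d. - (2 * int N) \<le> x \<and> x \<le> d \<and> d \<le> - int N \<and>
     real N powr t * weight \<omega> x \<le> weight \<omega> d"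
    and \<theta>: "0 < \<theta>" "\<theta> < 1" "\<nu> \<le> \<theta>" and t: "0 < t" and f: "1 - \<theta> * t \<le> f" and f': "\<theta> < f" "f < e"
  shows "\<forall>\<^sub>F n in sequentially. exp (- (real n powr e)) \<le> measure (quenched_law \<omega>) (far_left_event \<nu> n)"
proof -
  define s where "s = - (\<theta> * t)"
  have s: "s < 0" using \<theta> t by (simp add: s_def)
  \<comment> \<open>The additional 1 puts the trap strictly to the left of -n^\<theta>, as the
    strict event requires.\<close>
  let ?N = "\<lambda>n. level \<theta> n + 1"
  have "filterlim ?N at_top sequentially"
  proof (rule filterlim_at_top_mono)
    show "filterlim (\<lambda>n. nat \<lfloor>real n powr \<theta>\<rfloor>) at_top sequentially" using \<theta> by real_asymp
    show "\<forall>\<^sub>F n in sequentially. nat \<lfloor>real n powr \<theta>\<rfloor> \<le> ?N n"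
      unfolding level_def by (intro always_eventually allI) linarith
  qed
  with trap have trap': "\<forall>\<^sub>F n in sequentially. \<exists>x d. - (2 * int (?N n)) \<le> x \<and> x \<le> d \<and> d \<le> - int (?N n) \<and>
     real (?N n) powr t * weight \<omega> x \<le> weight \<omega> d"
    by (rule eventually_compose_filterlim)
  have ev: "\<forall>\<^sub>F n in sequentially. exp (- (real n powr e)) \<le>
      b * exp (- (C * (2 * (real n powr \<theta> + 2)))) * exp (- (2 * real n powr f))"
    using b \<theta> f' by real_asymp
  \<comment> \<open>The descent, of at most 2N steps, ends before time n.\<close>
  have ev2: "\<forall>\<^sub>F n in sequentially. 2 * (real n powr \<theta> + 2) < real n" using \<theta> by real_asymp
  have ev3: "\<forall>\<^sub>F n in sequentially. real n powr s \<le> 1 / 2" using s by real_asymp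
  show ?thesis using ev ev2 ev3 trap' eventually_ge_at_top[of 1]
  proof eventually_elim
    case (elim n)
    define M where "M = ?N n"
    have M_bounds: "real n powr \<theta> + 1 \<le> real M" "real M \<le> real n powr \<theta> + 2"
      using level_bounds[where \<nu> = \<theta> and n = n] by (auto simp: M_def)
    from elim(4)[folded M_def] obtain x d where xd: "- (2 * int M) \<le> x" "x \<le> d" "d \<le> - int M"
      and w: "real M powr t * weight \<omega> x \<le> weight \<omega> d" by blast
    define m where "m = nat (- x)"
    have "x \<le> 0" using xd by linarith
    then have m: "int m = - x" by (simp add: m_def)
    have "real m = - real_of_int x" using m by linarith
    moreover have "- real_of_int x \<le> 2 * real M" using xd(1) by linarith
    ultimately have "real m \<le> 2 * real M" by simp
    also have "\<dots> \<le> 2 * (real n powr \<theta> + 2)" using M_bounds(2) by (intro mult_left_mono) auto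
    finally have m_le: "real m \<le> 2 * (real n powr \<theta> + 2)" .
    then have m_n: "m < n" using elim(2) by linarith
    define q where "q = weight \<omega> x / weight \<omega> d"
    have n\<theta>: "0 < real n powr \<theta>" using elim(5) by simp
    have q_le: "q \<le> real n powr s"
    proof -
      have "(real n powr \<theta>) powr t \<le> real M powr t" using M_bounds t by (intro powr_mono2) auto
      then have "real n powr (\<theta> * t) * weight \<omega> x \<le> real M powr t * weight \<omega> x"
        using weight_pos[of x] by (intro mult_right_mono) (auto simp: powr_powr)
      also note w
      finally have "real n powr (\<theta> * t) * weight \<omega> x \<le> weight \<omega> d" .
      moreover have "0 < real n powr (\<theta> * t)" using elim(5) by simp
      ultimately show ?thesis
        using weight_pos[of d] by (simp add: q_def s_def powr_minus field_simps)
    qed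
    have "0 \<le> q" using weight_pos[of x] weight_pos[of d] by (simp add: q_def)
    moreover have "q \<le> 1 / 2" using q_le elim(3) by linarith
    ultimately have q: "0 \<le> q" "q \<le> 1 / 2" by auto
    have le: "weight \<omega> x \<le> weight \<omega> d"
      using q(2) weight_pos[of d] weight_pos[of x] by (simp add: q_def field_simps)
    have "exp (- (2 * real n powr f)) \<le> exp (- (2 * q)) ^ (n - m)"
    proof -
      have "real (n - m) * (2 * q) \<le> real n * (2 * real n powr s)"
        using q_le q by (intro mult_mono) auto
      also have "\<dots> = 2 * real n powr (1 + s)" using elim(5) by (simp add: powr_add)
      also have "\<dots> \<le> 2 * real n powr f"
        using f elim(5) by (intro mult_left_mono powr_mono) (auto simp: s_def)
      finally show ?thesis by (simp add: exp_of_nat_mult[symmetric])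
    qed
    also have "\<dots> \<le> (1 - q) ^ (n - m)" using exp_le_one_minus[OF q] by (intro power_mono) auto
    also have "\<dots> \<le> walk_prob \<omega> (n - m) {..d} x" unfolding q_def by (rule walk_prob_trap[OF xd(2) le])
    finally have 1: "exp (- (2 * real n powr f)) \<le> walk_prob \<omega> (n - m) {..d} (0 - int m)" using m by simp
    have "b * exp (- (C * (2 * (real n powr \<theta> + 2)))) \<le> b * exp (- (C * real m))"
      using m_le b by (intro mult_left_mono) auto
    also have "\<dots> \<le> (\<Prod>i<m. 1 - \<omega> (0 - int i))" using path[of m] by simp
    finally have 2: "b * exp (- (C * (2 * (real n powr \<theta> + 2)))) \<le> (\<Prod>i<m. 1 - \<omega> (0 - int i))" .
    have "exp (- (real n powr e)) \<le> b * exp (- (C * (2 * (real n powr \<theta> + 2)))) * exp (- (2 * real n powr f))"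
      by (rule elim(1))
    also have "\<dots> \<le> (\<Prod>i<m. 1 - \<omega> (0 - int i)) * walk_prob \<omega> (n - m) {..d} (0 - int m)"
      using 1 2 b by (intro mult_mono) (auto intro: order_trans[rotated])
    also have "\<dots> \<le> walk_prob \<omega> (m + (n - m)) {..d} 0" by (rule walk_prob_straight_path)
    also have "\<dots> \<le> measure (quenched_law \<omega>) (far_left_event \<nu> n)"
    proof -
      have "real n powr \<nu> \<le> real n powr \<theta>" using \<theta> elim(5) by (intro powr_mono) auto
      moreover have "real_of_int d \<le> - real M" using xd(3) by linarith
      ultimately have "real_of_int d < - (real n powr \<nu>)" using M_bounds by linarith
      then show ?thesis using far_left_lower m_n by simp
    qed
    finally show ?case .
  qed
qed

end

section \<open>Almost sure exponents\<close>

context iid_environment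
begin

lemma quenched_hitting_exponent:
  assumes eps: "0 < \<epsilon>" "integrable \<mu> (\<lambda>x. site_ratio x powr (- \<epsilon>))" and \<nu>: "0 < \<nu>" "\<nu> < 1"
  shows "AE \<omega> in law. (\<lambda>n. ln (- ln (measure (quenched_law \<omega>) (hitting_event \<nu> n))) / ln (real n)) \<longlonglongrightarrow> \<nu>"
proof -
  obtain \<gamma> where \<gamma>: "AE \<omega> in law. \<exists>K. regular_environment \<omega> K (1 / \<kappa> + 1) \<gamma>"
    using AE_regular_environment[of "1 / \<kappa> + 1"] by auto
  show ?thesis
    using \<gamma> AE_straight_path[OF eps]
  proof eventually_elim
    case (elim \<omega>)
    from elim(1) obtain K where "regular_environment \<omega> K (1 / \<kappa> + 1) \<gamma>" by blast
    then interpret regular_environment \<omega> K "1 / \<kappa> + 1" \<gamma> .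
    from elim(2) obtain b C where b: "0 < b" "0 < C" and path: "\<And>m. b * exp (- (C * real m)) \<le> (\<Prod>i<m. 1 - \<omega> (- int i))"
      by blast
    show ?case
      by (rule tendsto_ln_ln_exponent[OF exponent_below exponent_above])
         (use quenched_upper_nu(2)[OF \<nu>(1) exponent_below_bounds[OF \<nu>(1)]]
            quenched_lower_hitting[OF path b \<nu>] in auto)
  qed
qed

lemma quenched_far_left_exponent:
  assumes eps: "0 < \<epsilon>" "integrable \<mu> (\<lambda>x. site_ratio x powr (- \<epsilon>))" and \<nu>: "0 < \<nu>" "\<nu> < 1"
  shows "AE \<omega> in law. (\<lambda>n. ln (- ln (measure (quenched_law \<omega>) (far_left_event \<nu> n))) / ln (real n))
      \<longlonglongrightarrow> max \<nu> (\<kappa> / (\<kappa> + 1))"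
proof -
  define \<theta> where "\<theta> = max \<nu> (\<kappa> / (\<kappa> + 1))"
  have \<theta>: "0 < \<theta>" "\<theta> < 1" "\<nu> \<le> \<theta>" "\<kappa> / (\<kappa> + 1) \<le> \<theta>"
    using \<nu> kappa_pos by (auto simp: \<theta>_def)
  define a where "a i = \<theta> * (real i + 1) / (real i + 2)" for i
  define b where "b i = \<theta> + 1 / (real i + 1)" for i
  have a: "0 < a i" "a i < \<theta>" for i using exponent_below_bounds[OF \<theta>(1)] by (auto simp: a_def)
  have upper: "AE \<omega> in law. \<forall>\<^sub>F n in sequentially. measure (quenched_law \<omega>) (far_left_event \<nu> n) \<le> exp (- (real n powr a i))" for i
  proof (cases "a i < \<nu>")
    case True
    obtain \<gamma> where \<gamma>: "AE \<omega> in law. \<exists>K. regular_environment \<omega> K (1 / \<kappa> + 1) \<gamma>"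
      using AE_regular_environment[of "1 / \<kappa> + 1"] by auto
    then show ?thesis
      by eventually_elim (use True \<nu> a regular_environment.quenched_upper_nu(1) in blast)
  next
    case False
    then have ai: "a i < \<kappa> / (\<kappa> + 1)" using a[of i] by (auto simp: \<theta>_def max_def split: if_splits)
    \<comment> \<open>The midpoint between 1/\<kappa> and 1/a - 1. The interval is nonempty because
      a < \<kappa>/(\<kappa>+1), and \<beta> < 1/a - 1 means a < 1/(1+\<beta>).\<close>
    define \<beta> where "\<beta> = (1 / \<kappa> + (1 / a i - 1)) / 2"
    have "1 / \<kappa> < 1 / a i - 1" using ai a[of i] kappa_pos by (simp add: field_simps)
    then have beta: "1 / \<kappa> < \<beta>" "\<beta> < 1 / a i - 1" by (auto simp: \<beta>_def field_simps)
    have "0 < 1 / \<kappa>" using kappa_pos by simp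
    then have beta0: "0 < \<beta>" using beta(1) by linarith
    have "1 + \<beta> < 1 / a i" using beta(2) by linarith
    then have "a i < 1 / (1 + \<beta>)" using a[of i] beta0 by (simp add: field_simps)
    moreover obtain \<gamma> where "AE \<omega> in law. \<exists>K. regular_environment \<omega> K \<beta> \<gamma>"
      using AE_regular_environment[OF beta(1)] by auto
    ultimately show ?thesis
      using \<nu>(1) a[of i] regular_environment.quenched_upper_trap by (elim AE_mp) (intro AE_I2, blast)
  qed
  \<comment> \<open>Depth coefficients tending to 1/\<kappa> from below; the maximum with 1/(2
    \<kappa>) keeps them positive for small i.\<close>
  define t where "t i = max (1 / \<kappa> - 1 / (2 * (real i + 1))) (1 / (2 * \<kappa>))" for i
  have t: "0 < t i" "t i < 1 / \<kappa>" for i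
  proof -
    have "0 < 1 / (2 * \<kappa>)" "1 / (2 * \<kappa>) < 1 / \<kappa>" using kappa_pos by (simp_all add: divide_strict_left_mono)
    then show "0 < t i" "t i < 1 / \<kappa>" by (auto simp: t_def less_max_iff_disj)
  qed
  have bt: "1 - \<theta> * t i \<le> \<theta> + 1 / (2 * (real i + 1))" for i
  proof -
    \<comment> \<open>This is the inequality \<theta> \<ge> \<kappa>/(\<kappa>+1) in another
      form.\<close>
    have "1 - \<theta> / \<kappa> \<le> \<theta>" using \<theta>(4) kappa_pos by (simp add: field_simps)
    moreover have "\<theta> * (1 / \<kappa> - 1 / (2 * (real i + 1))) \<le> \<theta> * t i"
      using \<theta> by (intro mult_left_mono) (auto simp: t_def)
    moreover have "\<theta> * (1 / (2 * (real i + 1))) \<le> 1 * (1 / (2 * (real i + 1)))"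
      using \<theta> by (intro mult_right_mono) auto
    ultimately show ?thesis by (simp add: right_diff_distrib)
  qed
  have bf: "\<theta> + 1 / (2 * (real i + 1)) < b i" "\<theta> < \<theta> + 1 / (2 * (real i + 1))" for i
    by (simp_all add: b_def divide_strict_left_mono)
  \<comment> \<open>The exceptional null sets depend on i, but there are only countably many of
    them.\<close>
  have "AE \<omega> in law. \<forall>i. \<forall>\<^sub>F n in sequentially. measure (quenched_law \<omega>) (far_left_event \<nu> n) \<le> exp (- (real n powr a i))"
    unfolding AE_all_countable using upper by blast
  moreover have "AE \<omega> in law. \<forall>i. \<forall>\<^sub>F N in sequentially. \<exists>x d. - (2 * int N) \<le> x \<and> x \<le> d \<and> d \<le> - int N \<and>
     real N powr t i * weight \<omega> x \<le> weight \<omega> d"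
    unfolding AE_all_countable using AE_trap t by blast
  ultimately show ?thesis
    using AE_environment AE_straight_path[OF eps] unfolding \<theta>_def[symmetric]
  proof eventually_elim
    case (elim \<omega>)
    interpret environment \<omega> by (rule elim(3))
    from elim(4) obtain c C where c: "0 < c" "0 < C" and path: "\<And>m. c * exp (- (C * real m)) \<le> (\<Prod>i<m. 1 - \<omega> (- int i))"
      by blast
    show ?case
    proof (rule tendsto_ln_ln_exponent)
      show "a \<longlonglongrightarrow> \<theta>" "b \<longlonglongrightarrow> \<theta>"
        unfolding a_def b_def by (rule exponent_below exponent_above)+
      fix i
      show "\<forall>\<^sub>F n in sequentially. measure (quenched_law \<omega>) (far_left_event \<nu> n) \<le> exp (- (real n powr a i))"
        using elim(1) by blast
      show "\<forall>\<^sub>F n in sequentially. exp (- (real n powr b i)) \<le> measure (quenched_law \<omega>) (far_left_event \<nu> n)"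
        by (rule quenched_lower_trap[OF path c _ \<theta>(1-3) t(1)[of i] bt bf(2,1)])
           (use elim(2) in blast)
    qed
  qed
qed

section \<open>Annealed exponents\<close>

lemma measure_annealed_law:
  assumes "A \<in> sets path_space"
  shows "measure (annealed_law law) {(\<omega>, X). X \<in> A} = enn2real (\<integral>\<^sup>+\<omega>. ennreal (measure (quenched_law \<omega>) A) \<partial>law)"
proof -
  have "emeasure (quenched_law \<omega>) A = ennreal (measure (quenched_law \<omega>) A)" for \<omega>
    using finite_measure.emeasure_eq_measure[OF prob_space.finite_measure[OF prob_space_quenched_law]] by blast
  then show ?thesis
    unfolding measure_def[of "annealed_law law"] emeasure_annealed_law[OF sets_law assms] by (simp only:)
qed

lemma annealed_law_le:
  assumes "A \<in> sets path_space" and f: "\<And>\<omega>. environment \<omega> \<Longrightarrow> measure (quenched_law \<omega>) A \<le> f \<omega>"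
    and u: "(\<integral>\<^sup>+\<omega>. ennreal (f \<omega>) \<partial>law) \<le> ennreal u" "0 \<le> u"
  shows "measure (annealed_law law) {(\<omega>, X). X \<in> A} \<le> u"
proof -
  have "(\<integral>\<^sup>+\<omega>. ennreal (measure (quenched_law \<omega>) A) \<partial>law) \<le> (\<integral>\<^sup>+\<omega>. ennreal (f \<omega>) \<partial>law)"
    by (rule nn_integral_mono_AE, use AE_environment in eventually_elim) (rule ennreal_leI, rule f)
  also note u(1)
  finally show ?thesis
    unfolding measure_annealed_law[OF assms(1)] using u(2) by (intro enn2real_leI)
qed

lemma annealed_law_ge:
  assumes "A \<in> sets path_space" and f: "\<And>\<omega>. environment \<omega> \<Longrightarrow> f \<omega> \<le> measure (quenched_law \<omega>) A"
    and u: "ennreal u \<le> (\<integral>\<^sup>+\<omega>. ennreal (f \<omega>) \<partial>law)"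
  shows "u \<le> measure (annealed_law law) {(\<omega>, X). X \<in> A}"
proof -
  let ?I = "\<integral>\<^sup>+\<omega>. ennreal (measure (quenched_law \<omega>) A) \<partial>law"
  \<comment> \<open>\<open>enn2real\<close> sends infinity to 0, so its monotonicity needs this
    integral to be finite.\<close>
  have "?I \<le> (\<integral>\<^sup>+\<omega>. 1 \<partial>law)"
    by (rule nn_integral_mono) (simp add: prob_space.prob_le_1[OF prob_space_quenched_law])
  also have "\<dots> = 1" using product.P.emeasure_space_1 by simp
  finally have fin: "?I < top" by (rule le_less_trans) simp
  note u
  also have "(\<integral>\<^sup>+\<omega>. ennreal (f \<omega>) \<partial>law) \<le> ?I"
    by (rule nn_integral_mono_AE, use AE_environment in eventually_elim) (rule ennreal_leI, rule f)
  finally have "enn2real (ennreal u) \<le> enn2real ?I" using fin by (rule enn2real_mono)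
  moreover have "u \<le> enn2real (ennreal u)" by (cases "0 \<le> u") (auto intro: order_trans[OF _ enn2real_nonneg])
  ultimately show ?thesis unfolding measure_annealed_law[OF assms(1)] by linarith
qed

lemma annealed_upper:
  assumes \<nu>: "0 < \<nu>" and a: "0 < a" "a < \<nu>"
  shows "\<forall>\<^sub>F n in sequentially. measure (annealed_law law) {(\<omega>, X). X \<in> far_left_event \<nu> n} \<le> exp (- (real n powr a))"
    and "\<forall>\<^sub>F n in sequentially. measure (annealed_law law) {(\<omega>, X). X \<in> hitting_event \<nu> n} \<le> exp (- (real n powr a))"
proof -
  obtain C q where C: "0 < C" and q: "0 < q" "q < 1"
    and bound: "\<And>n m. (\<integral>\<^sup>+\<omega>. ennreal (walk_prob \<omega> n {..- int m} 0) \<partial>law) \<le> ennreal (C * q ^ m)"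
    using annealed_far_left by blast
  define c where "c = - ln q"
  have c: "0 < c" using q by (simp add: c_def)
  have q_level: "q ^ level \<nu> n \<le> exp (- (c * real n powr \<nu>))" for n
  proof -
    have "q ^ level \<nu> n = exp (real (level \<nu> n) * ln q)" using q by (simp add: exp_of_nat_mult)
    also have "\<dots> \<le> exp (- (c * real n powr \<nu>))"
      using level_bounds(1)[of n \<nu>] c mult_left_mono[of "real n powr \<nu>" "real (level \<nu> n)" c]
      by (simp add: c_def mult.commute)
    finally show ?thesis .
  qed
  have ev: "\<forall>\<^sub>F n in sequentially. real n * (C * exp (- (c * real n powr \<nu>))) \<le> exp (- (real n powr a))"
    using c C \<nu> a by real_asymp
  show "\<forall>\<^sub>F n in sequentially. measure (annealed_law law) {(\<omega>, X). X \<in> far_left_event \<nu> n} \<le> exp (- (real n powr a))"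
    using ev eventually_ge_at_top[of 1]
  proof eventually_elim
    case (elim n)
    have "measure (annealed_law law) {(\<omega>, X). X \<in> far_left_event \<nu> n} \<le> 1 * (C * q ^ level \<nu> n)"
      by (rule annealed_law_le[OF sets_far_left_event environment.far_left_upper]) (use bound C q in auto)
    also have "\<dots> \<le> real n * (C * exp (- (c * real n powr \<nu>)))"
      using elim(2) C q q_level by (intro mult_mono) auto
    finally show ?case using elim(1) by linarith
  qed
  show "\<forall>\<^sub>F n in sequentially. measure (annealed_law law) {(\<omega>, X). X \<in> hitting_event \<nu> n} \<le> exp (- (real n powr a))"
    using ev
  proof eventually_elim
    case (elim n)
    have "measure (annealed_law law) {(\<omega>, X). X \<in> hitting_event \<nu> n} \<le> real n * (C * q ^ level \<nu> n)"
    proof (rule annealed_law_le[OF sets_hitting_time_less environment.hitting_upper])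
      have meas: "(\<lambda>\<omega>. ennreal (walk_prob \<omega> k A x)) \<in> borel_measurable law" for k A x
      proof -
        have "(\<lambda>\<omega>. walk_prob \<omega> k A x) \<in> borel_measurable law"
          by (induction k arbitrary: x) (simp_all add: step_op_def)
        then show ?thesis by measurable
      qed
      have "(\<integral>\<^sup>+\<omega>. ennreal (\<Sum>k<n. walk_prob \<omega> k {..- int (level \<nu> n)} 0) \<partial>law)
          = (\<integral>\<^sup>+\<omega>. (\<Sum>k<n. ennreal (walk_prob \<omega> k {..- int (level \<nu> n)} 0)) \<partial>law)"
        by (rule nn_integral_cong_AE, use AE_environment in eventually_elim)
           (auto intro!: sum_ennreal[symmetric] environment.walk_prob_bounds(1))
      also have "\<dots> = (\<Sum>k<n. \<integral>\<^sup>+\<omega>. ennreal (walk_prob \<omega> k {..- int (level \<nu> n)} 0) \<partial>law)"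
        by (rule nn_integral_sum) (rule meas)
      also have "\<dots> \<le> (\<Sum>k<n. ennreal (C * q ^ level \<nu> n))" by (intro sum_mono bound)
      also have "\<dots> = ennreal (\<Sum>k<n. C * q ^ level \<nu> n)" using C q by (intro sum_ennreal) auto
      finally show "(\<integral>\<^sup>+\<omega>. ennreal (\<Sum>k<n. walk_prob \<omega> k {..- int (level \<nu> n)} 0) \<partial>law) \<le> ennreal (real n * (C * q ^ level \<nu> n))"
        by simp
    qed (use C q in auto)
    also have "\<dots> \<le> real n * (C * exp (- (c * real n powr \<nu>)))"
      using C q_level by (intro mult_left_mono) auto
    finally show ?case using elim by linarith
  qed
qed

lemma annealed_lower:
  assumes \<nu>: "0 < \<nu>" "\<nu> < 1" and e: "\<nu> < e"
  shows "\<forall>\<^sub>F n in sequentially. exp (- (real n powr e)) \<le> measure (annealed_law law) {(\<omega>, X). X \<in> far_left_event \<nu> n}"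
    and "\<forall>\<^sub>F n in sequentially. exp (- (real n powr e)) \<le> measure (annealed_law law) {(\<omega>, X). X \<in> hitting_event \<nu> n}"
proof -
  obtain \<delta> a where \<delta>: "0 < \<delta>" and a: "0 < a"
    and trap: "\<And>m k. ennreal (exp (- (a * (1 + real m))) * (1 - exp (- (\<delta> * real m))) ^ k)
        \<le> (\<integral>\<^sup>+\<omega>. ennreal (walk_prob \<omega> (2 * m + k) {..- int m} 0) \<partial>law)"
    and path: "\<And>m. ennreal (exp (- (a * (1 + real m)))) \<le> (\<integral>\<^sup>+\<omega>. ennreal (walk_prob \<omega> m {- int m} 0) \<partial>law)"
    using annealed_trap by blast
  \<comment> \<open>The trap has depth of order n^\<nu>, so the cost n exp(-\<delta> n^\<nu>) of
    staying tends to 0 and only the environment and the descent count; e > \<nu> absorbs the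
    constant a.\<close>
  have ev: "\<forall>\<^sub>F n in sequentially. exp (- (real n powr e)) \<le> exp (- (a * (real n powr \<nu> + 3))) * exp (- (2 * real n * exp (- (\<delta> * real n powr \<nu>))))"
    using \<delta> a \<nu> e by real_asymp
  have ev2: "\<forall>\<^sub>F n in sequentially. exp (- (\<delta> * real n powr \<nu>)) \<le> 1 / 2"
    using \<delta> \<nu> by real_asymp
  have ev3: "\<forall>\<^sub>F n in sequentially. 2 * (real n powr \<nu> + 2) < real n"
    using \<nu> by real_asymp
  show "\<forall>\<^sub>F n in sequentially. exp (- (real n powr e)) \<le> measure (annealed_law law) {(\<omega>, X). X \<in> far_left_event \<nu> n}"
    using ev ev2 ev3
  proof eventually_elim
    case (elim n)
    \<comment> \<open>One more than the level, so that -m lies strictly below -n^\<nu>.\<close>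
    define m where "m = level \<nu> n + 1"
    have m: "real n powr \<nu> + 1 \<le> real m" "real m \<le> real n powr \<nu> + 2"
      using level_bounds[where \<nu> = \<nu> and n = n] by (auto simp: m_def)
    have "real (2 * m) < real n" using m elim(3) by simp
    then have mn: "2 * m \<le> n" by (simp only: of_nat_less_iff)
    define q where "q = exp (- (\<delta> * real m))"
    have q_le: "q \<le> exp (- (\<delta> * real n powr \<nu>))" using m \<delta> by (simp add: q_def)
    have "0 \<le> q" by (simp add: q_def)
    moreover have "q \<le> 1 / 2" using q_le elim(2) by linarith
    ultimately have q: "0 \<le> q" "q \<le> 1 / 2" by auto
    have "exp (- (2 * real n * exp (- (\<delta> * real n powr \<nu>)))) \<le> exp (- (2 * q)) ^ (n - 2 * m)"
    proof -
      have "real (n - 2 * m) * (2 * q) \<le> real n * (2 * exp (- (\<delta> * real n powr \<nu>)))"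
        using q_le q by (intro mult_mono) auto
      then show ?thesis by (simp add: exp_of_nat_mult[symmetric] mult_ac)
    qed
    also have "\<dots> \<le> (1 - q) ^ (n - 2 * m)" using exp_le_one_minus[OF q] by (intro power_mono) auto
    finally have 1: "exp (- (2 * real n * exp (- (\<delta> * real n powr \<nu>)))) \<le> (1 - q) ^ (n - 2 * m)" .
    have 2: "exp (- (a * (real n powr \<nu> + 3))) \<le> exp (- (a * (1 + real m)))" using m a by simp
    have "exp (- (real n powr e)) \<le> exp (- (a * (1 + real m))) * (1 - q) ^ (n - 2 * m)"
      using mult_mono[OF 2 1] elim(1) by simp
    also have "\<dots> \<le> measure (annealed_law law) {(\<omega>, X). X \<in> far_left_event \<nu> n}"
    proof (rule annealed_law_ge[OF sets_far_left_event environment.far_left_lower])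
      show "real_of_int (- int m) < - (real n powr \<nu>)" using m by simp
      show "ennreal (exp (- (a * (1 + real m))) * (1 - q) ^ (n - 2 * m)) \<le> (\<integral>\<^sup>+\<omega>. ennreal (walk_prob \<omega> n {..- int m} 0) \<partial>law)"
        using trap[of m "n - 2 * m"] mn by (simp add: q_def)
    qed
    finally show ?case .
  qed
  show "\<forall>\<^sub>F n in sequentially. exp (- (real n powr e)) \<le> measure (annealed_law law) {(\<omega>, X). X \<in> hitting_event \<nu> n}"
    using ev ev3
  proof eventually_elim
    case (elim n)
    let ?m = "level \<nu> n"
    have m: "real ?m \<le> real n powr \<nu> + 1" by (rule level_bounds)
    moreover have "0 \<le> real n powr \<nu>" by simp
    moreover have "2 * real n powr \<nu> + 4 < real n" using elim(2) by (simp add: distrib_left)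
    ultimately have "real ?m < real n" by linarith
    then have mn: "?m < n" by simp
    have "exp (- (real n powr e)) \<le> exp (- (a * (real n powr \<nu> + 3))) * 1"
      using elim(1) by (rule order_trans) (intro mult_left_mono, auto)
    also have "\<dots> \<le> exp (- (a * (1 + real ?m)))" using m a by simp
    also have "\<dots> \<le> measure (annealed_law law) {(\<omega>, X). X \<in> hitting_event \<nu> n}"
      by (rule annealed_law_ge[OF sets_hitting_time_less environment.hitting_lower[OF _ mn] path])
    finally show ?case .
  qed
qed

lemma annealed_exponents:
  assumes \<nu>: "0 < \<nu>" "\<nu> < 1"
  shows "(\<lambda>n. ln (- ln (measure (annealed_law law) {(\<omega>, X). X \<in> far_left_event \<nu> n})) / ln (real n)) \<longlonglongrightarrow> \<nu>"
    and "(\<lambda>n. ln (- ln (measure (annealed_law law) {(\<omega>, X). X \<in> hitting_event \<nu> n})) / ln (real n)) \<longlonglongrightarrow> \<nu>"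
proof -
  have b: "\<nu> < \<nu> + 1 / (real i + 1)" for i by simp
  note up = annealed_upper[OF \<nu>(1) exponent_below_bounds[OF \<nu>(1)]]
  note lo = annealed_lower[OF \<nu> b]
  show "(\<lambda>n. ln (- ln (measure (annealed_law law) {(\<omega>, X). X \<in> far_left_event \<nu> n})) / ln (real n)) \<longlonglongrightarrow> \<nu>"
    by (rule tendsto_ln_ln_exponent[OF exponent_below exponent_above up(1) lo(1)])
  show "(\<lambda>n. ln (- ln (measure (annealed_law law) {(\<omega>, X). X \<in> hitting_event \<nu> n})) / ln (real n)) \<longlonglongrightarrow> \<nu>"
    by (rule tendsto_ln_ln_exponent[OF exponent_below exponent_above up(2) lo(2)])
qed

end

section \<open>Reduction to a product measure\<close>

theorem theorem1p4:
  fixes M :: "'a measure"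
    and W :: "int \<Rightarrow> 'a \<Rightarrow> real"
    and P :: "(int \<Rightarrow> real) measure"
    and \<kappa> \<epsilon>\<^sub>0 \<nu> :: real
  assumes "prob_space M"
    and "prob_space.indep_vars M (\<lambda>_. borel) W UNIV"
    and "\<And>i. distr M borel (W i) = distr M borel (W 0)"
    and "\<And>i s. s \<in> space M \<Longrightarrow> 0 < W i s \<and> W i s < 1"
    and "P = environment_law M W"
    and "(\<integral>\<omega>. ln (rho \<omega> 0) \<partial>P) < 0"
    and "\<kappa> > 0"
    and "(\<integral>\<omega>. rho \<omega> 0 powr \<kappa> \<partial>P) = 1"
    and "integrable P (\<lambda>\<omega>. rho \<omega> 0 powr \<kappa> * ln_plus (rho \<omega> 0))"
    and "\<And>k. k > 0 \<Longrightarrow> (\<integral>\<omega>. rho \<omega> 0 powr k \<partial>P) = 1 \<Longrightarrow>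
           integrable P (\<lambda>\<omega>. rho \<omega> 0 powr k * ln_plus (rho \<omega> 0)) \<Longrightarrow> k = \<kappa>"
    and "\<epsilon>\<^sub>0 > 0"
    and "integrable P (\<lambda>\<omega>. rho \<omega> 0 powr (- \<epsilon>\<^sub>0))"
    and "0 < \<nu>" and "\<nu> < 1"
  shows "(AE \<omega> in P.
            (\<lambda>n. ln (- ln (measure (quenched_law \<omega>)
                     {X. real_of_int (X n) < - (real n powr \<nu>)})) / ln (real n))
              \<longlonglongrightarrow> max \<nu> (\<kappa> / (\<kappa> + 1))) \<and>
         (\<lambda>n. ln (- ln (measure (annealed_law P)
                  {(\<omega>, X). real_of_int (X n) < - (real n powr \<nu>)})) / ln (real n))
           \<longlonglongrightarrow> \<nu> \<and>
         (\<lambda>n. ln (- ln (measure (annealed_law P)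
                  {(\<omega>, X). hitting_time (- (real n powr \<nu>)) X < enat n})) / ln (real n))
           \<longlonglongrightarrow> \<nu> \<and>
         (AE \<omega> in P.
            (\<lambda>n. ln (- ln (measure (quenched_law \<omega>)
                     {X. hitting_time (- (real n powr \<nu>)) X < enat n})) / ln (real n))
              \<longlonglongrightarrow> \<nu>)"
proof -
  interpret M: prob_space M by fact
  define \<mu> where "\<mu> = distr M borel (W 0)"
  have W [measurable]: "W i \<in> borel_measurable M" for i
    using assms(2) unfolding M.indep_vars_def by blast
  \<comment> \<open>Independence and equal distribution together make the law of the environment a
    power of the single-site law.\<close>
  have P: "P = Pi\<^sub>M UNIV (\<lambda>_. \<mu>)"
  proof -
    have "P = distr M env_space (\<lambda>s. \<lambda>i\<in>UNIV. W i s)"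
      by (simp add: assms(5) environment_law_def restrict_def)
    also have "\<dots> = Pi\<^sub>M UNIV (\<lambda>i. distr M borel (W i))"
      by (rule M.indep_vars_iff_distr_eq_PiM[THEN iffD1, OF _ W assms(2)]) simp
    also have "\<dots> = Pi\<^sub>M UNIV (\<lambda>_. \<mu>)"
      by (intro PiM_cong refl) (unfold \<mu>_def, rule assms(3))
    finally show ?thesis .
  qed
  have \<mu>_P: "\<mu> = distr P borel (\<lambda>\<omega>. \<omega> 0)"
  proof -
    have "(\<lambda>s i. W i s) \<in> M \<rightarrow>\<^sub>M env_space"
      using measurable_restrict[of UNIV W M "\<lambda>_. borel"] by (simp add: restrict_def)
    then show ?thesis
      unfolding assms(5) environment_law_def \<mu>_def
      by (subst distr_distr) (simp_all add: comp_def)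
  qed
  have meas_P: "(\<lambda>\<omega>. \<omega> 0) \<in> borel_measurable P"
    unfolding assms(5) environment_law_def by simp
  \<comment> \<open>The hypotheses concern \<rho> at site 0 under P and have to be moved to the
    single-site law.\<close>
  have transfer_integral: "(\<integral>x. f x \<partial>\<mu>) = (\<integral>\<omega>. f (\<omega> 0) \<partial>P)"
    and transfer_integrable: "integrable \<mu> f \<longleftrightarrow> integrable P (\<lambda>\<omega>. f (\<omega> 0))"
    if "f \<in> borel_measurable borel" for f :: "real \<Rightarrow> real"
    unfolding \<mu>_P by (rule integral_distr[OF meas_P that], rule integrable_distr_eq[OF meas_P that])
  interpret iid_environment \<mu> \<kappa>
  proof (intro iid_environment.intro iid_environment_axioms.intro)
    show "prob_space \<mu>" unfolding \<mu>_def by (rule M.prob_space_distr) measurable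
    show "sets \<mu> = sets borel" by (simp add: \<mu>_def)
    show "AE x in \<mu>. 0 < x \<and> x < 1"
      unfolding \<mu>_def using assms(4) by (subst AE_distr_iff) auto
    have "(\<lambda>x. ln (site_ratio x)) \<in> borel_measurable borel" by measurable
    then show "(\<integral>x. ln (site_ratio x) \<partial>\<mu>) < 0"
      using assms(6) by (simp add: transfer_integral rho_site_ratio)
    have "(\<lambda>x. site_ratio x powr \<kappa>) \<in> borel_measurable borel" by measurable
    then show "(\<integral>x. site_ratio x powr \<kappa> \<partial>\<mu>) = 1"
      using assms(8) by (simp add: transfer_integral rho_site_ratio)
  qed (fact assms(7))
  have "(\<lambda>x. site_ratio x powr (- \<epsilon>\<^sub>0)) \<in> borel_measurable borel" by measurable
  then have eps: "integrable \<mu> (\<lambda>x. site_ratio x powr (- \<epsilon>\<^sub>0))"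
    using assms(12) by (simp add: transfer_integrable rho_site_ratio)
  note \<nu> = \<open>0 < \<nu>\<close> \<open>\<nu> < 1\<close>
  show ?thesis
    unfolding P
    using quenched_far_left_exponent[OF assms(11) eps \<nu>] annealed_exponents[OF \<nu>, unfolded mem_Collect_eq]
      quenched_hitting_exponent[OF assms(11) eps \<nu>]
    by (intro conjI)
qed

end
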